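(* Let $(W,\mathfrak h)$ be an irreducible complex reflection group with $n=\dim\mathfrak h>1$, let $t\in\mathbb C$ with $t\ne0$, and let $c:\mathcal S\to\mathbb C$ be a conjugation-invariant function. Then the centre of $H_{t,c}^{\mathfrak{gl}(n)}$ equals $\mathbb C[\mathrm{eu}_c]\otimes\mathbb CZ(W)$.
   Context: $\mathfrak h$ is a finite-dimensional complex vector space. A complex reflection is a finite-order $s\in GL(\mathfrak h)$ with $\operatorname{rank}(s-1)=1$. A complex reflection group $(W,\mathfrak h)$ is a finite subgroup $W\subset GL(\mathfrak h)$ generated by complex reflections; it is irreducible if $\mathfrak h$ is an irreducible representation. $\mathcal S$ is the set of complex reflections in $W$. For $s\in\mathcal S$, $\alpha_s\in\mathfrak h^*$ is such that $\ker\alpha_s$ is the hyperplane fixed by $s$, $\lambda_s$ is defined by $s(\alpha_s)=\lambda_s\alpha_s$, and $\alpha_s^\vee\in\mathfrak h$ is an eigenvector of $s$ with eigenvalue $\ne1$. The rational Cherednik algebra $H_{t,c}$ is the quotient of $T(\mathfrak h\oplus\mathfrak h^* )\rtimes W$ by $[x,x']=0$, $[y,y']=0$, $[y,x]=t\,x(y)-\sum_{s\in\mathcal S}\frac{2c_s}{\alpha_s(\alpha_s^\vee)}x(\alpha_s^\vee)\alpha_s(y)\,s$ for $x,x'\in\mathfrak h^*$, $y,y'\in\mathfrak h$. Let $y_1,\dots,y_n$ be a basis of $\mathfrak h$ with dual basis $x_1,\dots,x_n$ of $\mathfrak h^*$. $H_{t,c}^{\mathfrak{gl}(n)}$ is the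 subalgebra of $H_{t,c}$ generated by all $x_iy_j$ and $W$. The Euler element is $\mathrm{eu}_c=\sum_{i=1}^nx_iy_i-\sum_{s\in\mathcal S}\frac{2c_s}{1-\lambda_s}s$. $\mathbb CZ(W)$ is the group algebra of the centre $Z(W)$ of $W$; the tensor product is identified with the subalgebra generated by $\mathrm{eu}_c$ and $Z(W)$ via multiplication. *)

theory Defs
  imports
    "HOL-Analysis.Analysis"
    "HOL-Algebra.Algebra"
    "HOL-Library.Poly_Mapping"
    "HOL-Computational_Algebra.Polynomial"
begin

section \<open>Complex reflection groups\<close>

text \<open>The space \<open>\<hh>\<close> is \<open>complex ^ 'n\<close> and an element of \<open>GL(\<hh>)\<close> is an invertible matrix.
  A functional is given by its row of coefficients, again in \<open>complex ^ 'n\<close>: the row \<open>\<xi>\<close> stands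
  for \<open>v \<mapsto> \<Sum>\<^sub>i \<xi>\<^sub>i v\<^sub>i\<close>.\<close>

definition pairing :: "complex ^ 'n \<Rightarrow> complex ^ 'n \<Rightarrow> complex" where
  "pairing \<xi> v = (\<Sum>i\<in>UNIV. \<xi> $ i * v $ i)"

text \<open>The contragredient action: \<open>(w \<xi>)(v) = \<xi>(w\<^sup>-\<^sup>1 v)\<close>.\<close>

definition dual_act :: "complex ^ 'n ^ 'n \<Rightarrow> complex ^ 'n \<Rightarrow> complex ^ 'n" where
  "dual_act w \<xi> = \<xi> v* matrix_inv w"

definition GL :: "(complex ^ 'n ^ 'n) monoid" where
  "GL = \<lparr>carrier = {A. invertible A}, mult = (**), one = mat 1\<rparr>"

definition complex_reflection :: "complex ^ 'n ^ 'n \<Rightarrow> bool" where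
  "complex_reflection s \<longleftrightarrow>
     s \<in> carrier GL \<and> (\<exists>k::nat. k > 0 \<and> s [^]\<^bsub>GL\<^esub> k = \<one>\<^bsub>GL\<^esub>) \<and> rank (s - mat 1) = 1"

definition reflections :: "(complex ^ 'n ^ 'n) set \<Rightarrow> (complex ^ 'n ^ 'n) set" where
  "reflections W = {s \<in> W. complex_reflection s}"

definition complex_reflection_group :: "(complex ^ 'n ^ 'n) set \<Rightarrow> bool" where
  "complex_reflection_group W \<longleftrightarrow>
     finite W \<and> subgroup W GL \<and> W = generate GL (reflections W)"

definition irreducible_rep :: "(complex ^ 'n ^ 'n) set \<Rightarrow> bool" where
  "irreducible_rep W \<longleftrightarrow>
     (\<forall>U. vec.subspace U \<and> (\<forall>w\<in>W. \<forall>u\<in>U. w *v u \<in> U) \<longrightarrow> U = {0} \<or> U = UNIV)"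

definition group_centre :: "(complex ^ 'n ^ 'n) set \<Rightarrow> (complex ^ 'n ^ 'n) set" where
  "group_centre W = {z \<in> W. \<forall>w\<in>W. z ** w = w ** z}"

definition conj_invariant :: "(complex ^ 'n ^ 'n) set \<Rightarrow> (complex ^ 'n ^ 'n \<Rightarrow> complex) \<Rightarrow> bool" where
  "conj_invariant W c \<longleftrightarrow>
     (\<forall>s\<in>reflections W. \<forall>w\<in>W. c (w ** s ** matrix_inv w) = c s)"

text \<open>The data \<open>\<alpha>\<^sub>s\<close>, \<open>\<alpha>\<^sub>s\<^sup>\<or>\<close>, \<open>\<lambda>\<^sub>s\<close>; the vectors are determined by \<open>s\<close> only up to a scalar,
  so they are kept as parameters.\<close>

definition reflection_data ::
  "(complex ^ 'n ^ 'n) set \<Rightarrow> (complex ^ 'n ^ 'n \<Rightarrow> complex ^ 'n) \<Rightarrow>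
   (complex ^ 'n ^ 'n \<Rightarrow> complex ^ 'n) \<Rightarrow> (complex ^ 'n ^ 'n \<Rightarrow> complex) \<Rightarrow> bool" where
  "reflection_data W \<alpha> \<alpha>v lam \<longleftrightarrow>
     (\<forall>s\<in>reflections W.
        {v. pairing (\<alpha> s) v = 0} = {v. s *v v = v} \<and>
        \<alpha>v s \<noteq> 0 \<and> (\<exists>\<mu>. \<mu> \<noteq> 1 \<and> s *v \<alpha>v s = \<mu> *s \<alpha>v s) \<and>
        dual_act s (\<alpha> s) = lam s *s \<alpha> s)"

definition dual_bases :: "('n \<Rightarrow> complex ^ 'n) \<Rightarrow> ('n \<Rightarrow> complex ^ 'n) \<Rightarrow> bool" where
  "dual_bases y x \<longleftrightarrow>
     inj y \<and> vec.independent (range y) \<and> vec.span (range y) = UNIV \<and>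
     (\<forall>i j. pairing (x i) (y j) = (if i = j then 1 else 0))"


section \<open>The tensor algebra of \<open>\<hh> \<oplus> \<hh>\<^sup>*\<close>\<close>

text \<open>As the standard basis of \<open>\<hh>\<close> and the coordinate functionals form a basis of \<open>\<hh> \<oplus> \<hh>\<^sup>*\<close>,
  its tensor algebra is the free associative algebra on them, that is, the algebra over
  \<open>complex\<close> of the free monoid of words in the letters \<open>VecL i\<close> and \<open>CovL i\<close>. The product of
  \<open>\<Rightarrow>\<^sub>0\<close> is the convolution product coming from the additively written monoid of words.\<close>

datatype 'a free_word = Word (letters: "'a list")

instantiation free_word :: (type) monoid_add
begin

definition zero_free_word :: "'a free_word" where
  "0 = Word []"

definition plus_free_word :: "'a free_word \<Rightarrow> 'a free_word \<Rightarrow> 'a free_word" where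
  "u + v = Word (letters u @ letters v)"

instance
  by standard (simp_all add: zero_free_word_def plus_free_word_def)

end

datatype 'n letter = VecL 'n | CovL 'n

type_synonym 'n tensor = "'n letter free_word \<Rightarrow>\<^sub>0 complex"

definition const_T :: "complex \<Rightarrow> 'n tensor" where
  "const_T a = Poly_Mapping.single 0 a"

definition letter_T :: "'n letter \<Rightarrow> 'n tensor" where
  "letter_T l = Poly_Mapping.single (Word [l]) 1"

definition vec_T :: "complex ^ 'n \<Rightarrow> 'n tensor" where
  "vec_T v = (\<Sum>i\<in>UNIV. const_T (v $ i) * letter_T (VecL i))"

definition cov_T :: "complex ^ 'n \<Rightarrow> 'n tensor" where
  "cov_T \<xi> = (\<Sum>i\<in>UNIV. const_T (\<xi> $ i) * letter_T (CovL i))"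

text \<open>The action of \<open>w\<close> by algebra automorphisms extending its action on \<open>\<hh> \<oplus> \<hh>\<^sup>*\<close>.\<close>

fun letter_act :: "complex ^ 'n ^ 'n \<Rightarrow> 'n letter \<Rightarrow> 'n tensor" where
  "letter_act w (VecL i) = vec_T (w *v axis i 1)"
| "letter_act w (CovL i) = cov_T (dual_act w (axis i 1))"

definition tensor_act :: "complex ^ 'n ^ 'n \<Rightarrow> 'n tensor \<Rightarrow> 'n tensor" where
  "tensor_act w p =
     (\<Sum>u\<in>Poly_Mapping.keys p. const_T (Poly_Mapping.lookup p u) * prod_list (map (letter_act w) (letters u)))"


section \<open>The algebra \<open>T(\<hh> \<oplus> \<hh>\<^sup>*) \<rtimes> W\<close>\<close>

text \<open>A function \<open>f\<close> stands for \<open>\<Sum>\<^sub>w f(w) w\<close>, and \<open>(p u) (q v) = p u(q) u v\<close>. The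
  group \<open>W\<close> is finite.\<close>

type_synonym 'n smash_elt = "complex ^ 'n ^ 'n \<Rightarrow> 'n tensor"

definition smash :: "(complex ^ 'n ^ 'n) set \<Rightarrow> 'n smash_elt ring" where
  "smash W =
     \<lparr>carrier = {f. \<forall>w. w \<notin> W \<longrightarrow> f w = 0},
      mult = (\<lambda>f g w. \<Sum>(u, v) \<in> {(u, v) \<in> W \<times> W. u ** v = w}. f u * tensor_act u (g v)),
      one = (\<lambda>w. if w = mat 1 then 1 else 0),
      ring.zero = (\<lambda>w. 0),
      ring.add = (\<lambda>f g w. f w + g w)\<rparr>"

definition smash_term :: "'n tensor \<Rightarrow> complex ^ 'n ^ 'n \<Rightarrow> 'n smash_elt" where
  "smash_term p w = (\<lambda>u. if u = w then p else 0)"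

definition const_A :: "complex \<Rightarrow> ('n::finite) smash_elt" where
  "const_A a = smash_term (const_T a) (mat 1)"

definition vec_A :: "complex ^ 'n \<Rightarrow> 'n smash_elt" where
  "vec_A v = smash_term (vec_T v) (mat 1)"

definition cov_A :: "complex ^ 'n \<Rightarrow> 'n smash_elt" where
  "cov_A \<xi> = smash_term (cov_T \<xi>) (mat 1)"

definition grp_A :: "complex ^ 'n ^ 'n \<Rightarrow> 'n smash_elt" where
  "grp_A w = smash_term 1 w"


section \<open>The rational Cherednik algebra\<close>

definition commutator :: "('a, 'b) ring_scheme \<Rightarrow> 'a \<Rightarrow> 'a \<Rightarrow> 'a" where
  "commutator R a b = a \<otimes>\<^bsub>R\<^esub> b \<ominus>\<^bsub>R\<^esub> b \<otimes>\<^bsub>R\<^esub> a"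

definition cherednik_rhs ::
  "(complex ^ 'n ^ 'n) set \<Rightarrow> complex \<Rightarrow> (complex ^ 'n ^ 'n \<Rightarrow> complex) \<Rightarrow>
   (complex ^ 'n ^ 'n \<Rightarrow> complex ^ 'n) \<Rightarrow> (complex ^ 'n ^ 'n \<Rightarrow> complex ^ 'n) \<Rightarrow>
   complex ^ 'n \<Rightarrow> complex ^ 'n \<Rightarrow> 'n smash_elt" where
  "cherednik_rhs W t c \<alpha> \<alpha>v y x =
     const_A (t * pairing x y) \<ominus>\<^bsub>smash W\<^esub>
     (\<Oplus>\<^bsub>smash W\<^esub>s\<in>reflections W.
        const_A (2 * c s / pairing (\<alpha> s) (\<alpha>v s) * pairing x (\<alpha>v s) * pairing (\<alpha> s) y)
          \<otimes>\<^bsub>smash W\<^esub> grp_A s)"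

definition cherednik_relations ::
  "(complex ^ 'n ^ 'n) set \<Rightarrow> complex \<Rightarrow> (complex ^ 'n ^ 'n \<Rightarrow> complex) \<Rightarrow>
   (complex ^ 'n ^ 'n \<Rightarrow> complex ^ 'n) \<Rightarrow> (complex ^ 'n ^ 'n \<Rightarrow> complex ^ 'n) \<Rightarrow>
   'n smash_elt set" where
  "cherednik_relations W t c \<alpha> \<alpha>v =
     {commutator (smash W) (cov_A x) (cov_A x') | x x'. True} \<union>
     {commutator (smash W) (vec_A y) (vec_A y') | y y'. True} \<union>
     {commutator (smash W) (vec_A y) (cov_A x) \<ominus>\<^bsub>smash W\<^esub> cherednik_rhs W t c \<alpha> \<alpha>v y x
        | x y. True}"

definition cherednik_ideal ::
  "(complex ^ 'n ^ 'n) set \<Rightarrow> complex \<Rightarrow> (complex ^ 'n ^ 'n \<Rightarrow> complex) \<Rightarrow>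
   (complex ^ 'n ^ 'n \<Rightarrow> complex ^ 'n) \<Rightarrow> (complex ^ 'n ^ 'n \<Rightarrow> complex ^ 'n) \<Rightarrow>
   'n smash_elt set" where
  "cherednik_ideal W t c \<alpha> \<alpha>v = Idl\<^bsub>smash W\<^esub> (cherednik_relations W t c \<alpha> \<alpha>v)"

definition cherednik ::
  "(complex ^ 'n ^ 'n) set \<Rightarrow> complex \<Rightarrow> (complex ^ 'n ^ 'n \<Rightarrow> complex) \<Rightarrow>
   (complex ^ 'n ^ 'n \<Rightarrow> complex ^ 'n) \<Rightarrow> (complex ^ 'n ^ 'n \<Rightarrow> complex ^ 'n) \<Rightarrow>
   'n smash_elt set ring" where
  "cherednik W t c \<alpha> \<alpha>v = smash W Quot cherednik_ideal W t c \<alpha> \<alpha>v"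

definition cherednik_proj ::
  "(complex ^ 'n ^ 'n) set \<Rightarrow> complex \<Rightarrow> (complex ^ 'n ^ 'n \<Rightarrow> complex) \<Rightarrow>
   (complex ^ 'n ^ 'n \<Rightarrow> complex ^ 'n) \<Rightarrow> (complex ^ 'n ^ 'n \<Rightarrow> complex ^ 'n) \<Rightarrow>
   'n smash_elt \<Rightarrow> 'n smash_elt set" where
  "cherednik_proj W t c \<alpha> \<alpha>v a = cherednik_ideal W t c \<alpha> \<alpha>v +>\<^bsub>smash W\<^esub> a"

text \<open>The unital \<open>complex\<close>-subalgebra generated by a set: the subring generated by the set and
  all scalars.\<close>

definition generated_subalgebra ::
  "(complex ^ 'n ^ 'n) set \<Rightarrow> complex \<Rightarrow> (complex ^ 'n ^ 'n \<Rightarrow> complex) \<Rightarrow>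
   (complex ^ 'n ^ 'n \<Rightarrow> complex ^ 'n) \<Rightarrow> (complex ^ 'n ^ 'n \<Rightarrow> complex ^ 'n) \<Rightarrow>
   'n smash_elt set set \<Rightarrow> 'n smash_elt set set" where
  "generated_subalgebra W t c \<alpha> \<alpha>v G =
     generate_ring (cherednik W t c \<alpha> \<alpha>v)
       (range (\<lambda>a. cherednik_proj W t c \<alpha> \<alpha>v (const_A a)) \<union> G)"

definition cherednik_gl ::
  "(complex ^ 'n ^ 'n) set \<Rightarrow> complex \<Rightarrow> (complex ^ 'n ^ 'n \<Rightarrow> complex) \<Rightarrow>
   (complex ^ 'n ^ 'n \<Rightarrow> complex ^ 'n) \<Rightarrow> (complex ^ 'n ^ 'n \<Rightarrow> complex ^ 'n) \<Rightarrow>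
   ('n \<Rightarrow> complex ^ 'n) \<Rightarrow> ('n \<Rightarrow> complex ^ 'n) \<Rightarrow> 'n smash_elt set set" where
  "cherednik_gl W t c \<alpha> \<alpha>v y x =
     generated_subalgebra W t c \<alpha> \<alpha>v
       ({cherednik_proj W t c \<alpha> \<alpha>v (cov_A (x i))
           \<otimes>\<^bsub>cherednik W t c \<alpha> \<alpha>v\<^esub> cherednik_proj W t c \<alpha> \<alpha>v (vec_A (y j)) | i j. True} \<union>
        (\<lambda>w. cherednik_proj W t c \<alpha> \<alpha>v (grp_A w)) ` W)"

definition euler ::
  "(complex ^ 'n ^ 'n) set \<Rightarrow> complex \<Rightarrow> (complex ^ 'n ^ 'n \<Rightarrow> complex) \<Rightarrow>
   (complex ^ 'n ^ 'n \<Rightarrow> complex ^ 'n) \<Rightarrow> (complex ^ 'n ^ 'n \<Rightarrow> complex ^ 'n) \<Rightarrow>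
   (complex ^ 'n ^ 'n \<Rightarrow> complex) \<Rightarrow>
   ('n \<Rightarrow> complex ^ 'n) \<Rightarrow> ('n \<Rightarrow> complex ^ 'n) \<Rightarrow> 'n smash_elt set" where
  "euler W t c \<alpha> \<alpha>v lam y x =
     (\<Oplus>\<^bsub>cherednik W t c \<alpha> \<alpha>v\<^esub>i\<in>UNIV.
        cherednik_proj W t c \<alpha> \<alpha>v (cov_A (x i))
          \<otimes>\<^bsub>cherednik W t c \<alpha> \<alpha>v\<^esub> cherednik_proj W t c \<alpha> \<alpha>v (vec_A (y i)))
     \<ominus>\<^bsub>cherednik W t c \<alpha> \<alpha>v\<^esub>
     (\<Oplus>\<^bsub>cherednik W t c \<alpha> \<alpha>v\<^esub>s\<in>reflections W.
        cherednik_proj W t c \<alpha> \<alpha>v (const_A (2 * c s / (1 - lam s)))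
          \<otimes>\<^bsub>cherednik W t c \<alpha> \<alpha>v\<^esub> cherednik_proj W t c \<alpha> \<alpha>v (grp_A s))"

definition centre_of :: "('a, 'b) ring_scheme \<Rightarrow> 'a set \<Rightarrow> 'a set" where
  "centre_of R B = {z \<in> B. \<forall>b\<in>B. z \<otimes>\<^bsub>R\<^esub> b = b \<otimes>\<^bsub>R\<^esub> z}"

text \<open>Since the elements of \<open>Z = Z(W)\<close> form a basis of \<open>\<complex>Z\<close>, the tensor product of the
  polynomial algebra \<open>\<complex>[e]\<close> with \<open>\<complex>Z\<close> is the space of families of polynomials
  indexed by \<open>Z\<close>. The family \<open>f\<close> stands for \<open>\<Sum>\<^sub>z f\<^sub>z \<otimes> z\<close>.\<close>

definition poly_tensor_group_algebra ::
  "(complex ^ 'n ^ 'n) set \<Rightarrow> (complex ^ 'n ^ 'n \<Rightarrow> complex poly) set" where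
  "poly_tensor_group_algebra Z = {f. \<forall>z. z \<notin> Z \<longrightarrow> f z = 0}"

text \<open>The multiplication map \<open>\<Sum>\<^sub>z f\<^sub>z \<otimes> z \<mapsto> \<Sum>\<^sub>z f\<^sub>z(e) z\<close> into the Cherednik algebra.\<close>

definition multiplication_map ::
  "(complex ^ 'n ^ 'n) set \<Rightarrow> complex \<Rightarrow> (complex ^ 'n ^ 'n \<Rightarrow> complex) \<Rightarrow>
   (complex ^ 'n ^ 'n \<Rightarrow> complex ^ 'n) \<Rightarrow> (complex ^ 'n ^ 'n \<Rightarrow> complex ^ 'n) \<Rightarrow>
   'n smash_elt set \<Rightarrow> (complex ^ 'n ^ 'n) set \<Rightarrow>
   (complex ^ 'n ^ 'n \<Rightarrow> complex poly) \<Rightarrow> 'n smash_elt set" where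
  "multiplication_map W t c \<alpha> \<alpha>v e Z f =
     (\<Oplus>\<^bsub>cherednik W t c \<alpha> \<alpha>v\<^esub>z\<in>Z.
        (\<Oplus>\<^bsub>cherednik W t c \<alpha> \<alpha>v\<^esub>k\<in>{..Polynomial.degree (f z)}.
           cherednik_proj W t c \<alpha> \<alpha>v (const_A (Polynomial.coeff (f z) k))
             \<otimes>\<^bsub>cherednik W t c \<alpha> \<alpha>v\<^esub> e [^]\<^bsub>cherednik W t c \<alpha> \<alpha>v\<^esub> k)
        \<otimes>\<^bsub>cherednik W t c \<alpha> \<alpha>v\<^esub> cherednik_proj W t c \<alpha> \<alpha>v (grp_A z))"

end

theory Submission
  imports
    Defs
    "HOL-Library.Function_Algebras"
    "HOL-Computational_Algebra.Fundamental_Theorem_Algebra"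
begin

text \<open>
  Let \<open>H\<close> be the Cherednik algebra and let \<open>X\<^sub>\<xi>\<close>, \<open>Y\<^sub>v\<close> stand for the images of \<open>\<xi> \<in> \<hh>\<^sup>*\<close> and
  \<open>v \<in> \<hh>\<close> in it. The proof compares symbols of elements of \<open>H\<close>, so it rests on the
  Poincare-Birkhoff-Witt theorem for \<open>H\<close>, which comes first.

  \<^emph>\<open>Normal forms.\<close> Every element of \<open>H\<close> is a combination of ordered products of \<open>x\<close>'s, then
  \<open>y\<close>'s, then one \<open>w \<in> W\<close>. To see that the coefficients are unique, let \<open>H\<close> act on the space of formal
  combinations \<open>n\<close> of such products: \<open>x\<close> multiplies, \<open>w\<close> acts on all three factors, and \<open>y\<close> acts
  by the operator (\<open>dunkl\<close>) that multiplies products without \<open>x\<close> and commutes past an \<open>x\<close> as the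
  relation for \<open>[y, x]\<close> demands. That the order of the \<open>x\<close>'s does not matter, and that the operators
  of two \<open>y\<close>'s commute, comes down to two symmetry properties of a single reflection; for the
  second, the commutator of two Dunkl operators commutes with all \<open>x\<close> and vanishes on products
  without \<open>x\<close>, hence vanishes. Multiplying out a formal combination in \<open>H\<close> is compatible with the
  actions, so \<open>a\<close> is recovered from \<open>a \<cdot> 1\<close> (\<open>normal_form\<close>), and the action is faithful
  (\<open>faithful\<close>). From then on \<open>H\<close> is a ring of operators.

  \<^emph>\<open>Upper bound for the centre.\<close> Let \<open>z\<close> commute with all \<open>x\<^sub>i y\<^sub>j\<close>, let \<open>m\<close> be the largest number of
  \<open>y\<close>'s in its normal form and \<open>P\<^sub>u u\<close> the part with \<open>m\<close> letters \<open>y\<close> and group element \<open>u\<close>. In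
  \<open>[z, x\<^sub>i y\<^sub>j]\<close> the part with \<open>m + 1\<close> letters \<open>y\<close> at \<open>u\<close> is \<open>P\<^sub>u \<cdot> (u x\<^sub>i \<cdot> u y\<^sub>j - x\<^sub>i y\<^sub>j)\<close>; as
  polynomials have no zero divisors, \<open>P\<^sub>u = 0\<close> unless \<open>u\<close> is a scalar matrix. Now look at the part with \<open>m\<close>
  letters \<open>y\<close> at a scalar \<open>u\<close>. A correction term caused by a reflection \<open>s\<close> moves the group element
  from \<open>s\<^sup>-\<^sup>1 u\<close> to \<open>u\<close>, and \<open>s\<^sup>-\<^sup>1 u\<close> is not scalar because \<open>n > 1\<close>, so it contributes nothing.
  What remains is \<open>t\<close> times the Poisson bracket of \<open>P\<^sub>u\<close> with \<open>x\<^sub>i y\<^sub>j\<close>. As \<open>t \<noteq> 0\<close>, the polynomial \<open>P\<^sub>u\<close> is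
  invariant under \<open>gl(n)\<close> and therefore a multiple of \<open>(\<Sum>\<^sub>i x\<^sub>i y\<^sub>i)\<^sup>m\<close>, the symbol of \<open>eu\<^sup>m\<close>. Subtracting
  the corresponding multiples of \<open>eu\<^sup>m u\<close> lowers \<open>m\<close> (\<open>symbol_of_commuting\<close>,
  \<open>commuting_is_tensor_eval\<close>).

  \<^emph>\<open>Lower bound and freeness.\<close> Since \<open>[eu, x] = t x\<close> and \<open>[eu, y] = - t y\<close>, the Euler element commutes with
  \<open>x\<^sub>i y\<^sub>j\<close>, and it commutes with \<open>W\<close>. By Schur's lemma the centre of \<open>W\<close> consists of the scalar
  matrices in \<open>W\<close>, which fix every \<open>x\<^sub>i y\<^sub>j\<close>. The elements \<open>eu\<^sup>k w\<close> with \<open>w\<close> scalar are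
  linearly independent because their symbols are (\<open>tensor_eval_inj\<close>).\<close>

section \<open>Linear maps out of spaces of finitely supported functions\<close>

abbreviation coef :: "('k \<Rightarrow>\<^sub>0 complex) \<Rightarrow> 'k \<Rightarrow> complex" where
  "coef \<equiv> Poly_Mapping.lookup"

abbreviation sgl :: "'k \<Rightarrow> complex \<Rightarrow> 'k \<Rightarrow>\<^sub>0 complex" where
  "sgl \<equiv> Poly_Mapping.single"

definition psc :: "complex \<Rightarrow> ('k \<Rightarrow>\<^sub>0 complex) \<Rightarrow> 'k \<Rightarrow>\<^sub>0 complex" where
  "psc a p = Poly_Mapping.map ((*) a) p"

lemma coef_psc [simp]: "coef (psc a p) k = a * coef p k"
  by (simp add: psc_def Poly_Mapping.map.rep_eq when_def)

lemma psc_single [simp]: "psc a (sgl k b) = sgl k (a * b)"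
  by (rule poly_mapping_eqI) (simp add: lookup_single when_def)

lemma psc_add_right: "psc a (p + q) = psc a p + psc a q"
  by (rule poly_mapping_eqI) (simp add: lookup_add distrib_left)

lemma poly_mapping_sum_single: "p = (\<Sum>k\<in>Poly_Mapping.keys p. sgl k (coef p k))"
proof (rule poly_mapping_eqI)
  fix k
  have "coef (\<Sum>j\<in>Poly_Mapping.keys p. sgl j (coef p j)) k
      = (\<Sum>j\<in>Poly_Mapping.keys p. if j = k then coef p k else 0)"
    unfolding lookup_sum by (rule sum.cong) (auto simp: lookup_single when_def)
  then show "coef p k = coef (\<Sum>j\<in>Poly_Mapping.keys p. sgl j (coef p j)) k"
    by (simp add: sum.delta in_keys_iff)
qed

lemma pm_induct [case_names single add]:
  assumes "\<And>k a. P (sgl k a)" "\<And>p q. P p \<Longrightarrow> P q \<Longrightarrow> P (p + q)"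
  shows "P p"
proof -
  have "P (\<Sum>k\<in>A. sgl k (coef p k))" if "finite A" for A
    using that
  proof (induction A rule: finite_induct)
    case empty
    then show ?case using assms(1)[of undefined 0] by simp
  qed (simp_all add: assms)
  then show ?thesis using poly_mapping_sum_single[of p] by (metis finite_keys)
qed

locale complex_scaling = Modules.module scale
  for scale :: "complex \<Rightarrow> 'b :: ab_group_add \<Rightarrow> 'b"
begin

definition lext :: "('k \<Rightarrow> 'b) \<Rightarrow> ('k \<Rightarrow>\<^sub>0 complex) \<Rightarrow> 'b" where
  "lext F p = (\<Sum>k\<in>Poly_Mapping.keys p. scale (coef p k) (F k))"

lemma lext_superset:
  assumes "finite A" "Poly_Mapping.keys p \<subseteq> A"
  shows "lext F p = (\<Sum>k\<in>A. scale (coef p k) (F k))"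
  unfolding lext_def by (rule sum.mono_neutral_left) (use assms in \<open>auto simp: in_keys_iff\<close>)

lemma lext_zero [simp]: "lext F 0 = 0"
  by (simp add: lext_def)

lemma lext_add: "lext F (p + q) = lext F p + lext F q"
proof -
  let ?A = "Poly_Mapping.keys p \<union> Poly_Mapping.keys q"
  have "Poly_Mapping.keys (p + q) \<subseteq> ?A" by (rule keys_add)
  then show ?thesis
    by (simp add: lext_superset[of ?A] lookup_add scale_left_distrib sum.distrib)
qed

lemma lext_single [simp]: "lext F (sgl k a) = scale a (F k)"
  by (simp add: lext_superset[of "{k}"])

lemma lext_psc: "lext F (psc a p) = scale a (lext F p)"
  by (induction p rule: pm_induct)
    (simp_all add: lext_add scale_right_distrib psc_add_right)

end

interpretation pm: complex_scaling "psc :: complex \<Rightarrow> ('k \<Rightarrow>\<^sub>0 complex) \<Rightarrow> _"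
  by unfold_locales (rule poly_mapping_eqI; simp add: lookup_add algebra_simps)+

locale complex_alg = complex_scaling scale
  for scale :: "complex \<Rightarrow> 'b :: ring_1 \<Rightarrow> 'b" +
  assumes scale_mult_left: "scale a x * y = scale a (x * y)"
    and scale_mult_right: "x * scale a y = scale a (x * y)"
begin

lemma lext_mult:
  fixes F :: "'k :: monoid_add \<Rightarrow> 'b"
  assumes F: "\<And>k l. F (k + l) = F k * F l"
  shows "lext F (p * q) = lext F p * lext F q"
proof (induction p rule: pm_induct)
  case (single k a)
  show ?case
  proof (induction q rule: pm_induct)
    case (single l b)
    show ?case by (simp add: mult_single F scale_mult_left scale_mult_right mult.commute)
  qed (simp add: distrib_left lext_add)
qed (simp add: distrib_right lext_add)

end

lemma psc_conv_mult: "psc a (p :: 'k :: monoid_add \<Rightarrow>\<^sub>0 complex) = sgl 0 a * p"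
  by (simp add: psc_def mult_map_scale_conv_mult)

lemma scalar_commutes: "p * sgl 0 a = sgl 0 a * (p :: 'k :: monoid_add \<Rightarrow>\<^sub>0 complex)"
  by (induction p rule: pm_induct) (simp_all add: mult_single distrib_left distrib_right mult.commute)

interpretation pma: complex_alg "psc :: complex \<Rightarrow> ('k :: monoid_add \<Rightarrow>\<^sub>0 complex) \<Rightarrow> _"
proof
  fix a and x y :: "'k \<Rightarrow>\<^sub>0 complex"
  show "psc a x * y = psc a (x * y)"
    by (simp add: psc_conv_mult mult.assoc)
  show "x * psc a y = psc a (x * y)"
    by (metis psc_conv_mult mult.assoc scalar_commutes)
qed

section \<open>The ring of linear operators\<close>

text \<open>The linear operators form a type so that identities between noncommuting operators can be
  computed in the class of rings.\<close>

typedef 'k op = "{f :: ('k \<Rightarrow>\<^sub>0 complex) \<Rightarrow> ('k \<Rightarrow>\<^sub>0 complex).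
    (\<forall>p q. f (p + q) = f p + f q) \<and> (\<forall>a p. f (psc a p) = psc a (f p))}"
  morphisms ap Op
  by (rule exI[of _ id]) simp

lemma ap_Op:
  assumes "\<And>p q. f (p + q) = f p + f q" "\<And>a p. f (psc a p) = psc a (f p)"
  shows "ap (Op f) = f"
  using assms by (simp add: Op_inverse)

lemma ap_add: "ap A (p + q) = ap A p + ap A q"
  using ap[of A] by simp

lemma ap_psc: "ap A (psc a p) = psc a (ap A p)"
  using ap[of A] by simp

lemma ap_zero [simp]: "ap A 0 = 0"
  using ap_add[of A 0 0] by simp

lemma ap_sum: "ap A (sum f I) = (\<Sum>i\<in>I. ap A (f i))"
  by (induction I rule: infinite_finite_induct) (simp_all add: ap_add)

lemma op_eqI: "(\<And>p. ap A p = ap B p) \<Longrightarrow> A = B"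
  using ap_inject[of A B] by blast

instantiation op :: (type) ring_1
begin

definition "0 = Op (\<lambda>p. 0)"
definition "1 = Op (\<lambda>p. p)"
definition "A + B = Op (\<lambda>p. ap A p + ap B p)"
definition "A - B = Op (\<lambda>p. ap A p - ap B p)"
definition "- A = Op (\<lambda>p. - ap A p)"
definition "A * B = Op (\<lambda>p. ap A (ap B p))"

lemma ap_op [simp]:
  shows "ap 0 p = 0" "ap 1 p = p" "ap (A + B) p = ap A p + ap B p"
    "ap (A - B) p = ap A p - ap B p" "ap (- A) p = - ap A p" "ap (A * B) p = ap A (ap B p)"
proof -
  show "ap 0 p = 0"
    unfolding zero_op_def by (subst ap_Op) simp_all
  show "ap 1 p = p"
    unfolding one_op_def by (subst ap_Op) simp_all
  show "ap (A + B) p = ap A p + ap B p"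
    unfolding plus_op_def by (subst ap_Op) (simp_all add: ap_add ap_psc psc_add_right)
  show "ap (A - B) p = ap A p - ap B p"
    unfolding minus_op_def by (subst ap_Op) (simp_all add: ap_add ap_psc pm.scale_right_diff_distrib)
  show "ap (- A) p = - ap A p"
    unfolding uminus_op_def by (subst ap_Op) (simp_all add: ap_add ap_psc)
  show "ap (A * B) p = ap A (ap B p)"
    unfolding times_op_def by (subst ap_Op) (simp_all add: ap_add ap_psc)
qed

instance
proof
  show "(0 :: 'a op) \<noteq> 1"
  proof
    assume "(0 :: 'a op) = 1"
    then have "ap (0 :: 'a op) (sgl undefined 1) = ap 1 (sgl undefined 1)" by simp
    then have "sgl (undefined :: 'a) 1 = 0" by simp
    then show False by (metis lookup_single_eq lookup_zero zero_neq_one)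
  qed
qed (rule op_eqI; simp add: ap_add algebra_simps)+

end

definition osc :: "complex \<Rightarrow> 'k op \<Rightarrow> 'k op" where
  "osc a A = Op (\<lambda>p. psc a (ap A p))"

lemma ap_osc [simp]: "ap (osc a A) p = psc a (ap A p)"
  unfolding osc_def by (subst ap_Op) (simp_all add: ap_add ap_psc psc_add_right mult.commute)

lemma ap_op_sum [simp]: "ap (sum f I) p = (\<Sum>i\<in>I. ap (f i) p)"
  by (induction I rule: infinite_finite_induct) simp_all

interpretation op: complex_alg "osc :: complex \<Rightarrow> 'k op \<Rightarrow> _"
  by unfold_locales
    (rule op_eqI; simp add: ap_add ap_psc psc_add_right pm.scale_left_distrib)+

section \<open>Reflections and the pairing\<close>

lemma pairing_simps [simp]:
  "pairing (\<xi> + \<xi>') v = pairing \<xi> v + pairing \<xi>' v"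
  "pairing (\<xi> - \<xi>') v = pairing \<xi> v - pairing \<xi>' v"
  "pairing \<xi> (v + v') = pairing \<xi> v + pairing \<xi> v'"
  "pairing \<xi> (v - v') = pairing \<xi> v - pairing \<xi> v'"
  "pairing (a *s \<xi>) v = a * pairing \<xi> v"
  "pairing \<xi> (a *s v) = a * pairing \<xi> v"
  by (simp_all add: pairing_def algebra_simps sum.distrib sum_subtractf sum_distrib_left)

lemma pairing_axis [simp]: "pairing (axis i 1) v = v $ i" "pairing \<xi> (axis i 1) = \<xi> $ i"
  by (simp_all add: pairing_def axis_def if_distrib[of "\<lambda>x. x * _"] if_distrib[of "(*) _"] cong: if_cong)

lemma pairing_transpose: "pairing (\<xi> v* A) v = pairing \<xi> (A *v v)"
proof -
  have "pairing (\<xi> v* A) v = (\<Sum>j\<in>UNIV. \<Sum>i\<in>UNIV. \<xi> $ i * A $ i $ j * v $ j)"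
    by (simp add: pairing_def vector_matrix_mult_def sum_distrib_left sum_distrib_right mult_ac)
  also have "\<dots> = (\<Sum>i\<in>UNIV. \<Sum>j\<in>UNIV. \<xi> $ i * A $ i $ j * v $ j)"
    by (rule sum.swap)
  finally show ?thesis
    by (simp add: pairing_def matrix_vector_mult_def sum_distrib_left mult.assoc)
qed

lemma pairing_eqI: "(\<And>v. pairing \<xi> v = pairing \<xi>' v) \<Longrightarrow> \<xi> = \<xi>'"
  by (metis pairing_axis(2) vec_eq_iff)

lemma pairing_dual_act [simp]: "pairing (dual_act w \<xi>) v = pairing \<xi> (matrix_inv w *v v)"
  by (simp add: dual_act_def pairing_transpose)

lemma matrix_inv_eq:
  fixes A B :: "complex ^ 'n ^ 'n"
  assumes "A ** B = mat 1"
  shows "matrix_inv A = B" "invertible A" "invertible B"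
proof -
  have BA: "B ** A = mat 1" using assms matrix_left_right_inverse by blast
  have "A ** matrix_inv A = mat 1 \<and> matrix_inv A ** A = mat 1"
    unfolding matrix_inv_def by (rule someI[of _ B]) (use assms BA in simp)
  then show "matrix_inv A = B"
    by (metis BA matrix_mul_assoc matrix_mul_lid matrix_mul_rid)
  show "invertible A" "invertible B" using assms BA by (auto simp: invertible_def)
qed

lemma matrix_inv_invertible:
  fixes A :: "complex ^ 'n ^ 'n"
  assumes "invertible A"
  shows "A ** matrix_inv A = mat 1" "matrix_inv A ** A = mat 1"
  using assms matrix_inv_eq(1) unfolding invertible_def by metis+

lemma matrix_vector_simps:
  fixes A :: "complex ^ 'n ^ 'n"
  shows "A *v (v + v') = A *v v + A *v v'" "A *v (v - v') = A *v v - A *v v'"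
    "A *v (a *s v) = a *s (A *v v)"
  by (simp_all add: matrix_vector_mult_def vec_eq_iff algebra_simps sum.distrib sum_subtractf sum_distrib_left)

lemma mat_vec: "(mat a :: complex ^ 'n ^ 'n) *v v = a *s v"
proof -
  have "(\<Sum>j\<in>UNIV. (if i = j then a else 0) * v $ j) = a * v $ i" for i
    by (subst sum.remove[of _ i]) auto
  then show ?thesis by (simp add: matrix_vector_mult_def mat_def vec_eq_iff)
qed

lemma dual_act_simps:
  "dual_act w (\<xi> + \<xi>') = dual_act w \<xi> + dual_act w \<xi>'"
  "dual_act w (a *s \<xi>) = a *s dual_act w \<xi>"
  "dual_act (mat 1) \<xi> = \<xi>"
  by (rule pairing_eqI; simp add: matrix_vector_simps matrix_inv_eq(1)[of "mat 1" "mat 1"])+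

lemma dual_act_mult:
  assumes "invertible u" "invertible w"
  shows "dual_act (u ** w) \<xi> = dual_act u (dual_act w \<xi>)"
proof -
  have "(u ** w) ** (matrix_inv w ** matrix_inv u) = mat 1"
    by (metis assms matrix_inv_invertible(1) matrix_mul_assoc matrix_mul_rid)
  then have "matrix_inv (u ** w) = matrix_inv w ** matrix_inv u"
    by (rule matrix_inv_eq)
  then show ?thesis
    by (intro pairing_eqI) (simp flip: matrix_vector_mul_assoc)
qed

lemma rank_mul_le:
  fixes A B :: "complex ^ 'n ^ 'n"
  shows "rank (A ** B) \<le> rank A" "rank (A ** B) \<le> rank B"
proof -
  have "row i (A ** B) = row i A v* B" for i
    by (simp add: row_def matrix_matrix_mult_def vector_matrix_mult_def vec_eq_iff mult.commute)
  then have "rows (A ** B) = (\<lambda>x. x v* B) ` rows A" by (auto simp: rows_def)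
  moreover have "Vector_Spaces.linear (*s) (*s) (\<lambda>x. x v* B)"
    by unfold_locales
      (simp_all add: vector_matrix_mult_def vec_eq_iff algebra_simps sum.distrib sum_distrib_left)
  ultimately show "rank (A ** B) \<le> rank A"
    by (simp add: row_rank_def_gen vec.dim_image_le)
  have "row i (A ** B) = (\<Sum>j\<in>UNIV. (A $ i $ j) *s row j B)" for i
    by (simp add: row_def matrix_matrix_mult_def vec_eq_iff)
  moreover have "(\<Sum>j\<in>UNIV. (A $ i $ j) *s row j B) \<in> vec.span (rows B)" for i
    by (intro vec.span_sum vec.span_scale vec.span_base) (auto simp: rows_def)
  ultimately have "row i (A ** B) \<in> vec.span (rows B)" for i by simp
  then have "rows (A ** B) \<subseteq> vec.span (rows B)"
  proof (intro subsetI)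
    fix x assume "x \<in> rows (A ** B)"
    then obtain i where "x = row i (A ** B)" unfolding rows_def by blast
    then show "x \<in> vec.span (rows B)" using \<open>\<And>i. row i (A ** B) \<in> vec.span (rows B)\<close> by simp
  qed
  then show "rank (A ** B) \<le> rank B"
    by (simp add: row_rank_def_gen vec.dim_mono)
qed

text \<open>Conjugates of reflections are reflections; this is the rank part of that statement.\<close>

lemma rank_conj:
  fixes A w w' :: "complex ^ 'n ^ 'n"
  assumes "w' ** w = mat 1"
  shows "rank (w ** A ** w') = rank A"
proof (rule antisym)
  have le: "rank (u ** B ** u') \<le> rank B" for u u' B :: "complex ^ 'n ^ 'n"
    using rank_mul_le(1)[of "u ** B" u'] rank_mul_le(2)[of u B] by linarith
  show "rank (w ** A ** w') \<le> rank A" by (rule le)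
  have "w' ** (w ** A ** w') ** w = (w' ** w) ** A ** (w' ** w)"
    by (simp only: matrix_mul_assoc)
  then have "w' ** (w ** A ** w') ** w = A" by (simp add: assms)
  moreover have "rank (w' ** (w ** A ** w') ** w) \<le> rank (w ** A ** w')"
    by (rule le)
  ultimately show "rank A \<le> rank (w ** A ** w')" by simp
qed

locale reflection_algebra =
  fixes W :: "(complex ^ 'n ^ 'n) set"
    and t :: complex
    and c lam :: "complex ^ 'n ^ 'n \<Rightarrow> complex"
    and \<alpha> \<alpha>v :: "complex ^ 'n ^ 'n \<Rightarrow> complex ^ 'n"
  assumes refl_group: "complex_reflection_group W"
    and conj: "conj_invariant W c"
    and data: "reflection_data W \<alpha> \<alpha>v lam"
    and card: "CARD('n) > 1"
begin

abbreviation R where "R \<equiv> reflections W"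

lemma finite_W: "finite W" and finite_R [simp]: "finite R" and R_subset: "R \<subseteq> W"
  using refl_group by (auto simp: complex_reflection_group_def reflections_def)

lemma W_invertible: "w \<in> W \<Longrightarrow> invertible w"
  using refl_group subgroup.subset[of W GL] by (auto simp: complex_reflection_group_def GL_def)

lemma W_one: "mat 1 \<in> W"
  using refl_group subgroup.one_closed[of W GL] by (simp add: complex_reflection_group_def GL_def)

lemma W_mult: "u \<in> W \<Longrightarrow> w \<in> W \<Longrightarrow> u ** w \<in> W"
  using refl_group subgroup.m_closed[of W GL u w] by (simp add: complex_reflection_group_def GL_def)

lemma W_inv: "w \<in> W \<Longrightarrow> matrix_inv w \<in> W"
proof -
  assume w: "w \<in> W"
  note i = matrix_inv_invertible[OF W_invertible[OF w]]
  have "inv\<^bsub>GL\<^esub> w = matrix_inv w"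
    unfolding m_inv_def
  proof (rule the_equality)
    show "matrix_inv w \<in> carrier GL \<and> w \<otimes>\<^bsub>GL\<^esub> matrix_inv w = \<one>\<^bsub>GL\<^esub> \<and> matrix_inv w \<otimes>\<^bsub>GL\<^esub> w = \<one>\<^bsub>GL\<^esub>"
      using i by (auto simp: GL_def invertible_def)
  next
    fix y assume "y \<in> carrier GL \<and> w \<otimes>\<^bsub>GL\<^esub> y = \<one>\<^bsub>GL\<^esub> \<and> y \<otimes>\<^bsub>GL\<^esub> w = \<one>\<^bsub>GL\<^esub>"
    then have "w ** y = mat 1" by (simp add: GL_def)
    then show "y = matrix_inv w" by (simp add: matrix_inv_eq(1))
  qed
  then show ?thesis
    using refl_group subgroup.m_inv_closed[of W GL w] w by (simp add: complex_reflection_group_def)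
qed

lemma W_inv_mult: "w \<in> W \<Longrightarrow> w ** matrix_inv w = mat 1" "w \<in> W \<Longrightarrow> matrix_inv w ** w = mat 1"
  by (simp_all add: W_invertible matrix_inv_invertible)

lemma W_inv_cancel:
  assumes "w \<in> W"
  shows "A ** w ** matrix_inv w = A" "A ** matrix_inv w ** w = A"
    "w ** matrix_inv w = mat 1" "matrix_inv w ** w = mat 1"
  by (simp_all add: W_inv_mult assms flip: matrix_mul_assoc)

lemma W_inv_vec [simp]: "w \<in> W \<Longrightarrow> w *v (matrix_inv w *v v) = v" "w \<in> W \<Longrightarrow> matrix_inv w *v (w *v v) = v"
  by (simp_all add: matrix_vector_mul_assoc W_inv_mult)

definition root_pairing :: "complex ^ 'n ^ 'n \<Rightarrow> complex" where
  "root_pairing s = pairing (\<alpha> s) (\<alpha>v s)"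

text \<open>The kernel of \<open>\<alpha> s\<close> is fixed and \<open>\<alpha>v s\<close>, an eigenvector for another eigenvalue, lies outside it; so
  \<open>s\<close> is determined by its values on these two, and the eigenvalue on \<open>\<alpha>v s\<close> is inverse to \<open>lam s\<close>.\<close>

lemma refl_facts:
  assumes s: "s \<in> R"
  shows root_pairing_nonzero: "root_pairing s \<noteq> 0"
    and lam_neq: "lam s \<noteq> 1" "lam s \<noteq> 0"
    and refl_vec: "s *v v = v - ((1 - inverse (lam s)) * pairing (\<alpha> s) v / root_pairing s) *s \<alpha>v s"
    and refl_inv_vec: "matrix_inv s *v v = v - ((1 - lam s) * pairing (\<alpha> s) v / root_pairing s) *s \<alpha>v s"
    and refl_dual: "dual_act s \<xi> = \<xi> - ((1 - lam s) * pairing \<xi> (\<alpha>v s) / root_pairing s) *s \<alpha> s"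
proof -
  have sW: "s \<in> W" using s R_subset by blast
  obtain m where ker: "\<And>v. pairing (\<alpha> s) v = 0 \<longleftrightarrow> s *v v = v" and av: "\<alpha>v s \<noteq> 0"
    and m: "m \<noteq> 1" "s *v \<alpha>v s = m *s \<alpha>v s" and l: "dual_act s (\<alpha> s) = lam s *s \<alpha> s"
    using data s unfolding reflection_data_def by (metis (mono_tags, lifting) mem_Collect_eq)
  show h: "root_pairing s \<noteq> 0"
  proof
    assume "root_pairing s = 0"
    then have "m *s \<alpha>v s = 1 *s \<alpha>v s" using ker[of "\<alpha>v s"] m(2) by (simp add: root_pairing_def)
    then show False using av m(1) by (metis vec.scale_cancel_right)
  qed
  have m0: "m \<noteq> 0"
  proof
    assume "m = 0"
    then have "matrix_inv s *v (s *v \<alpha>v s) = 0" using m(2) by simp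
    then show False using av sW by simp
  qed
  have sv: "s *v v = v - ((1 - m) * pairing (\<alpha> s) v / root_pairing s) *s \<alpha>v s" for v
  proof -
    let ?a = "pairing (\<alpha> s) v / root_pairing s"
    have "pairing (\<alpha> s) (v - ?a *s \<alpha>v s) = 0" using h by (simp add: root_pairing_def)
    then have "s *v (v - ?a *s \<alpha>v s) = v - ?a *s \<alpha>v s" using ker by blast
    then have "s *v v = v - ?a *s \<alpha>v s + ?a *s (m *s \<alpha>v s)"
      by (simp add: matrix_vector_simps m(2) algebra_simps)
    then show ?thesis by (simp add: vec_eq_iff algebra_simps diff_divide_distrib)
  qed
  have inv: "matrix_inv s *v v = v - ((1 - inverse m) * pairing (\<alpha> s) v / root_pairing s) *s \<alpha>v s" for v
  proof -
    let ?a = "(1 - inverse m) * pairing (\<alpha> s) v / root_pairing s"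
    have "s *v (v - ?a *s \<alpha>v s) = v - ((1 - m) * pairing (\<alpha> s) v / root_pairing s + ?a * m) *s \<alpha>v s"
      unfolding matrix_vector_simps m(2) sv[of v] by (simp add: vec_eq_iff algebra_simps)
    moreover have "(1 - m) * pairing (\<alpha> s) v / root_pairing s + ?a * m = 0"
      using m0 by (simp add: add_divide_distrib[symmetric] algebra_simps)
    ultimately have "s *v (v - ?a *s \<alpha>v s) = v" by (simp only: vec.scale_zero_left diff_zero)
    then show ?thesis using sW by (metis W_inv_vec(2))
  qed
  have du: "dual_act s \<xi> = \<xi> - ((1 - inverse m) * pairing \<xi> (\<alpha>v s) / root_pairing s) *s \<alpha> s" for \<xi>
    by (rule pairing_eqI) (simp add: inv)
  have "lam s * root_pairing s = inverse m * root_pairing s"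
    using arg_cong[OF l, of "\<lambda>\<xi>. pairing \<xi> (\<alpha>v s)"] h
    unfolding du by (simp add: root_pairing_def[symmetric] field_simps)
  then have lam: "lam s = inverse m" using h by simp
  show "lam s \<noteq> 1" "lam s \<noteq> 0" using lam m m0 by simp_all
  show "s *v v = v - ((1 - inverse (lam s)) * pairing (\<alpha> s) v / root_pairing s) *s \<alpha>v s"
    "matrix_inv s *v v = v - ((1 - lam s) * pairing (\<alpha> s) v / root_pairing s) *s \<alpha>v s"
    "dual_act s \<xi> = \<xi> - ((1 - lam s) * pairing \<xi> (\<alpha>v s) / root_pairing s) *s \<alpha> s"
    using sv inv du lam by simp_all
qed

text \<open>The coefficient of \<open>- s\<close> in the relation for \<open>[y, x]\<close>.\<close>

definition refl_coef :: "complex ^ 'n ^ 'n \<Rightarrow> complex ^ 'n \<Rightarrow> complex ^ 'n \<Rightarrow> complex" where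
  "refl_coef s \<xi> v = 2 * c s / root_pairing s * pairing \<xi> (\<alpha>v s) * pairing (\<alpha> s) v"

lemma refl_coef_simps:
  "refl_coef s (\<xi> + \<xi>') v = refl_coef s \<xi> v + refl_coef s \<xi>' v" "refl_coef s (a *s \<xi>) v = a * refl_coef s \<xi> v"
  "refl_coef s \<xi> (v + v') = refl_coef s \<xi> v + refl_coef s \<xi> v'" "refl_coef s \<xi> (a *s v) = a * refl_coef s \<xi> v"
  by (simp_all add: refl_coef_def algebra_simps add_divide_distrib)

text \<open>Both \<open>\<xi> - s \<xi>\<close> and the coefficient are proportional to \<open>\<xi>(\<alpha>v s)\<close>, whence the symmetry in \<open>\<xi>\<close> and
  \<open>\<xi>'\<close>. It is what makes commuting a \<open>y\<close> past \<open>\<xi> \<xi>'\<close> agree with commuting it past \<open>\<xi>' \<xi>\<close>.\<close>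

lemma refl_coef_dual_symmetric:
  assumes "s \<in> R"
  shows "refl_coef s \<xi>' v *s \<xi> + refl_coef s \<xi> v *s dual_act s \<xi>' = refl_coef s \<xi> v *s \<xi>' + refl_coef s \<xi>' v *s dual_act s \<xi>"
  by (simp add: refl_dual[OF assms] vec_eq_iff refl_coef_def algebra_simps)

text \<open>The counterpart in \<open>\<hh>\<close> of the preceding symmetry, needed for the Dunkl operators to commute.\<close>

lemma refl_coef_vec_symmetric:
  assumes "s \<in> R"
  shows "refl_coef s \<xi> v' *s (matrix_inv s *v v - v) = refl_coef s \<xi> v *s (matrix_inv s *v v' - v')"
  by (simp add: refl_inv_vec[OF assms] vec_eq_iff refl_coef_def algebra_simps)

lemma conj_matrix:
  assumes "w \<in> W" "s \<in> W"
  shows "(w ** s ** matrix_inv w) ** w = w ** s" "matrix_inv w ** (w ** s ** matrix_inv w) ** w = s"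
    "w ** (matrix_inv w ** s ** w) ** matrix_inv w = s"
  by (simp_all add: matrix_mul_assoc W_inv_cancel[OF assms(1)])

lemma GL_pow: "A [^]\<^bsub>GL\<^esub> (k::nat) = ((\<lambda>B. B ** A) ^^ k) (mat 1)"
  by (induction k) (simp_all add: GL_def nat_pow_def)

lemma conj_reflection:
  assumes w: "w \<in> W" and s: "s \<in> R"
  shows "w ** s ** matrix_inv w \<in> R"
proof -
  have sW: "s \<in> W" using s R_subset by blast
  define s' where "s' = w ** s ** matrix_inv w"
  have s'W: "s' \<in> W" unfolding s'_def by (intro W_mult W_inv w sW)
  have cr: "complex_reflection s" using s by (simp add: reflections_def)
  then obtain k :: nat where k: "k > 0" "s [^]\<^bsub>GL\<^esub> k = \<one>\<^bsub>GL\<^esub>" and r: "rank (s - mat 1) = 1"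
    by (auto simp: complex_reflection_def)
  have "s' [^]\<^bsub>GL\<^esub> m = w ** (s [^]\<^bsub>GL\<^esub> m) ** matrix_inv w" for m :: nat
  proof (induction m)
    case 0
    then show ?case using W_inv_mult(1)[OF w] by (simp add: GL_pow GL_def)
  next
    case (Suc m)
    have "s' [^]\<^bsub>GL\<^esub> Suc m = w ** (s [^]\<^bsub>GL\<^esub> m) ** matrix_inv w ** s'"
      using Suc by (simp add: GL_def)
    also have "\<dots> = w ** ((s [^]\<^bsub>GL\<^esub> m) ** s) ** matrix_inv w"
      unfolding s'_def by (simp add: matrix_mul_assoc W_inv_cancel[OF w])
    finally show ?case by (simp add: GL_def)
  qed
  then have "s' [^]\<^bsub>GL\<^esub> k = \<one>\<^bsub>GL\<^esub>" using k W_inv_mult(1)[OF w] by (simp add: GL_def)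
  moreover have "s' - mat 1 = w ** (s - mat 1) ** matrix_inv w"
  proof -
    have "w ** (s - mat 1) ** matrix_inv w = w ** s ** matrix_inv w - w ** mat 1 ** matrix_inv w"
      by (simp add: matrix_matrix_mult_def vec_eq_iff algebra_simps sum_subtractf)
    then show ?thesis using W_inv_mult(1)[OF w] by (simp add: s'_def)
  qed
  then have "rank (s' - mat 1) = 1" using rank_conj[OF W_inv_mult(2)[OF w]] r by simp
  moreover have "s' \<in> carrier GL" using W_invertible[OF s'W] by (simp add: GL_def)
  ultimately have "complex_reflection s'" using k(1) by (auto simp: complex_reflection_def)
  with s'W have "s' \<in> R" by (simp add: reflections_def)
  then show ?thesis by (simp only: s'_def)
qed

text \<open>This form no longer mentions the vectors chosen for \<open>s\<close>, so it can be conjugated.\<close>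

lemma refl_coef_intrinsic:
  assumes "s \<in> R"
  shows "(1 - inverse (lam s)) * refl_coef s \<xi> v = 2 * c s * (pairing \<xi> v - pairing \<xi> (s *v v))"
  unfolding refl_vec[OF assms] by (simp add: refl_coef_def)

text \<open>The vector \<open>w (\<alpha>v s)\<close> is an eigenvector of the conjugate that is not fixed, and a reflection has
  only one eigenvalue besides \<open>1\<close>.\<close>

lemma lam_conj:
  assumes w: "w \<in> W" and s: "s \<in> R"
  shows "lam (w ** s ** matrix_inv w) = lam s"
proof -
  define s' where "s' = w ** s ** matrix_inv w"
  have sW: "s \<in> W" using s R_subset by blast
  have s': "s' \<in> R" using conj_reflection[OF w s] by (simp add: s'_def)
  have sw: "s' *v (w *v u) = w *v (s *v u)" for u
    unfolding s'_def matrix_vector_mul_assoc conj_matrix(1)[OF w sW] ..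
  let ?m = "inverse (lam s)" and ?m' = "inverse (lam s')"
  have "s *v \<alpha>v s = ?m *s \<alpha>v s"
    using root_pairing_nonzero[OF s] by (subst refl_vec[OF s]) (simp add: root_pairing_def vec_eq_iff field_simps)
  then have 1: "s' *v (w *v \<alpha>v s) = ?m *s (w *v \<alpha>v s)"
    by (simp add: sw matrix_vector_simps)
  define p where "p = pairing (\<alpha> s') (w *v \<alpha>v s)"
  have 2: "pairing (\<alpha> s') (s' *v u) = ?m' * pairing (\<alpha> s') u" for u
    using root_pairing_nonzero[OF s'] by (subst refl_vec[OF s']) (simp add: root_pairing_def field_simps)
  have "?m * p = ?m' * p" using 2[of "w *v \<alpha>v s"] unfolding 1 p_def by simp
  moreover have "p \<noteq> 0"
  proof
    assume "p = 0"
    then have "s' *v (w *v \<alpha>v s) = w *v \<alpha>v s"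
      by (subst refl_vec[OF s']) (simp add: p_def)
    then have "matrix_inv w *v (w *v (?m *s \<alpha>v s)) = matrix_inv w *v (w *v \<alpha>v s)"
      using 1 by (simp add: matrix_vector_simps)
    then have "?m *s \<alpha>v s = \<alpha>v s" using w by simp
    then have "?m * root_pairing s = root_pairing s" unfolding root_pairing_def by (metis pairing_simps(6))
    then show False using lam_neq[OF s] root_pairing_nonzero[OF s] by simp
  qed
  ultimately show ?thesis by (simp add: s'_def)
qed

lemma refl_coef_equivariant:
  assumes w: "w \<in> W" and s: "s \<in> R"
  shows "refl_coef (w ** s ** matrix_inv w) (dual_act w \<xi>) (w *v v) = refl_coef s \<xi> v"
proof -
  define s' where "s' = w ** s ** matrix_inv w"
  have sW: "s \<in> W" using s R_subset by blast
  have s': "s' \<in> R" using conj_reflection[OF w s] by (simp add: s'_def)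
  have sw: "s' *v (w *v u) = w *v (s *v u)" for u
    unfolding s'_def matrix_vector_mul_assoc conj_matrix(1)[OF w sW] ..
  have lam: "lam s' = lam s" using lam_conj[OF w s] by (simp add: s'_def)
  have c: "c s' = c s" using conj w s by (simp add: conj_invariant_def s'_def)
  have "(1 - inverse (lam s')) * refl_coef s' (dual_act w \<xi>) (w *v v) = (1 - inverse (lam s)) * refl_coef s \<xi> v"
    unfolding refl_coef_intrinsic[OF s'] refl_coef_intrinsic[OF s]
      by (simp add: c sw w)
  then have "(1 - inverse (lam s)) * refl_coef s' (dual_act w \<xi>) (w *v v) = (1 - inverse (lam s)) * refl_coef s \<xi> v"
    by (simp only: lam)
  moreover have "1 - inverse (lam s) \<noteq> 0" using lam_neq[OF s] by simp
  ultimately have "refl_coef s' (dual_act w \<xi>) (w *v v) = refl_coef s \<xi> v"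
    by (rule mult_left_cancel[THEN iffD1, rotated])
  then show ?thesis by (simp only: s'_def)
qed

lemma sum_reflections_conj:
  assumes w: "w \<in> W"
  shows "(\<Sum>s\<in>R. f (w ** s ** matrix_inv w)) = (\<Sum>s\<in>R. f s)"
proof (rule sum.reindex_bij_witness[of _ "\<lambda>s. matrix_inv w ** s ** w" "\<lambda>s. w ** s ** matrix_inv w"])
  fix s assume s: "s \<in> R"
  then have sW: "s \<in> W" using R_subset by blast
  have "matrix_inv (matrix_inv w) = w" using matrix_inv_eq(1) W_inv_mult(2)[OF w] by blast
  then show "matrix_inv w ** s ** w \<in> R" using conj_reflection[OF W_inv[OF w] s] by simp
  show "matrix_inv w ** (w ** s ** matrix_inv w) ** w = s" "w ** (matrix_inv w ** s ** w) ** matrix_inv w = s"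
    using conj_matrix[OF w sW] by auto
  show "w ** s ** matrix_inv w \<in> R" by (rule conj_reflection[OF w s])
qed (rule refl)

definition scalar :: "complex ^ 'n ^ 'n \<Rightarrow> bool" where
  "scalar w \<longleftrightarrow> (\<exists>a. w = mat a)"

text \<open>In dimension at least \<open>2\<close> the functional \<open>\<alpha> s\<close> vanishes on a nonzero vector, which \<open>s\<close> fixes, while \<open>s\<close> is
  not the identity.\<close>

lemma reflection_not_scalar:
  assumes s: "s \<in> R"
  shows "\<not> scalar s"
proof
  assume "scalar s"
  then obtain a where a: "s = mat a" by (auto simp: scalar_def)
  have sv: "s *v v = a *s v" for v by (simp add: a mat_vec)
  have *: "v = 0" if "pairing (\<alpha> s) v = 0" for v
  proof -
    have "a *s v = v" using that sv refl_vec[OF s, of v] by simp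
    moreover have "a \<noteq> 1"
    proof
      assume "a = 1"
      then have "pairing (\<alpha> s) (s *v \<alpha>v s) = root_pairing s" by (simp add: sv root_pairing_def)
      moreover have "pairing (\<alpha> s) (s *v \<alpha>v s) = inverse (lam s) * root_pairing s"
        using root_pairing_nonzero[OF s] by (subst refl_vec[OF s]) (simp add: root_pairing_def field_simps)
      ultimately show False using lam_neq[OF s] root_pairing_nonzero[OF s] by simp
    qed
    ultimately show "v = 0" by (metis vec.scale_cancel_right vec.scale_one)
  qed
  obtain i j :: 'n where ij: "i \<noteq> j"
    using card card_le_Suc0_iff_eq[of "UNIV :: 'n set"] by auto
  \<comment> \<open>A vector in the kernel of the functional, supported on two coordinates.\<close>
  let ?v = "(\<alpha> s $ j) *s axis i 1 - (\<alpha> s $ i) *s axis j 1"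
  have "pairing (\<alpha> s) ?v = 0" unfolding pairing_simps pairing_axis by simp
  then have "?v = 0" by (rule *)
  then have "?v $ j = 0" by (simp only: zero_index)
  moreover have "axis i (1::complex) $ j = 0" "axis j (1::complex) $ j = 1"
    using ij by (auto simp: axis_def)
  ultimately have "pairing (\<alpha> s) (axis i 1) = 0" by simp
  then have "axis i (1::complex) $ i = 0" using * by (metis zero_index)
  then show False by simp
qed

end

section \<open>Normal forms and the Dunkl operators on them\<close>

text \<open>A key \<open>(\<mu>, \<nu>, G)\<close> stands for the ordered product of the \<open>x\<^sub>i\<close> with \<open>i \<in># \<mu>\<close>, the \<open>y\<^sub>i\<close> with \<open>i \<in># \<nu>\<close>
  and a group element. The group element is stored as a multiset of matrices, in practice with one
  member: then the normal forms are polynomials in commuting variables \<open>x\<^sub>i\<close>, \<open>y\<^sub>i\<close>, \<open>g\<^sub>u\<close>, and a matrix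
  \<open>w\<close> acts on them as the ring endomorphism with \<open>g\<^sub>u \<mapsto> g\<^sub>w\<^sub>u\<close>. The product of this ring is not the
  product of the Cherednik algebra.\<close>

type_synonym 'n nf_key = "'n multiset \<times> 'n multiset \<times> (complex ^ 'n ^ 'n) multiset"

type_synonym 'n nf = "'n nf_key \<Rightarrow>\<^sub>0 complex"

type_synonym 'n nf_op = "'n nf_key op"

definition xN :: "'n :: finite \<Rightarrow> 'n nf" where "xN i = sgl ({#i#}, {#}, {#}) 1"
definition yN :: "'n :: finite \<Rightarrow> 'n nf" where "yN i = sgl ({#}, {#i#}, {#}) 1"
definition gN :: "complex ^ 'n ^ 'n \<Rightarrow> 'n nf" where "gN w = sgl ({#}, {#}, {#w#}) 1"

definition covN :: "complex ^ 'n \<Rightarrow> 'n nf" where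
  "covN \<xi> = (\<Sum>i\<in>UNIV. psc (\<xi> $ i) (xN i))"

definition vecN :: "complex ^ 'n \<Rightarrow> 'n nf" where
  "vecN v = (\<Sum>i\<in>UNIV. psc (v $ i) (yN i))"

lemma sgl_add_mset:
  "sgl (add_mset i \<mu>, \<nu>, G) a = xN i * sgl (\<mu>, \<nu>, G) a"
  "sgl (\<mu>, add_mset i \<nu>, G) a = yN i * sgl (\<mu>, \<nu>, G) a"
  "sgl (\<mu>, \<nu>, add_mset u G) a = gN u * sgl (\<mu>, \<nu>, G) a"
  by (simp_all add: xN_def yN_def gN_def mult_single add_Pair)

lemma sgl_one: "sgl ({#}, {#}, {#}) 1 = 1"
  by (rule poly_mapping_eqI) (simp add: lookup_one lookup_single zero_prod_def eq_commute)

definition xfree :: "'n :: finite nf \<Rightarrow> bool" where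
  "xfree n \<longleftrightarrow> (\<forall>k\<in>Poly_Mapping.keys n. fst k = {#})"

lemma xfree_add: "xfree m \<Longrightarrow> xfree n \<Longrightarrow> xfree (m + n)"
  using keys_add[of m n] by (fastforce simp: xfree_def)

lemma xfree_psc: "xfree n \<Longrightarrow> xfree (psc a n)"
  by (auto simp: xfree_def in_keys_iff)

lemma xfree_mult: "xfree m \<Longrightarrow> xfree n \<Longrightarrow> xfree (m * n)"
  using keys_mult[of m n] by (fastforce simp: xfree_def)

lemma xfree_sum: "(\<And>i. i \<in> I \<Longrightarrow> xfree (f i)) \<Longrightarrow> xfree (sum f I)"
proof (induction I rule: infinite_finite_induct)
  case (insert i I)
  then show ?case by (simp add: xfree_add)
qed (simp_all add: xfree_def)

lemma xfree_single: "xfree (sgl ({#}, k) a)"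
  by (simp add: xfree_def)

lemma xfree_vecN: "xfree (vecN v)" and xfree_gN: "xfree (gN w)" and xfree_one: "xfree 1"
  unfolding vecN_def yN_def gN_def sgl_one[symmetric] by (intro xfree_sum xfree_psc xfree_single)+

lemma xfree_prod_mset: "(\<And>i. xfree (f i)) \<Longrightarrow> xfree (\<Prod>i\<in>#M. f i)"
  by (induction M) (auto intro: xfree_mult xfree_one)

lemma nf_x_induct [case_names xfree x add]:
  assumes "\<And>n. xfree n \<Longrightarrow> P n" "\<And>i n. P n \<Longrightarrow> P (xN i * n)" "\<And>m n. P m \<Longrightarrow> P n \<Longrightarrow> P (m + n)"
  shows "P n"
proof (induction n rule: pm_induct)
  case (single k a)
  obtain \<mu> \<nu> G where k: "k = (\<mu>, \<nu>, G)" by (cases k)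
  show ?case unfolding k
    by (induction \<mu>) (auto simp: sgl_add_mset intro: assms xfree_single)
qed (rule assms(3))

lemma nf_induct [case_names one x y g psc add]:
  assumes "P 1" "\<And>i n. P n \<Longrightarrow> P (xN i * n)" "\<And>i n. P n \<Longrightarrow> P (yN i * n)" "\<And>u n. P n \<Longrightarrow> P (gN u * n)"
    "\<And>a n. P n \<Longrightarrow> P (psc a n)" "\<And>m n. P m \<Longrightarrow> P n \<Longrightarrow> P (m + n)"
  shows "P n"
proof (induction n rule: pm_induct)
  case (single k a)
  obtain \<mu> \<nu> G where k: "k = (\<mu>, \<nu>, G)" by (cases k)
  have 1: "P (sgl ({#}, {#}, G) 1)"
    by (induction G) (auto simp: sgl_add_mset sgl_one intro: assms)
  have 2: "P (sgl ({#}, \<nu>, G) 1)"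
    by (induction \<nu>) (auto simp: sgl_add_mset intro: assms 1)
  have 3: "P (sgl (\<mu>, \<nu>, G) 1)"
    by (induction \<mu>) (auto simp: sgl_add_mset intro: assms 2)
  show ?case using assms(5)[OF 3, of a] by (simp add: k)
qed (rule assms(6))

lemma covN_simps: "covN (\<xi> + \<xi>') = covN \<xi> + covN \<xi>'" "covN (a *s \<xi>) = psc a (covN \<xi>)" "covN (axis i 1) = xN i"
  and vecN_simps: "vecN (v + v') = vecN v + vecN v'" "vecN (a *s v) = psc a (vecN v)" "vecN (axis i 1) = yN i"
  for i :: "'n :: finite"
proof -
  have "psc (axis i 1 $ j) m = (if j = i then m else 0)" for j :: 'n and m :: "'n nf"
    by (simp add: axis_def)
  then show "covN (axis i 1) = xN i" "vecN (axis i 1) = yN i"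
    by (simp_all add: covN_def vecN_def)
qed (simp_all add: covN_def vecN_def pm.scale_left_distrib sum.distrib pm.scale_sum_right)

lemma covN_sum: "covN (sum f I) = (\<Sum>i\<in>I. covN (f i))" and vecN_sum: "vecN (sum f I) = (\<Sum>i\<in>I. vecN (f i))"
  for f :: "'i \<Rightarrow> complex ^ 'n"
proof -
  have "covN 0 = (0 :: 'n nf)" "vecN 0 = (0 :: 'n nf)" by (simp_all add: covN_def vecN_def)
  then show "covN (sum f I) = (\<Sum>i\<in>I. covN (f i))" "vecN (sum f I) = (\<Sum>i\<in>I. vecN (f i))"
    by (induction I rule: infinite_finite_induct) (simp_all add: covN_simps vecN_simps)
qed

definition cov_op :: "complex ^ 'n \<Rightarrow> 'n nf_op" where
  "cov_op \<xi> = Op (\<lambda>n. covN \<xi> * n)"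

lemma ap_cov_op [simp]: "ap (cov_op \<xi>) n = covN \<xi> * n"
  unfolding cov_op_def by (subst ap_Op) (simp_all add: distrib_left pma.scale_mult_right)

lemma cov_op_simps: "cov_op (\<xi> + \<xi>') = cov_op \<xi> + cov_op \<xi>'" "cov_op (a *s \<xi>) = osc a (cov_op \<xi>)"
  by (rule op_eqI; simp add: covN_simps distrib_right pma.scale_mult_left)+

fun act_key :: "complex ^ 'n ^ 'n \<Rightarrow> 'n nf_key \<Rightarrow> 'n nf" where
  "act_key w (\<mu>, \<nu>, G) = (\<Prod>i\<in>#\<mu>. covN (dual_act w (axis i 1))) * (\<Prod>i\<in>#\<nu>. vecN (w *v axis i 1)) * (\<Prod>u\<in>#G. gN (w ** u))"

definition grp_op :: "complex ^ 'n ^ 'n \<Rightarrow> 'n nf_op" where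
  "grp_op w = Op (pm.lext (act_key w))"

lemma ap_grp_op: "ap (grp_op w) n = pm.lext (act_key w) n"
  unfolding grp_op_def by (subst ap_Op) (simp_all add: pm.lext_add pm.lext_psc)

lemma grp_op_mult_nf: "ap (grp_op w) (m * n) = ap (grp_op w) m * ap (grp_op w) n"
proof -
  have "act_key w (k + l) = act_key w k * act_key w l" for k l
    by (cases k; cases l) (simp add: mult_ac)
  then show ?thesis unfolding ap_grp_op by (rule pma.lext_mult)
qed

lemma dual_act_sum: "dual_act w (sum f I) = (\<Sum>i\<in>I. dual_act w (f i))"
proof -
  have "dual_act w (0 *s 0) = 0 *s dual_act w 0" by (rule dual_act_simps)
  then show ?thesis
    by (induction I rule: infinite_finite_induct) (simp_all add: dual_act_simps)
qed

lemma matrix_vector_sum: "(w :: complex ^ 'n ^ 'm) *v (sum f I) = (\<Sum>i\<in>I. w *v f i)"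
  by (induction I rule: infinite_finite_induct) (simp_all add: matrix_vector_right_distrib)

lemma grp_op_gens [simp]:
  "ap (grp_op w) 1 = 1" "ap (grp_op w) (gN u) = gN (w ** u)"
  "ap (grp_op w) (covN \<xi>) = covN (dual_act w \<xi>)" "ap (grp_op w) (vecN v) = vecN (w *v v)"
  for w :: "complex ^ 'n ^ 'n"
proof -
  show "ap (grp_op w) 1 = 1"
    using pm.lext_single[of "act_key w" "({#}, {#}, {#})" 1] by (simp add: ap_grp_op sgl_one)
  show "ap (grp_op w) (gN u) = gN (w ** u)" by (simp add: ap_grp_op gN_def)
  have x: "ap (grp_op w) (xN i) = covN (dual_act w (axis i 1))" for i by (simp add: ap_grp_op xN_def)
  have y: "ap (grp_op w) (yN i) = vecN (w *v axis i 1)" for i by (simp add: ap_grp_op yN_def)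
  have "ap (grp_op w) (covN \<xi>) = (\<Sum>i\<in>UNIV. psc (\<xi> $ i) (covN (dual_act w (axis i 1))))"
    by (simp add: covN_def[of \<xi>] ap_sum ap_psc x)
  also have "\<dots> = covN (\<Sum>i\<in>UNIV. \<xi> $ i *s dual_act w (axis i 1))"
    by (simp add: covN_sum covN_simps)
  also have "(\<Sum>i\<in>UNIV. \<xi> $ i *s dual_act w (axis i 1)) = dual_act w (\<Sum>i\<in>UNIV. \<xi> $ i *s axis i 1)"
    by (simp add: dual_act_sum dual_act_simps)
  finally show "ap (grp_op w) (covN \<xi>) = covN (dual_act w \<xi>)" by (simp add: basis_expansion)
  have "ap (grp_op w) (vecN v) = (\<Sum>i\<in>UNIV. psc (v $ i) (vecN (w *v axis i 1)))"
    by (simp add: vecN_def[of v] ap_sum ap_psc y)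
  also have "\<dots> = vecN (\<Sum>i\<in>UNIV. v $ i *s (w *v axis i 1))"
    by (simp add: vecN_sum vecN_simps)
  also have "(\<Sum>i\<in>UNIV. v $ i *s (w *v axis i 1)) = w *v (\<Sum>i\<in>UNIV. v $ i *s axis i 1)"
    by (simp add: matrix_vector_sum matrix_vector_simps)
  finally show "ap (grp_op w) (vecN v) = vecN (w *v v)" by (simp add: basis_expansion)
qed

lemma grp_op_xy [simp]: "ap (grp_op w) (xN i) = covN (dual_act w (axis i 1))" "ap (grp_op w) (yN i) = vecN (w *v axis i 1)"
  using grp_op_gens(3)[of w "axis i 1"] grp_op_gens(4)[of w "axis i 1"] by (simp_all add: covN_simps vecN_simps)

lemma grp_op_mult:
  assumes "invertible u" "invertible w"
  shows "grp_op u * grp_op w = grp_op (u ** w)"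
proof (rule op_eqI)
  fix n show "ap (grp_op u * grp_op w) n = ap (grp_op (u ** w)) n"
    by (induction n rule: nf_induct)
      (simp_all add: grp_op_mult_nf ap_add ap_psc dual_act_mult[OF assms] matrix_vector_mul_assoc matrix_mul_assoc)
qed

lemma grp_op_one: "grp_op (mat 1) = 1"
proof (rule op_eqI)
  fix n :: "'a nf" show "ap (grp_op (mat 1)) n = ap 1 n"
    by (induction n rule: nf_induct)
      (simp_all add: grp_op_mult_nf ap_add ap_psc dual_act_simps covN_simps vecN_simps)
qed

lemma grp_op_cov_op: "grp_op w * cov_op \<xi> = cov_op (dual_act w \<xi>) * grp_op w"
  by (rule op_eqI) (simp add: grp_op_mult_nf)

lemma xfree_grp_op: "xfree n \<Longrightarrow> xfree (ap (grp_op w) n)"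
proof -
  assume n: "xfree n"
  have "xfree (psc (coef n k) (act_key w k))" if "k \<in> Poly_Mapping.keys n" for k
  proof -
    have "fst k = {#}" using that n by (simp add: xfree_def)
    then obtain \<nu> G where "k = ({#}, \<nu>, G)" by (cases k) auto
    then show ?thesis
      by (auto intro!: xfree_psc xfree_mult xfree_prod_mset xfree_vecN xfree_gN)
  qed
  then show ?thesis unfolding ap_grp_op pm.lext_def by (rule xfree_sum)
qed

context reflection_algebra
begin

text \<open>The right-hand side of the relation for \<open>[v, \<xi>]\<close>, as an operator.\<close>

definition yx_op :: "complex ^ 'n \<Rightarrow> complex ^ 'n \<Rightarrow> 'n nf_op" where
  "yx_op \<xi> v = osc (t * pairing \<xi> v) 1 - (\<Sum>s\<in>R. osc (refl_coef s \<xi> v) (grp_op s))"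

lemma ap_yx_op: "ap (yx_op \<xi> v) n = psc (t * pairing \<xi> v) n - (\<Sum>s\<in>R. psc (refl_coef s \<xi> v) (ap (grp_op s) n))"
  by (simp add: yx_op_def)

lemma yx_op_simps:
  "yx_op (\<xi> + \<xi>') v = yx_op \<xi> v + yx_op \<xi>' v" "yx_op (a *s \<xi>) v = osc a (yx_op \<xi> v)"
  "yx_op \<xi> (v + v') = yx_op \<xi> v + yx_op \<xi> v'" "yx_op \<xi> (a *s v) = osc a (yx_op \<xi> v)"
  by (simp_all add: yx_op_def refl_coef_simps op.scale_left_distrib op.scale_right_diff_distrib op.scale_sum_right
      sum.distrib algebra_simps)

lemma yx_op_symmetric:
  "covN \<xi> * ap (yx_op \<xi>' v) n + ap (yx_op \<xi> v) (covN \<xi>' * n) = covN \<xi>' * ap (yx_op \<xi> v) n + ap (yx_op \<xi>' v) (covN \<xi> * n)"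
proof -
  have "covN \<xi> * psc (refl_coef s \<xi>' v) (ap (grp_op s) n) + psc (refl_coef s \<xi> v) (ap (grp_op s) (covN \<xi>' * n))
      = covN (refl_coef s \<xi>' v *s \<xi> + refl_coef s \<xi> v *s dual_act s \<xi>') * ap (grp_op s) n" for s \<xi> \<xi>'
    by (simp add: covN_simps grp_op_mult_nf distrib_right pma.scale_mult_left pma.scale_mult_right)
  then have "(\<Sum>s\<in>R. covN \<xi> * psc (refl_coef s \<xi>' v) (ap (grp_op s) n) + psc (refl_coef s \<xi> v) (ap (grp_op s) (covN \<xi>' * n)))
    = (\<Sum>s\<in>R. covN \<xi>' * psc (refl_coef s \<xi> v) (ap (grp_op s) n) + psc (refl_coef s \<xi>' v) (ap (grp_op s) (covN \<xi> * n)))"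
    by (simp only:) (intro sum.cong refl, simp only: refl_coef_dual_symmetric)
  then show ?thesis
    by (simp add: ap_yx_op right_diff_distrib sum.distrib sum_distrib_left pma.scale_mult_right algebra_simps)
qed

text \<open>If \<open>q\<close> is the image of \<open>p\<close> under the operator of \<open>v\<close>, then the second component is the image of
  \<open>x\<^sub>i p\<close> that the relation for \<open>[v, x\<^sub>i]\<close> forces. The operator of \<open>v\<close> is obtained by folding these steps
  over the letters \<open>x\<close>; by \<open>yx_op_symmetric\<close> their order is irrelevant.\<close>

definition ystep :: "complex ^ 'n \<Rightarrow> 'n \<Rightarrow> 'n nf \<times> 'n nf \<Rightarrow> 'n nf \<times> 'n nf" where
  "ystep v i = (\<lambda>(p, q). (xN i * p, xN i * q + ap (yx_op (axis i 1) v) p))"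

lemma ystep_apply:
  "fst (ystep v i z) = xN i * fst z" "snd (ystep v i z) = xN i * snd z + ap (yx_op (axis i 1) v) (fst z)"
  by (simp_all add: ystep_def case_prod_beta)

lemma ystep_commute: "comp_fun_commute (ystep v)"
proof
  fix i j
  show "ystep v j \<circ> ystep v i = ystep v i \<circ> ystep v j"
  proof (rule ext, clarify)
    fix p q
    show "(ystep v j \<circ> ystep v i) (p, q) = (ystep v i \<circ> ystep v j) (p, q)"
      using yx_op_symmetric[of "axis j 1" "axis i 1" v p]
      by (simp add: ystep_def covN_simps algebra_simps)
  qed
qed

fun dunkl_key :: "complex ^ 'n \<Rightarrow> 'n nf_key \<Rightarrow> 'n nf" where
  "dunkl_key v (\<mu>, k) = snd (fold_mset (ystep v) (sgl ({#}, k) 1, vecN v * sgl ({#}, k) 1) \<mu>)"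

text \<open>Setting the \<open>y\<^sub>i\<close> to \<open>0\<close> and the \<open>g\<^sub>u\<close> to \<open>1\<close> turns this into the usual Dunkl operator on polynomials in \<open>x\<close>,
  \<open>t \<partial>\<^sub>v\<close> minus divided differences. The recursion avoids dividing by \<open>\<alpha> s\<close>.\<close>

definition dunkl :: "complex ^ 'n \<Rightarrow> 'n nf_op" where
  "dunkl v = Op (pm.lext (dunkl_key v))"

lemma ap_dunkl: "ap (dunkl v) n = pm.lext (dunkl_key v) n"
  unfolding dunkl_def by (subst ap_Op) (simp_all add: pm.lext_add pm.lext_psc)

lemma dunkl_xfree: "xfree n \<Longrightarrow> ap (dunkl v) n = vecN v * n"
proof -
  assume n: "xfree n"
  have "ap (dunkl v) n = (\<Sum>k\<in>Poly_Mapping.keys n. psc (coef n k) (vecN v * sgl k 1))"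
    unfolding ap_dunkl pm.lext_def
  proof (rule sum.cong[OF refl])
    fix k assume "k \<in> Poly_Mapping.keys n"
    then obtain l where "k = ({#}, l)" using n by (cases k) (auto simp: xfree_def)
    then show "psc (coef n k) (dunkl_key v k) = psc (coef n k) (vecN v * sgl k 1)" by simp
  qed
  also have "\<dots> = vecN v * (\<Sum>k\<in>Poly_Mapping.keys n. sgl k (coef n k))"
    by (simp add: sum_distrib_left pma.scale_mult_right[symmetric])
  finally show ?thesis by (simp add: poly_mapping_sum_single[symmetric])
qed

lemma dunkl_x: "ap (dunkl v) (xN i * n) = xN i * ap (dunkl v) n + ap (yx_op (axis i 1) v) n"
proof (induction n rule: pm_induct)
  case (single k a)
  interpret comp_fun_commute "ystep v" by (rule ystep_commute)
  obtain \<mu> \<nu> G where k: "k = (\<mu>, \<nu>, G)" by (cases k)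
  let ?f = "fold_mset (ystep v) (sgl ({#}, \<nu>, G) 1, vecN v * sgl ({#}, \<nu>, G) 1)"
  have f: "?f (add_mset j \<mu>) = ystep v j (?f \<mu>)" for j \<mu>
    by (rule fold_mset_add_mset)
  have "fst (?f \<mu>) = sgl (\<mu>, \<nu>, G) 1" for \<mu>
  proof (induction \<mu>)
    case (add j \<mu>)
    then show ?case by (simp only: f ystep_apply sgl_add_mset)
  qed simp
  then have "snd (?f (add_mset i \<mu>)) = xN i * snd (?f \<mu>) + ap (yx_op (axis i 1) v) (sgl (\<mu>, \<nu>, G) 1)"
    by (simp only: f ystep_apply)
  then have "psc a (snd (?f (add_mset i \<mu>))) = xN i * psc a (snd (?f \<mu>)) + ap (yx_op (axis i 1) v) (psc a (sgl (\<mu>, \<nu>, G) 1))"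
    by (simp add: psc_add_right ap_psc pma.scale_mult_right del: psc_single)
  moreover have "ap (dunkl v) (sgl (\<kappa>, \<nu>, G) a) = psc a (snd (?f \<kappa>))" for \<kappa>
    by (simp only: ap_dunkl pm.lext_single dunkl_key.simps)
  ultimately show ?case
    by (simp only: k sgl_add_mset[symmetric] psc_single mult_1_right)
qed (simp add: ap_add distrib_left)

lemma dunkl_cov: "ap (dunkl v) (covN \<xi> * n) = covN \<xi> * ap (dunkl v) n + ap (yx_op \<xi> v) n"
proof -
  have "yx_op (\<Sum>i\<in>I. f i) v = (\<Sum>i\<in>I. yx_op (f i) v)" if "finite I" for f and I :: "'n set"
    using that
  proof (induction I rule: finite_induct)
    case empty
    have "yx_op (0 *s 0) v = osc 0 (yx_op 0 v)" by (rule yx_op_simps)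
    then show ?case by simp
  qed (simp add: yx_op_simps)
  then have yx_op: "yx_op \<xi> v = (\<Sum>i\<in>UNIV. osc (\<xi> $ i) (yx_op (axis i 1) v))"
    by (subst basis_expansion[symmetric]) (simp add: yx_op_simps)
  show ?thesis
    by (simp add: yx_op covN_def sum_distrib_right ap_sum ap_psc pma.scale_mult_left dunkl_x psc_add_right sum.distrib)
qed

lemma dunkl_cov_op: "dunkl v * cov_op \<xi> = cov_op \<xi> * dunkl v + yx_op \<xi> v"
  by (rule op_eqI) (simp add: dunkl_cov)

lemma yx_op_equivariant:
  assumes w: "w \<in> W"
  shows "grp_op w * yx_op \<xi> v = yx_op (dual_act w \<xi>) (w *v v) * grp_op w"
proof -
  have s: "grp_op w * grp_op s = grp_op (w ** s ** matrix_inv w) * grp_op w" if "s \<in> R" for s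
  proof -
    have sW: "s \<in> W" using that R_subset by blast
    show ?thesis
      using conj_matrix(1)[OF w sW] W_invertible[OF w] W_invertible[OF sW]
        W_invertible[OF W_mult[OF W_mult[OF w sW] W_inv[OF w]]]
      by (simp add: grp_op_mult)
  qed
  have "(\<Sum>s\<in>R. osc (refl_coef s \<xi> v) (grp_op w * grp_op s))
      = (\<Sum>s\<in>R. osc (refl_coef (w ** s ** matrix_inv w) (dual_act w \<xi>) (w *v v)) (grp_op (w ** s ** matrix_inv w) * grp_op w))"
    by (intro sum.cong refl) (simp add: s refl_coef_equivariant[OF w])
  also have "\<dots> = (\<Sum>s\<in>R. osc (refl_coef s (dual_act w \<xi>) (w *v v)) (grp_op s * grp_op w))"
    by (rule sum_reflections_conj[OF w, of "\<lambda>s. osc (refl_coef s (dual_act w \<xi>) (w *v v)) (grp_op s * grp_op w)"])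
  finally show ?thesis
    using w by (simp add: yx_op_def algebra_simps sum_distrib_left sum_distrib_right op.scale_mult_left op.scale_mult_right)
qed

text \<open>Both sides commute past \<open>x\<close> in the same way, because the relation for \<open>[v, \<xi>]\<close> is equivariant, and they
  agree on normal forms without \<open>x\<close>.\<close>

lemma grp_op_dunkl:
  assumes w: "w \<in> W"
  shows "grp_op w * dunkl v = dunkl (w *v v) * grp_op w"
proof (rule op_eqI)
  fix n show "ap (grp_op w * dunkl v) n = ap (dunkl (w *v v) * grp_op w) n"
  proof (induction n rule: nf_x_induct)
    case (xfree n)
    then show ?case by (simp add: dunkl_xfree xfree_grp_op grp_op_mult_nf)
  next
    case (x i n)
    have "ap (grp_op w * yx_op (axis i 1) v) n = ap (yx_op (dual_act w (axis i 1)) (w *v v) * grp_op w) n"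
      by (simp only: yx_op_equivariant[OF w])
    then show ?case using x by (simp add: dunkl_x grp_op_mult_nf ap_add dunkl_cov)
  qed (simp add: ap_add)
qed

lemma dunkl_simps: "dunkl (v + v') = dunkl v + dunkl v'" "dunkl (a *s v) = osc a (dunkl v)"
proof -
  show "dunkl (v + v') = dunkl v + dunkl v'"
  proof (rule op_eqI)
    fix n show "ap (dunkl (v + v')) n = ap (dunkl v + dunkl v') n"
      by (induction n rule: nf_x_induct) (simp_all add: dunkl_xfree dunkl_x vecN_simps yx_op_simps ap_add distrib_left distrib_right add_ac)
  qed
  show "dunkl (a *s v) = osc a (dunkl v)"
  proof (rule op_eqI)
    fix n show "ap (dunkl (a *s v)) n = ap (osc a (dunkl v)) n"
      by (induction n rule: nf_x_induct)
        (simp_all add: dunkl_xfree dunkl_x vecN_simps yx_op_simps ap_add psc_add_right pma.scale_mult_left pma.scale_mult_right)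
  qed
qed

lemma cov_op_sum: "cov_op (sum f A) = (\<Sum>i\<in>A. cov_op (f i))" for f :: "'i \<Rightarrow> complex ^ 'n"
proof -
  have "cov_op (0 *s 0 :: complex ^ 'n) = osc 0 (cov_op 0)" by (rule cov_op_simps)
  then show ?thesis by (induction A rule: infinite_finite_induct) (simp_all add: cov_op_simps)
qed

lemma dunkl_sum: "dunkl (sum f A) = (\<Sum>i\<in>A. dunkl (f i))"
proof -
  have "dunkl (0 *s 0) = osc 0 (dunkl 0)" by (rule dunkl_simps)
  then show ?thesis by (induction A rule: infinite_finite_induct) (simp_all add: dunkl_simps)
qed

lemma cov_op_diff: "cov_op (\<xi> - a *s \<zeta>) = cov_op \<xi> - osc a (cov_op \<zeta>)"
  using cov_op_simps(1)[of "\<xi> - a *s \<zeta>" "a *s \<zeta>"] by (simp add: cov_op_simps(2))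

lemma dunkl_diff: "dunkl (v - a *s v') = dunkl v - osc a (dunkl v')"
  using dunkl_simps(1)[of "v - a *s v'" "a *s v'"] by (simp add: dunkl_simps(2))

lemma cov_op_expand: "cov_op \<xi> = (\<Sum>i\<in>UNIV. osc (\<xi> $ i) (cov_op (axis i 1)))"
  for \<xi> :: "complex ^ 'n"
  by (subst basis_expansion[symmetric]) (simp only: cov_op_sum cov_op_simps)

lemma dunkl_expand: "dunkl v = (\<Sum>i\<in>UNIV. osc (v $ i) (dunkl (axis i 1)))"
  by (subst basis_expansion[symmetric]) (simp only: dunkl_sum dunkl_simps)

text \<open>The commutator \<open>C\<close> of the two operators commutes with every \<open>x\<close>: by the Jacobi identity
  \<open>[C, x]\<close> is the difference of \<open>[Y\<^sub>v, [Y\<^sub>v\<^sub>', x]]\<close> and \<open>[Y\<^sub>v\<^sub>', [Y\<^sub>v, x]]\<close>, which are equal by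
  \<open>refl_coef_vec_symmetric\<close>. On normal forms without \<open>x\<close> the operators are multiplications, so \<open>C\<close>
  vanishes there, and hence everywhere.\<close>

lemma dunkl_commute: "dunkl v * dunkl v' = dunkl v' * dunkl v"
proof -
  have YB: "dunkl v * yx_op \<xi> v' - yx_op \<xi> v' * dunkl v = dunkl v' * yx_op \<xi> v - yx_op \<xi> v * dunkl v'" for \<xi>
  proof -
    have *: "dunkl v * grp_op s - grp_op s * dunkl v = grp_op s * dunkl (matrix_inv s *v v - v)" if "s \<in> R" for s v
    proof -
      have sW: "s \<in> W" using that R_subset by blast
      have "dunkl v * grp_op s = grp_op s * dunkl (matrix_inv s *v v - v + v)"
        using grp_op_dunkl[OF sW, of "matrix_inv s *v v"] sW by simp
      then show ?thesis by (simp only: dunkl_simps distrib_left add_diff_cancel_right')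
    qed
    have "dunkl v * yx_op \<xi> v' - yx_op \<xi> v' * dunkl v = - (\<Sum>s\<in>R. grp_op s * dunkl (refl_coef s \<xi> v' *s (matrix_inv s *v v - v)))" for v v'
    proof -
      have "dunkl v * yx_op \<xi> v' - yx_op \<xi> v' * dunkl v = - (\<Sum>s\<in>R. osc (refl_coef s \<xi> v') (dunkl v * grp_op s - grp_op s * dunkl v))"
        by (simp add: yx_op_def algebra_simps sum_distrib_left sum_distrib_right op.scale_mult_left
            op.scale_mult_right op.scale_right_diff_distrib sum_subtractf)
      also have "(\<Sum>s\<in>R. osc (refl_coef s \<xi> v') (dunkl v * grp_op s - grp_op s * dunkl v))
          = (\<Sum>s\<in>R. grp_op s * dunkl (refl_coef s \<xi> v' *s (matrix_inv s *v v - v)))"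
        by (rule sum.cong) (simp_all only: * dunkl_simps op.scale_mult_right)
      finally show ?thesis .
    qed
    then show ?thesis by (simp only: refl_coef_vec_symmetric cong: sum.cong)
  qed
  define C where "C = dunkl v * dunkl v' - dunkl v' * dunkl v"
  have CX: "C * cov_op \<xi> = cov_op \<xi> * C" for \<xi>
  proof -
    have YX: "dunkl u * (cov_op \<xi> * A) = cov_op \<xi> * (dunkl u * A) + yx_op \<xi> u * A" for u A
      by (simp add: dunkl_cov_op distrib_right flip: mult.assoc)
    have "C * cov_op \<xi> = cov_op \<xi> * C
        + ((dunkl v * yx_op \<xi> v' - yx_op \<xi> v' * dunkl v) - (dunkl v' * yx_op \<xi> v - yx_op \<xi> v * dunkl v'))"
      by (simp add: C_def dunkl_cov_op YX algebra_simps)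
    then show ?thesis by (simp add: YB)
  qed
  have "ap C n = 0" for n
  proof (induction n rule: nf_x_induct)
    case (xfree n)
    then show ?case by (simp add: C_def dunkl_xfree xfree_mult xfree_vecN mult.left_commute)
  next
    case (x i n)
    have "ap (C * cov_op (axis i 1)) n = ap (cov_op (axis i 1) * C) n" by (simp only: CX)
    then show ?case using x by (simp add: covN_simps)
  qed (simp add: ap_add)
  then have "C = 0" by (intro op_eqI) simp
  then show ?thesis by (simp add: C_def)
qed

lemma cov_op_commute: "cov_op \<xi> * cov_op \<xi>' = cov_op \<xi>' * cov_op \<xi>"
  by (rule op_eqI) (simp add: mult.left_commute)

end

section \<open>The smash product and its action on normal forms\<close>

lemma const_T_mult: "const_T a * p = psc a p"
  by (simp add: const_T_def psc_conv_mult)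

lemma const_T_psc: "const_T a = psc a 1"
  by (metis const_T_mult mult_1_right)

lemma tensor_act_conv_lext: "tensor_act w p = pm.lext (\<lambda>u. prod_list (map (letter_act w) (letters u))) p"
  by (simp add: tensor_act_def pm.lext_def const_T_mult)

lemma tensor_act_add: "tensor_act w (p + q) = tensor_act w p + tensor_act w q"
  and tensor_act_psc: "tensor_act w (psc a p) = psc a (tensor_act w p)"
  and tensor_act_mult: "tensor_act w (p * q) = tensor_act w p * tensor_act w q"
  and tensor_act_zero [simp]: "tensor_act w 0 = 0"
  and tensor_act_one [simp]: "tensor_act w 1 = 1"
  and tensor_act_letter: "tensor_act w (letter_T l) = letter_act w l"
proof -
  show "tensor_act w (p + q) = tensor_act w p + tensor_act w q"
    "tensor_act w (psc a p) = psc a (tensor_act w p)" "tensor_act w 0 = 0"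
    by (simp_all add: tensor_act_conv_lext pm.lext_add pm.lext_psc)
  show "tensor_act w (p * q) = tensor_act w p * tensor_act w q"
    unfolding tensor_act_conv_lext by (rule pma.lext_mult) (simp add: plus_free_word_def)
  show "tensor_act w 1 = 1"
  proof -
    have "tensor_act w 1 = pm.lext (\<lambda>u. prod_list (map (letter_act w) (letters u))) (sgl 0 1)"
      by (simp add: tensor_act_conv_lext)
    also have "\<dots> = 1" by (subst pm.lext_single) (simp add: zero_free_word_def)
    finally show ?thesis .
  qed
  show "tensor_act w (letter_T l) = letter_act w l"
    by (simp add: tensor_act_conv_lext letter_T_def)
qed

lemma tensor_act_sum: "tensor_act w (sum f I) = (\<Sum>i\<in>I. tensor_act w (f i))"
  by (induction I rule: infinite_finite_induct) (simp_all add: tensor_act_add)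

lemma tensor_induct [case_names one letter psc add]:
  fixes p :: "'n tensor"
  assumes "P 1" "\<And>l p. P p \<Longrightarrow> P (letter_T l * p)" "\<And>a p. P p \<Longrightarrow> P (psc a p)"
    "\<And>p q. P p \<Longrightarrow> P q \<Longrightarrow> P (p + q)"
  shows "P p"
proof (induction p rule: pm_induct)
  case (single k a)
  have "P (sgl (Word ls) 1)" for ls
  proof (induction ls)
    case Nil
    then show ?case using assms(1) by (simp flip: zero_free_word_def)
  next
    case (Cons l ls)
    have "sgl (Word (l # ls)) 1 = letter_T l * sgl (Word ls) 1"
      by (simp add: letter_T_def mult_single plus_free_word_def)
    then show ?case using assms(2)[OF Cons] by simp
  qed
  from assms(3)[OF this, of a "letters k"] show ?case by simp
qed (rule assms(4))

lemma vec_T_simps: "vec_T (v + v') = vec_T v + vec_T v'" "vec_T (a *s v) = psc a (vec_T v)"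
  "vec_T (axis i 1) = letter_T (VecL i)"
  and cov_T_simps: "cov_T (\<xi> + \<xi>') = cov_T \<xi> + cov_T \<xi>'" "cov_T (a *s \<xi>) = psc a (cov_T \<xi>)"
  "cov_T (axis i 1) = letter_T (CovL i)" for i :: "'n :: finite"
proof -
  have "psc (axis i 1 $ j) m = (if j = i then m else 0)" for j :: 'n and m :: "'n tensor"
    by (simp add: axis_def)
  then show "vec_T (axis i 1) = letter_T (VecL i)" "cov_T (axis i 1) = letter_T (CovL i)"
    by (simp_all add: vec_T_def cov_T_def const_T_mult)
qed (simp_all add: vec_T_def cov_T_def const_T_mult pm.scale_left_distrib sum.distrib pm.scale_sum_right)

lemma vec_T_sum: "vec_T (sum f I) = (\<Sum>i\<in>I. vec_T (f i))"
  and cov_T_sum: "cov_T (sum f I) = (\<Sum>i\<in>I. cov_T (f i))" for f :: "'i \<Rightarrow> complex ^ 'n"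
proof -
  have "vec_T (0 *s 0 :: complex ^ 'n) = psc 0 (vec_T 0)" "cov_T (0 *s 0 :: complex ^ 'n) = psc 0 (cov_T 0)"
    by (rule vec_T_simps cov_T_simps)+
  then show "vec_T (sum f I) = (\<Sum>i\<in>I. vec_T (f i))" "cov_T (sum f I) = (\<Sum>i\<in>I. cov_T (f i))"
    by (induction I rule: infinite_finite_induct) (simp_all add: vec_T_simps cov_T_simps)
qed

lemma tensor_act_vec_T: "tensor_act w (vec_T v) = vec_T (w *v v)"
  and tensor_act_cov_T: "tensor_act w (cov_T \<xi>) = cov_T (dual_act w \<xi>)"
  for w :: "complex ^ 'n ^ 'n"
proof -
  have "tensor_act w (vec_T v) = vec_T (\<Sum>i\<in>UNIV. v $ i *s (w *v axis i 1))"
    by (simp add: vec_T_def[of v] const_T_mult tensor_act_sum tensor_act_psc tensor_act_letter vec_T_sum vec_T_simps)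
  also have "(\<Sum>i\<in>UNIV. v $ i *s (w *v axis i 1)) = w *v (\<Sum>i\<in>UNIV. v $ i *s axis i 1)"
    by (simp add: matrix_vector_sum matrix_vector_simps)
  finally show "tensor_act w (vec_T v) = vec_T (w *v v)" by (simp add: basis_expansion)
  have "tensor_act w (cov_T \<xi>) = cov_T (\<Sum>i\<in>UNIV. \<xi> $ i *s (dual_act w (axis i 1)))"
    by (simp add: cov_T_def[of \<xi>] const_T_mult tensor_act_sum tensor_act_psc tensor_act_letter cov_T_sum cov_T_simps)
  also have "(\<Sum>i\<in>UNIV. \<xi> $ i *s (dual_act w (axis i 1))) = dual_act w (\<Sum>i\<in>UNIV. \<xi> $ i *s axis i 1)"
    by (simp add: dual_act_sum dual_act_simps)
  finally show "tensor_act w (cov_T \<xi>) = cov_T (dual_act w \<xi>)" by (simp add: basis_expansion)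
qed

lemma tensor_act_act:
  assumes "invertible u" "invertible w"
  shows "tensor_act u (tensor_act w p) = tensor_act (u ** w) p"
proof (induction p rule: tensor_induct)
  case (letter l p)
  have "tensor_act u (tensor_act w (letter_T l)) = tensor_act (u ** w) (letter_T l)"
  proof (cases l)
    case (VecL i)
    then show ?thesis
      by (simp add: vec_T_simps(3)[symmetric] tensor_act_vec_T matrix_vector_mul_assoc)
  next
    case (CovL i)
    then show ?thesis
      by (simp add: cov_T_simps(3)[symmetric] tensor_act_cov_T dual_act_mult[OF assms])
  qed
  then show ?case using letter by (simp add: tensor_act_mult)
qed (simp_all add: tensor_act_add tensor_act_psc)

lemma tensor_act_id: "tensor_act (mat 1) p = p"
proof (induction p rule: tensor_induct)
  case (letter l p)
  have "tensor_act (mat 1) (letter_T l) = letter_T l"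
    by (cases l) (simp_all add: vec_T_simps(3)[symmetric] tensor_act_vec_T cov_T_simps(3)[symmetric]
        tensor_act_cov_T dual_act_simps)
  then show ?case using letter by (simp add: tensor_act_mult)
qed (simp_all add: tensor_act_add tensor_act_psc)

context reflection_algebra
begin

abbreviation S where "S \<equiv> smash W"

abbreviation smash_times (infixl \<open>\<star>\<close> 70) where "f \<star> g \<equiv> f \<otimes>\<^bsub>S\<^esub> g"

lemma smash_simps:
  "carrier S = {f. \<forall>w. w \<notin> W \<longrightarrow> f w = 0}" "\<zero>\<^bsub>S\<^esub> = 0" "f \<oplus>\<^bsub>S\<^esub> g = f + g"
  by (auto simp: smash_def zero_fun_def plus_fun_def)

lemma smash_mult_raw: "f \<star> g = (\<lambda>w. \<Sum>(u, v) \<in> {(u, v) \<in> W \<times> W. u ** v = w}. f u * tensor_act u (g v))"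
  by (simp add: smash_def)

text \<open>For fixed \<open>w\<close> a pair \<open>(u, v)\<close> with \<open>u v = w\<close> is determined by \<open>u\<close>.\<close>

lemma smash_mult:
  assumes w: "w \<in> W"
  shows "(f \<star> g) w = (\<Sum>u\<in>W. f u * tensor_act u (g (matrix_inv u ** w)))"
  unfolding smash_mult_raw
proof (rule sum.reindex_bij_witness[of _ "\<lambda>u. (u, matrix_inv u ** w)" fst], goal_cases)
  case (1 a)
  then show ?case by (auto simp: matrix_mul_assoc W_inv_cancel)
next
  case (4 u)
  then show ?case using w by (auto simp: matrix_mul_assoc W_inv_cancel intro: W_mult W_inv)
next
  case (5 a)
  then show ?case by (auto simp: matrix_mul_assoc W_inv_cancel)
qed auto

lemma smash_mult_outside: "w \<notin> W \<Longrightarrow> (f \<star> g) w = 0"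
  unfolding smash_mult_raw by (rule sum.neutral) (use W_mult in auto)

lemma smash_mult_closed: "f \<star> g \<in> carrier S"
  using smash_mult_outside by (simp add: smash_simps)

lemma smash_add_mult:
  "(f + g) \<star> h = f \<star> h + g \<star> h" "f \<star> (g + h) = f \<star> g + f \<star> h"
  by (rule ext; simp add: smash_mult_raw case_prod_beta distrib_right distrib_left tensor_act_add sum.distrib)+

lemma smash_assoc: "f \<star> g \<star> h = f \<star> (g \<star> h)"
proof
  fix w
  show "(f \<star> g \<star> h) w = (f \<star> (g \<star> h)) w"
  proof (cases "w \<in> W")
    case w: True
    let ?F = "\<lambda>a u. f a * (tensor_act a (g (matrix_inv a ** u)) * tensor_act u (h (matrix_inv u ** w)))"
    have "(f \<star> g \<star> h) w = (\<Sum>u\<in>W. \<Sum>a\<in>W. ?F a u)"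
      by (simp add: smash_mult w sum_distrib_right mult.assoc)
    also have "\<dots> = (\<Sum>a\<in>W. \<Sum>u\<in>W. ?F a u)" by (rule sum.swap)
    also have "\<dots> = (\<Sum>a\<in>W. \<Sum>b\<in>W. ?F a (a ** b))"
    proof (rule sum.cong[OF refl])
      fix a assume a: "a \<in> W"
      show "(\<Sum>u\<in>W. ?F a u) = (\<Sum>b\<in>W. ?F a (a ** b))"
        by (rule sum.reindex_bij_witness[of _ "\<lambda>b. a ** b" "\<lambda>u. matrix_inv a ** u"])
          (use a in \<open>auto simp: matrix_mul_assoc W_inv_cancel intro: W_mult W_inv\<close>)
    qed
    also have "\<dots> = (\<Sum>a\<in>W. \<Sum>b\<in>W. f a * tensor_act a (g b * tensor_act b (h (matrix_inv b ** (matrix_inv a ** w)))))"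
    proof (intro sum.cong refl)
      fix a b assume a: "a \<in> W" and b: "b \<in> W"
      have "matrix_inv (a ** b) = matrix_inv b ** matrix_inv a"
      proof (rule matrix_inv_eq(1))
        show "a ** b ** (matrix_inv b ** matrix_inv a) = mat 1"
          using a b by (simp add: matrix_mul_assoc W_inv_cancel)
      qed
      moreover have "matrix_inv a ** (a ** b) = b" using a by (simp add: matrix_mul_assoc W_inv_cancel)
      ultimately show "?F a (a ** b) = f a * tensor_act a (g b * tensor_act b (h (matrix_inv b ** (matrix_inv a ** w))))"
        using a b by (simp add: tensor_act_mult tensor_act_act W_invertible matrix_mul_assoc)
    qed
    also have "\<dots> = (f \<star> (g \<star> h)) w"
      using w by (simp add: smash_mult W_mult W_inv tensor_act_sum sum_distrib_left)
    finally show ?thesis .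
  qed (simp add: smash_mult_outside)
qed

lemma smash_term_in: "w \<in> W \<Longrightarrow> smash_term p w \<in> carrier S"
  by (auto simp: smash_simps smash_term_def)

lemma smash_one: "\<one>\<^bsub>S\<^esub> = smash_term 1 (mat 1)"
  by (simp add: smash_def smash_term_def)

lemma smash_term_mult:
  assumes u: "u \<in> W" and v: "v \<in> W"
  shows "smash_term p u \<star> smash_term q v = smash_term (p * tensor_act u q) (u ** v)"
proof
  fix w
  show "(smash_term p u \<star> smash_term q v) w = smash_term (p * tensor_act u q) (u ** v) w"
  proof (cases "w \<in> W")
    case w: True
    have "(smash_term p u \<star> smash_term q v) w
        = (\<Sum>a\<in>W. if a = u then p * tensor_act a (smash_term q v (matrix_inv a ** w)) else 0)"
      by (simp add: smash_mult[OF w] smash_term_def[of p] if_distrib[of "\<lambda>x. x * _"] cong: if_cong)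
    also have "\<dots> = p * tensor_act u (smash_term q v (matrix_inv u ** w))"
      using u finite_W by (simp add: sum.delta)
    also have "\<dots> = smash_term (p * tensor_act u q) (u ** v) w"
    proof -
      have "matrix_inv u ** w = v \<longleftrightarrow> w = u ** v"
        using u by (auto simp: matrix_mul_assoc W_inv_cancel)
      then show ?thesis by (simp add: smash_term_def)
    qed
    finally show ?thesis .
  next
    case False
    then show ?thesis using W_mult[OF u v] by (auto simp: smash_mult_outside smash_term_def)
  qed
qed

lemma smash_expand:
  assumes f: "f \<in> carrier S"
  shows "f = (\<Sum>w\<in>W. smash_term (f w) w)"
proof
  fix u
  have "(\<Sum>w\<in>A. smash_term (f w) w) u = (\<Sum>w\<in>A. smash_term (f w) w u)" if "finite A" for A
    using that by (induction A rule: finite_induct) simp_all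
  then show "f u = (\<Sum>w\<in>W. smash_term (f w) w) u"
    using f finite_W by (simp add: smash_term_def sum.delta' smash_simps)
qed

lemma smash_zero_mult [simp]: "g \<star> 0 = 0" "0 \<star> g = 0"
  by (rule ext; simp add: smash_mult_raw zero_fun_def)+

lemma smash_one_mult:
  assumes f: "f \<in> carrier S"
  shows "\<one>\<^bsub>S\<^esub> \<star> f = f" "f \<star> \<one>\<^bsub>S\<^esub> = f"
proof -
  have l: "\<one>\<^bsub>S\<^esub> \<star> smash_term p w = smash_term p w" and r: "smash_term p w \<star> \<one>\<^bsub>S\<^esub> = smash_term p w"
    if "w \<in> W" for p w
    using that W_one by (simp_all add: smash_one smash_term_mult tensor_act_id)
  have "\<one>\<^bsub>S\<^esub> \<star> (\<Sum>w\<in>A. smash_term (f w) w) = (\<Sum>w\<in>A. smash_term (f w) w)"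
    "(\<Sum>w\<in>A. smash_term (f w) w) \<star> \<one>\<^bsub>S\<^esub> = (\<Sum>w\<in>A. smash_term (f w) w)" if "finite A" "A \<subseteq> W" for A
    using that by (induction A rule: finite_induct) (simp_all add: smash_add_mult l r del: plus_fun_apply zero_fun_apply)
  from this[OF finite_W order_refl] show "\<one>\<^bsub>S\<^esub> \<star> f = f" "f \<star> \<one>\<^bsub>S\<^esub> = f"
    by (simp_all only: smash_expand[OF f, symmetric])
qed

lemma smash_ring: "ring S"
proof (rule ringI)
  show "abelian_group S"
  proof (rule abelian_groupI)
    fix f assume f: "f \<in> carrier S"
    show "\<exists>g\<in>carrier S. g \<oplus>\<^bsub>S\<^esub> f = \<zero>\<^bsub>S\<^esub>"
      by (rule bexI[of _ "- f"]) (use f in \<open>auto simp: smash_simps\<close>)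
  qed (auto simp: smash_simps add_ac)
  show "Group.monoid S"
  proof (rule monoidI)
    show "\<one>\<^bsub>S\<^esub> \<in> carrier S" by (simp add: smash_one smash_term_in W_one)
  qed (auto intro: smash_mult_closed smash_assoc smash_one_mult)
qed (auto simp: smash_simps(3) smash_add_mult)

sublocale S: ring S by (rule smash_ring)

lemma smash_uminus: "f \<in> carrier S \<Longrightarrow> \<ominus>\<^bsub>S\<^esub> f = - f"
  by (rule S.minus_equality) (auto simp: smash_simps)

lemma smash_minus: "g \<in> carrier S \<Longrightarrow> f \<ominus>\<^bsub>S\<^esub> g = f - g"
  by (simp add: a_minus_def smash_uminus smash_simps(3))

lemma smash_carrier_closed:
  "0 \<in> carrier S" "f \<in> carrier S \<Longrightarrow> g \<in> carrier S \<Longrightarrow> f + g \<in> carrier S"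
  "f \<in> carrier S \<Longrightarrow> g \<in> carrier S \<Longrightarrow> f - g \<in> carrier S"
  "f \<in> carrier S \<Longrightarrow> - f \<in> carrier S"
  by (auto simp: smash_simps(1))

lemma smash_finsum:
  "finite A \<Longrightarrow> (\<And>i. i \<in> A \<Longrightarrow> f i \<in> carrier S) \<Longrightarrow> finsum S f A = sum f A \<and> sum f A \<in> carrier S"
  by (induction A rule: finite_induct)
    (auto simp: smash_simps(2,3) smash_carrier_closed)

lemma smash_gens_in [simp]:
  "const_A a \<in> carrier S" "vec_A v \<in> carrier S" "cov_A \<xi> \<in> carrier S" "w \<in> W \<Longrightarrow> grp_A w \<in> carrier S"
  by (simp_all add: const_A_def vec_A_def cov_A_def grp_A_def smash_term_in W_one)

fun letter_op :: "'n letter \<Rightarrow> 'n nf_op" where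
  "letter_op (VecL i) = dunkl (axis i 1)"
| "letter_op (CovL i) = cov_op (axis i 1)"

definition tensor_op :: "'n tensor \<Rightarrow> 'n nf_op" where
  "tensor_op p = op.lext (\<lambda>u. prod_list (map letter_op (letters u))) p"

lemma tensor_op_simps:
  "tensor_op (p + q) = tensor_op p + tensor_op q" "tensor_op (psc a p) = osc a (tensor_op p)"
  "tensor_op (p * q) = tensor_op p * tensor_op q" "tensor_op 1 = 1" "tensor_op 0 = 0"
  "tensor_op (letter_T l) = letter_op l"
proof -
  show "tensor_op (p * q) = tensor_op p * tensor_op q"
    unfolding tensor_op_def by (rule op.lext_mult) (simp add: plus_free_word_def)
  show "tensor_op 1 = 1"
  proof -
    have "tensor_op 1 = op.lext (\<lambda>u. prod_list (map letter_op (letters u))) (sgl 0 1)"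
      by (simp add: tensor_op_def)
    also have "\<dots> = 1" by (subst op.lext_single) (simp add: zero_free_word_def)
    finally show ?thesis .
  qed
qed (simp_all add: tensor_op_def op.lext_add op.lext_psc letter_T_def)

lemma tensor_op_minus: "tensor_op (p - q) = tensor_op p - tensor_op q"
  by (metis tensor_op_simps(1) add_diff_cancel diff_add_cancel)

lemma tensor_op_sum: "tensor_op (sum f I) = (\<Sum>i\<in>I. tensor_op (f i))"
  by (induction I rule: infinite_finite_induct) (simp_all add: tensor_op_simps)

lemma tensor_op_vec_T: "tensor_op (vec_T v) = dunkl v"
  by (subst dunkl_expand) (simp add: vec_T_def const_T_mult tensor_op_sum tensor_op_simps)

lemma tensor_op_cov_T: "tensor_op (cov_T \<xi>) = cov_op \<xi>" for \<xi> :: "complex ^ 'n"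
  by (subst cov_op_expand) (simp add: cov_T_def const_T_mult tensor_op_sum tensor_op_simps)

lemma grp_op_tensor_op:
  assumes w: "w \<in> W"
  shows "grp_op w * tensor_op p = tensor_op (tensor_act w p) * grp_op w"
proof (induction p rule: tensor_induct)
  case (letter l p)
  have "grp_op w * letter_op l = tensor_op (letter_act w l) * grp_op w"
    by (cases l) (simp_all add: tensor_op_vec_T tensor_op_cov_T grp_op_cov_op grp_op_dunkl[OF w])
  then have "grp_op w * (letter_op l * A) = tensor_op (letter_act w l) * (grp_op w * A)" for A
    by (simp flip: mult.assoc)
  then show ?case using letter by (simp add: tensor_op_simps tensor_act_mult tensor_act_letter mult.assoc)
qed (simp_all add: tensor_act_add tensor_act_psc tensor_op_simps distrib_left distrib_right
    op.scale_mult_left op.scale_mult_right)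

text \<open>The action of the smash product on normal forms. It factors through the Cherednik algebra because the
  operators satisfy the defining relations (\<open>\<rho>_vanishes_on_I\<close>).\<close>

definition \<rho> :: "'n smash_elt \<Rightarrow> 'n nf_op" where
  "\<rho> f = (\<Sum>w\<in>W. tensor_op (f w) * grp_op w)"

lemma \<rho>_add: "\<rho> (f + g) = \<rho> f + \<rho> g" and \<rho>_minus: "\<rho> (f - g) = \<rho> f - \<rho> g" and \<rho>_zero [simp]: "\<rho> 0 = 0"
  by (simp_all add: \<rho>_def tensor_op_simps tensor_op_minus distrib_right left_diff_distrib sum.distrib sum_subtractf)

lemma \<rho>_sum: "\<rho> (sum f I) = (\<Sum>i\<in>I. \<rho> (f i))"
  by (induction I rule: infinite_finite_induct) (simp_all add: \<rho>_add del: plus_fun_apply zero_fun_apply)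

lemma \<rho>_mult: "\<rho> (f \<star> g) = \<rho> f * \<rho> g"
proof -
  let ?h = "\<lambda>z. tensor_op (f (fst z) * tensor_act (fst z) (g (snd z))) * grp_op (fst z ** snd z)"
  have "\<rho> (f \<star> g) = (\<Sum>w\<in>W. \<Sum>z | z \<in> W \<times> W \<and> (fst z ** snd z) = w. ?h z)"
    unfolding \<rho>_def
  proof (rule sum.cong[OF refl])
    fix w assume "w \<in> W"
    have "{(u, v) \<in> W \<times> W. u ** v = w} = {z. z \<in> W \<times> W \<and> (fst z ** snd z) = w}" by auto
    then have "tensor_op ((f \<star> g) w) * grp_op w
        = (\<Sum>z | z \<in> W \<times> W \<and> (fst z ** snd z) = w. tensor_op (f (fst z) * tensor_act (fst z) (g (snd z))) * grp_op w)"
      by (simp add: smash_mult_raw tensor_op_sum sum_distrib_right case_prod_beta)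
    also have "\<dots> = (\<Sum>z | z \<in> W \<times> W \<and> (fst z ** snd z) = w. ?h z)"
      by (rule sum.cong) auto
    finally show "tensor_op ((f \<star> g) w) * grp_op w = (\<Sum>z | z \<in> W \<times> W \<and> (fst z ** snd z) = w. ?h z)" .
  qed
  also have "\<dots> = (\<Sum>z\<in>W \<times> W. ?h z)"
    by (rule sum.group) (use finite_W W_mult in auto)
  also have "\<dots> = (\<Sum>z\<in>W \<times> W. tensor_op (f (fst z)) * grp_op (fst z) * (tensor_op (g (snd z)) * grp_op (snd z)))"
  proof (rule sum.cong[OF refl])
    fix z assume "z \<in> W \<times> W"
    then have u: "fst z \<in> W" and v: "snd z \<in> W" by auto
    have "grp_op (fst z) * (tensor_op (g (snd z)) * A) = tensor_op (tensor_act (fst z) (g (snd z))) * (grp_op (fst z) * A)" for A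
      using grp_op_tensor_op[OF u, of "g (snd z)"] by (simp flip: mult.assoc)
    then show "?h z = tensor_op (f (fst z)) * grp_op (fst z) * (tensor_op (g (snd z)) * grp_op (snd z))"
      using grp_op_mult[OF W_invertible[OF u] W_invertible[OF v]] by (simp add: tensor_op_simps mult.assoc)
  qed
  also have "\<dots> = \<rho> f * \<rho> g"
    by (simp add: \<rho>_def sum_product sum.cartesian_product case_prod_beta)
  finally show ?thesis .
qed

lemma \<rho>_term: "w \<in> W \<Longrightarrow> \<rho> (smash_term p w) = tensor_op p * grp_op w"
proof -
  assume w: "w \<in> W"
  have "\<rho> (smash_term p w) = (\<Sum>u\<in>W. if u = w then tensor_op p * grp_op w else 0)"
    unfolding \<rho>_def by (rule sum.cong) (auto simp: smash_term_def tensor_op_simps)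
  then show ?thesis using w finite_W by simp
qed

lemma \<rho>_gens [simp]:
  "\<rho> (const_A a) = osc a 1" "\<rho> (vec_A v) = dunkl v" "\<rho> (cov_A \<xi>) = cov_op \<xi>" "w \<in> W \<Longrightarrow> \<rho> (grp_A w) = grp_op w"
  "\<rho> \<one>\<^bsub>S\<^esub> = 1"
  by (simp_all add: const_A_def vec_A_def cov_A_def grp_A_def smash_one \<rho>_term W_one grp_op_one
      tensor_op_vec_T tensor_op_cov_T tensor_op_simps const_T_psc)

lemma cherednik_rhs_closed: "cherednik_rhs W t c \<alpha> \<alpha>v v \<xi> \<in> carrier S"
  and cherednik_rhs_eq: "cherednik_rhs W t c \<alpha> \<alpha>v v \<xi>
    = const_A (t * pairing \<xi> v) - (\<Sum>s\<in>R. const_A (refl_coef s \<xi> v) \<star> grp_A s)"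
proof -
  let ?f = "\<lambda>s. const_A (refl_coef s \<xi> v) \<star> grp_A s"
  have f: "finsum S ?f R = sum ?f R \<and> sum ?f R \<in> carrier S"
    by (rule smash_finsum) (simp_all add: smash_mult_closed)
  have "cherednik_rhs W t c \<alpha> \<alpha>v v \<xi> = const_A (t * pairing \<xi> v) \<ominus>\<^bsub>S\<^esub> finsum S ?f R"
    by (simp add: cherednik_rhs_def refl_coef_def root_pairing_def)
  then show "cherednik_rhs W t c \<alpha> \<alpha>v v \<xi> = const_A (t * pairing \<xi> v) - sum ?f R"
    using f by (simp add: smash_minus)
  then show "cherednik_rhs W t c \<alpha> \<alpha>v v \<xi> \<in> carrier S"
    using f by (simp add: smash_carrier_closed)
qed

lemma \<rho>_rhs: "\<rho> (cherednik_rhs W t c \<alpha> \<alpha>v v \<xi>) = yx_op \<xi> v"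
proof -
  have "(\<Sum>s\<in>R. \<rho> (const_A (refl_coef s \<xi> v) \<star> grp_A s)) = (\<Sum>s\<in>R. osc (refl_coef s \<xi> v) (grp_op s))"
    by (rule sum.cong) (use R_subset in \<open>auto simp: \<rho>_mult op.scale_mult_left\<close>)
  then show ?thesis by (simp add: cherednik_rhs_eq \<rho>_minus \<rho>_sum yx_op_def)
qed

lemma commutator_eq: "f \<in> carrier S \<Longrightarrow> g \<in> carrier S \<Longrightarrow> commutator S f g = f \<star> g - g \<star> f"
  by (simp add: commutator_def smash_minus smash_mult_closed)

abbreviation I where "I \<equiv> cherednik_ideal W t c \<alpha> \<alpha>v"

lemma relations_closed: "cherednik_relations W t c \<alpha> \<alpha>v \<subseteq> carrier S"
  unfolding cherednik_relations_def commutator_def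
  by (auto intro!: S.minus_closed smash_mult_closed cherednik_rhs_closed)

lemma I_ideal: "ideal I S"
  unfolding cherednik_ideal_def by (rule S.genideal_ideal) (rule relations_closed)

lemma relation_in_I:
  "cov_A \<xi> \<star> cov_A \<xi>' - cov_A \<xi>' \<star> cov_A \<xi> \<in> I"
  "vec_A v \<star> vec_A v' - vec_A v' \<star> vec_A v \<in> I"
  "vec_A v \<star> cov_A \<xi> - cov_A \<xi> \<star> vec_A v - cherednik_rhs W t c \<alpha> \<alpha>v v \<xi> \<in> I"
proof -
  have sub: "cherednik_relations W t c \<alpha> \<alpha>v \<subseteq> I"
    unfolding cherednik_ideal_def by (rule S.genideal_self) (rule relations_closed)
  have 1: "commutator S (cov_A \<xi>) (cov_A \<xi>') \<in> I" "commutator S (vec_A v) (vec_A v') \<in> I"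
    "commutator S (vec_A v) (cov_A \<xi>) \<ominus>\<^bsub>S\<^esub> cherednik_rhs W t c \<alpha> \<alpha>v v \<xi> \<in> I"
    by (rule subsetD[OF sub]; unfold cherednik_relations_def; blast)+
  then show "cov_A \<xi> \<star> cov_A \<xi>' - cov_A \<xi>' \<star> cov_A \<xi> \<in> I"
    "vec_A v \<star> vec_A v' - vec_A v' \<star> vec_A v \<in> I"
    "vec_A v \<star> cov_A \<xi> - cov_A \<xi> \<star> vec_A v - cherednik_rhs W t c \<alpha> \<alpha>v v \<xi> \<in> I"
    by (simp_all add: commutator_eq smash_minus cherednik_rhs_closed)
qed

lemma \<rho>_vanishes_on_I: "f \<in> I \<Longrightarrow> \<rho> f = 0"
proof -
  let ?K = "{f \<in> carrier S. \<rho> f = 0}"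
  have "ideal ?K S"
  proof (rule idealI)
    show "ring S" by (rule smash_ring)
    have "\<rho> (- f) = - \<rho> f" for f using \<rho>_minus[of 0 f] by (simp del: zero_fun_apply)
    then show "subgroup ?K (add_monoid S)"
      by (intro S.add.subgroupI)
        (auto simp: smash_uminus smash_simps(3) \<rho>_add smash_carrier_closed simp flip: a_inv_def
          simp del: plus_fun_apply zero_fun_apply intro: exI[of _ 0])
  qed (auto simp: \<rho>_mult smash_mult_closed)
  moreover have "cherednik_relations W t c \<alpha> \<alpha>v \<subseteq> ?K"
    using relations_closed
    by (auto simp: cherednik_relations_def commutator_eq smash_minus smash_mult_closed
        smash_carrier_closed cherednik_rhs_closed \<rho>_minus \<rho>_mult \<rho>_rhs cov_op_commute dunkl_commute dunkl_cov_op intro: cov_op_commute dunkl_commute)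
  ultimately have "I \<subseteq> ?K"
    unfolding cherednik_ideal_def by (rule S.genideal_minimal)
  then show "f \<in> I \<Longrightarrow> \<rho> f = 0" by blast
qed

end

section \<open>The action is faithful\<close>

lemma xfree_basis_induct [consumes 1, case_names single add]:
  assumes "xfree n" and "\<And>k a. P (sgl ({#}, k) a)"
    and "\<And>m n. xfree m \<Longrightarrow> xfree n \<Longrightarrow> P m \<Longrightarrow> P n \<Longrightarrow> P (m + n)"
  shows "P n"
proof -
  have "xfree (\<Sum>k\<in>A. sgl k (coef n k)) \<and> P (\<Sum>k\<in>A. sgl k (coef n k))"
    if "finite A" "A \<subseteq> Poly_Mapping.keys n" for A
    using that
  proof (induction A rule: finite_induct)
    case empty
    then show ?case using assms(2)[of undefined 0] by (simp add: xfree_def)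
  next
    case (insert k A)
    have "fst k = {#}" using assms(1) insert.prems by (simp add: xfree_def)
    then obtain k' where "k = ({#}, k')" by (cases k) simp
    then show ?case using insert by (simp add: xfree_add xfree_single assms(2,3))
  qed
  from this[OF finite_keys order_refl] show ?thesis
    by (simp flip: poly_mapping_sum_single)
qed

lemma xfree_induct [consumes 1, case_names g y add]:
  assumes "xfree n"
    and "\<And>G a. P (sgl ({#}, {#}, G) a)" "\<And>i n. xfree n \<Longrightarrow> P n \<Longrightarrow> P (yN i * n)"
    and "\<And>m n. xfree m \<Longrightarrow> xfree n \<Longrightarrow> P m \<Longrightarrow> P n \<Longrightarrow> P (m + n)"
  shows "P n"
  using assms(1)
proof (induction n rule: xfree_basis_induct)
  case (single k a)
  obtain \<nu> G where k: "k = (\<nu>, G)" by (cases k)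
  show ?case unfolding k
    by (induction \<nu>) (auto simp: sgl_add_mset(2) intro: assms(2,3) xfree_single)
qed (rule assms(4))

text \<open>Scalar multiples of elements of the smash product, regarded as functions.\<close>

definition ssc :: "complex \<Rightarrow> 'n smash_elt \<Rightarrow> 'n smash_elt" where
  "ssc a f = (\<lambda>w. psc a (f w))"

interpretation ssc: complex_scaling "ssc :: complex \<Rightarrow> 'n :: finite smash_elt \<Rightarrow> _"
  by unfold_locales
    (rule ext; simp add: ssc_def psc_add_right pm.scale_left_distrib)+

context reflection_algebra
begin

text \<open>Equality in the Cherednik algebra. Representatives are compared instead of cosets because they carry
  the pointwise addition of functions.\<close>

definition cong_I :: "'n smash_elt \<Rightarrow> 'n smash_elt \<Rightarrow> bool" (infix \<open>\<doteq>\<close> 50) where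
  "f \<doteq> g \<longleftrightarrow> f - g \<in> I"

lemma I_add: "f \<in> I \<Longrightarrow> g \<in> I \<Longrightarrow> f + g \<in> I"
  and I_zero: "0 \<in> I"
  and I_uminus: "f \<in> I \<Longrightarrow> - f \<in> I"
  and I_carrier: "f \<in> I \<Longrightarrow> f \<in> carrier S"
  and I_lmult: "f \<in> I \<Longrightarrow> g \<in> carrier S \<Longrightarrow> g \<star> f \<in> I"
  and I_rmult: "f \<in> I \<Longrightarrow> g \<in> carrier S \<Longrightarrow> f \<star> g \<in> I"
proof -
  interpret ideal I S by (rule I_ideal)
  show "f \<in> I \<Longrightarrow> g \<in> I \<Longrightarrow> f + g \<in> I" using a_closed smash_simps(3) by metis
  show "0 \<in> I" using zero_closed smash_simps(2) by metis
  show "f \<in> I \<Longrightarrow> f \<in> carrier S" by (rule a_Hcarr)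
  then show "f \<in> I \<Longrightarrow> - f \<in> I" using a_inv_closed smash_uminus by metis
  show "f \<in> I \<Longrightarrow> g \<in> carrier S \<Longrightarrow> g \<star> f \<in> I" by (rule I_l_closed)
  show "f \<in> I \<Longrightarrow> g \<in> carrier S \<Longrightarrow> f \<star> g \<in> I" by (rule I_r_closed)
qed

lemma cong_I_refl [simp]: "f \<doteq> f"
  by (simp add: cong_I_def I_zero del: zero_fun_apply)

lemma cong_I_trans [trans]: "f \<doteq> g \<Longrightarrow> g \<doteq> h \<Longrightarrow> f \<doteq> h"
proof -
  assume "f \<doteq> g" "g \<doteq> h"
  then have "(f - g) + (g - h) \<in> I" unfolding cong_I_def by (rule I_add)
  moreover have "(f - g) + (g - h) = f - h" by (rule ext) simp
  ultimately show ?thesis by (simp only: cong_I_def)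
qed

lemma cong_I_eq_trans [trans]: "f = g \<Longrightarrow> g \<doteq> h \<Longrightarrow> f \<doteq> h" "f \<doteq> g \<Longrightarrow> g = h \<Longrightarrow> f \<doteq> h"
  by simp_all

lemma cong_I_sym: "f \<doteq> g \<Longrightarrow> g \<doteq> f"
  unfolding cong_I_def using I_uminus[of "f - g"] by (simp only: minus_diff_eq)

lemma cong_I_add: "f \<doteq> g \<Longrightarrow> f' \<doteq> g' \<Longrightarrow> f + f' \<doteq> g + g'"
  unfolding cong_I_def by (simp only: add_diff_add I_add)

lemma cong_I_diff: "f \<doteq> g \<Longrightarrow> f' \<doteq> g' \<Longrightarrow> f - f' \<doteq> g - g'"
proof -
  assume "f \<doteq> g" "f' \<doteq> g'"
  then have "(f - g) + - (f' - g') \<in> I" unfolding cong_I_def by (intro I_add I_uminus)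
  moreover have "(f - g) + - (f' - g') = f - f' - (g - g')" by (rule ext) simp
  ultimately show ?thesis by (simp only: cong_I_def)
qed

lemma cong_I_sum: "(\<And>i. i \<in> A \<Longrightarrow> f i \<doteq> g i) \<Longrightarrow> sum f A \<doteq> sum g A"
  by (induction A rule: infinite_finite_induct)
    (simp_all add: cong_I_add del: plus_fun_apply zero_fun_apply)

lemma smash_diff_mult:
  "(f - g) \<star> h = f \<star> h - g \<star> h" "f \<star> (g - h) = f \<star> g - f \<star> h"
proof -
  have "f \<star> h = (f - g) \<star> h + g \<star> h"
    by (simp only: smash_add_mult(1)[symmetric] diff_add_cancel)
  then show "(f - g) \<star> h = f \<star> h - g \<star> h"
    by (simp only: add_diff_cancel_right')
  have "f \<star> g = f \<star> (g - h) + f \<star> h"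
    by (simp only: smash_add_mult(2)[symmetric] diff_add_cancel)
  then show "f \<star> (g - h) = f \<star> g - f \<star> h"
    by (simp only: add_diff_cancel_right')
qed

lemma smash_sum_mult:
  "sum f A \<star> h = (\<Sum>i\<in>A. f i \<star> h)" "h \<star> sum f A = (\<Sum>i\<in>A. h \<star> f i)"
  by (induction A rule: infinite_finite_induct)
    (simp_all add: smash_add_mult del: plus_fun_apply zero_fun_apply)

lemma cong_I_lmult: "f \<doteq> g \<Longrightarrow> h \<in> carrier S \<Longrightarrow> h \<star> f \<doteq> h \<star> g"
  unfolding cong_I_def by (simp only: I_lmult smash_diff_mult[symmetric])

lemma cong_I_rmult: "f \<doteq> g \<Longrightarrow> h \<in> carrier S \<Longrightarrow> f \<star> h \<doteq> g \<star> h"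
  unfolding cong_I_def by (simp only: I_rmult smash_diff_mult[symmetric])

lemma ssc_mult: "ssc a f \<star> g = ssc a (f \<star> g)" "f \<star> ssc a g = ssc a (f \<star> g)"
  by (rule ext; simp add: smash_mult_raw ssc_def case_prod_beta pma.scale_mult_left pma.scale_mult_right
      tensor_act_psc pm.scale_sum_right)+

lemma ssc_carrier: "f \<in> carrier S \<Longrightarrow> ssc a f \<in> carrier S"
  by (auto simp: smash_simps ssc_def)

lemma const_A_mult: "f \<in> carrier S \<Longrightarrow> const_A a \<star> f = ssc a f"
proof -
  assume f: "f \<in> carrier S"
  have "const_A a = ssc a \<one>\<^bsub>S\<^esub>"
    by (rule ext) (simp add: const_A_def ssc_def smash_one smash_term_def const_T_psc)
  then show ?thesis using f by (simp add: ssc_mult)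
qed

lemma cong_I_ssc: "f \<doteq> g \<Longrightarrow> ssc a f \<doteq> ssc a g"
  unfolding cong_I_def using I_carrier[of "f - g"] I_lmult[of "f - g" "const_A a"] const_A_mult[of "f - g" a]
  by (simp only: ssc.scale_right_diff_distrib smash_gens_in(1))

definition some_list :: "'a multiset \<Rightarrow> 'a list" where "some_list M = (SOME l. mset l = M)"

lemma mset_some_list: "mset (some_list M) = M"
  unfolding some_list_def by (rule someI_ex) (rule ex_mset)

definition lprod :: "('n \<Rightarrow> 'n smash_elt) \<Rightarrow> 'n list \<Rightarrow> 'n smash_elt \<Rightarrow> 'n smash_elt" where
  "lprod C l f = foldr (\<lambda>i g. C i \<star> g) l f"

lemma lprod_simps [simp]: "lprod C [] f = f" "lprod C (i # l) f = C i \<star> lprod C l f"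
  by (simp_all add: lprod_def)

lemma lprod_closed: "f \<in> carrier S \<Longrightarrow> lprod C l f \<in> carrier S"
  by (cases l) (simp_all add: smash_mult_closed)

text \<open>It suffices to move one factor to the front, past factors with which it commutes modulo the ideal.\<close>

lemma lprod_perm:
  assumes C: "\<And>i. C i \<in> carrier S" and comm: "\<And>i j. C i \<star> C j \<doteq> C j \<star> C i"
    and f: "f \<in> carrier S" and l: "mset l = mset l'"
  shows "lprod C l f \<doteq> lprod C l' f"
  using l
proof (induction l arbitrary: l')
  case (Cons i l)
  have move: "C i \<star> lprod C (p @ q) f \<doteq> lprod C (p @ i # q) f" for p q
  proof (induction p)
    case (Cons j p)
    have "C i \<star> lprod C ((j # p) @ q) f = (C i \<star> C j) \<star> lprod C (p @ q) f"
      by (simp add: smash_assoc)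
    also have "\<dots> \<doteq> (C j \<star> C i) \<star> lprod C (p @ q) f"
      by (rule cong_I_rmult[OF comm lprod_closed[OF f]])
    also have "(C j \<star> C i) \<star> lprod C (p @ q) f = C j \<star> (C i \<star> lprod C (p @ q) f)"
      by (rule smash_assoc)
    also have "\<dots> \<doteq> C j \<star> lprod C (p @ i # q) f"
      by (rule cong_I_lmult[OF Cons C])
    finally show ?case by simp
  qed simp
  have "i \<in> set l'" using Cons.prems by (metis list.set_intros(1) mset_eq_setD)
  then obtain p q where l': "l' = p @ i # q" by (meson split_list)
  have "mset l = mset (p @ q)" using Cons.prems l' by simp
  then have "C i \<star> lprod C l f \<doteq> C i \<star> lprod C (p @ q) f"
    by (intro cong_I_lmult C Cons.IH)
  also have "\<dots> \<doteq> lprod C l' f" unfolding l' by (rule move)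
  finally show ?case by simp
qed simp

abbreviation "CA i \<equiv> cov_A (axis i 1)"
abbreviation "VA i \<equiv> vec_A (axis i 1)"

text \<open>Multisets that are not a single element of \<open>W\<close> do not come from \<open>H\<close>. They are sent to \<open>0\<close>, which is
  compatible with the action of \<open>W\<close>, so that \<open>\<psi>\<close> below is defined on all normal forms.\<close>

definition grp_mset :: "(complex ^ 'n ^ 'n) multiset \<Rightarrow> 'n smash_elt" where
  "grp_mset G = (if \<exists>u\<in>W. G = {#u#} then grp_A (THE u. G = {#u#}) else 0)"

lemma grp_mset_single: "u \<in> W \<Longrightarrow> grp_mset {#u#} = grp_A u"
  by (simp add: grp_mset_def)

lemma grp_mset_closed: "grp_mset G \<in> carrier S"
  by (auto simp: grp_mset_def smash_carrier_closed)

fun monomial :: "'n nf_key \<Rightarrow> 'n smash_elt" where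
  "monomial (\<mu>, \<nu>, G) = lprod CA (some_list \<mu>) (lprod VA (some_list \<nu>) (grp_mset G))"

lemma monomial_closed: "monomial k \<in> carrier S"
  by (cases k) (simp add: lprod_closed grp_mset_closed)

text \<open>Multiplying out a normal form in the smash product. Up to the ideal this is a homomorphism of modules
  (\<open>\<psi>_linear\<close>), and it sends the unit to the unit; so it inverts \<open>f \<mapsto> f \<cdot> 1\<close>.\<close>

definition \<psi> :: "'n nf \<Rightarrow> 'n smash_elt" where "\<psi> n = ssc.lext monomial n"

lemma \<psi>_add: "\<psi> (m + n) = \<psi> m + \<psi> n" and \<psi>_psc: "\<psi> (psc a n) = ssc a (\<psi> n)"
  and \<psi>_single: "\<psi> (sgl k a) = ssc a (monomial k)" and \<psi>_zero [simp]: "\<psi> 0 = 0"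
  by (simp_all add: \<psi>_def ssc.lext_add ssc.lext_psc del: plus_fun_apply zero_fun_apply)

lemma \<psi>_minus: "\<psi> (m - n) = \<psi> m - \<psi> n"
proof -
  have "\<psi> m = \<psi> (m - n) + \<psi> n" by (simp only: \<psi>_add[symmetric] diff_add_cancel)
  then show ?thesis by (simp only: add_diff_cancel_right')
qed

lemma \<psi>_sum: "\<psi> (sum f A) = (\<Sum>i\<in>A. \<psi> (f i))"
  by (induction A rule: infinite_finite_induct) (simp_all add: \<psi>_add del: plus_fun_apply zero_fun_apply)

lemma \<psi>_closed: "\<psi> n \<in> carrier S"
  by (induction n rule: pm_induct)
    (simp_all only: \<psi>_add \<psi>_single smash_carrier_closed ssc_carrier monomial_closed)

lemma cov_comm: "CA i \<star> CA j \<doteq> CA j \<star> CA i"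
  and vec_comm: "VA i \<star> VA j \<doteq> VA j \<star> VA i"
  unfolding cong_I_def by (rule relation_in_I)+

lemma \<psi>_x: "\<psi> (xN i * n) \<doteq> CA i \<star> \<psi> n"
proof (induction n rule: pm_induct)
  case (single k a)
  obtain \<mu> \<nu> G where k: "k = (\<mu>, \<nu>, G)" by (cases k)
  have "lprod CA (some_list (add_mset i \<mu>)) f \<doteq> lprod CA (i # some_list \<mu>) f" if "f \<in> carrier S" for f
    by (rule lprod_perm) (use that cov_comm in \<open>auto simp: mset_some_list\<close>)
  then have "monomial (add_mset i \<mu>, \<nu>, G) \<doteq> CA i \<star> monomial (\<mu>, \<nu>, G)"
    using lprod_closed grp_mset_closed by simp
  then show ?case
    unfolding k sgl_add_mset[symmetric] \<psi>_single ssc_mult by (rule cong_I_ssc)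
qed (simp add: distrib_left \<psi>_add smash_add_mult cong_I_add del: plus_fun_apply)

lemma \<psi>_cov: "\<psi> (covN \<xi> * n) \<doteq> cov_A \<xi> \<star> \<psi> n"
proof -
  have "cov_A \<xi> = (\<Sum>i\<in>UNIV. ssc (\<xi> $ i) (CA i))"
  proof
    fix w
    have "(\<Sum>i\<in>A. ssc (\<xi> $ i) (CA i)) w = (\<Sum>i\<in>A. ssc (\<xi> $ i) (CA i) w)" for A
      by (induction A rule: infinite_finite_induct) simp_all
    then show "cov_A \<xi> w = (\<Sum>i\<in>UNIV. ssc (\<xi> $ i) (CA i)) w"
      by (simp add: cov_A_def smash_term_def ssc_def cov_T_def[of \<xi>] const_T_mult cov_T_simps(3))
  qed
  then show ?thesis
    by (simp add: covN_def sum_distrib_right \<psi>_sum \<psi>_psc pma.scale_mult_left smash_sum_mult ssc_mult)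
      (intro cong_I_sum cong_I_ssc \<psi>_x)
qed

lemma \<psi>_y:
  assumes "xfree n"
  shows "\<psi> (yN i * n) \<doteq> VA i \<star> \<psi> n"
proof -
  have one: "\<psi> (yN i * sgl ({#}, \<nu>, G) a) \<doteq> VA i \<star> \<psi> (sgl ({#}, \<nu>, G) a)" for \<nu> G a
  proof -
    have "lprod VA (some_list (add_mset i \<nu>)) (grp_mset G) \<doteq> lprod VA (i # some_list \<nu>) (grp_mset G)"
      by (rule lprod_perm) (use vec_comm grp_mset_closed in \<open>auto simp: mset_some_list\<close>)
    moreover have "some_list {#} = ([] :: 'n list)" using mset_some_list[of "{#} :: 'n multiset"] by simp
    ultimately have "monomial ({#}, add_mset i \<nu>, G) \<doteq> VA i \<star> monomial ({#}, \<nu>, G)" by simp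
    then show ?thesis
      unfolding sgl_add_mset[symmetric] \<psi>_single ssc_mult by (rule cong_I_ssc)
  qed
  show ?thesis
    using assms
  proof (induction n rule: xfree_basis_induct)
    case (single k a)
    then show ?case using one by (cases k) simp
  qed (simp add: distrib_left \<psi>_add smash_add_mult cong_I_add del: plus_fun_apply)
qed

lemma \<psi>_vec:
  assumes "xfree n"
  shows "\<psi> (vecN v * n) \<doteq> vec_A v \<star> \<psi> n"
proof -
  have "vec_A v = (\<Sum>i\<in>UNIV. ssc (v $ i) (VA i))"
  proof
    fix w
    have "(\<Sum>i\<in>A. ssc (v $ i) (VA i)) w = (\<Sum>i\<in>A. ssc (v $ i) (VA i) w)" for A
      by (induction A rule: infinite_finite_induct) simp_all
    then show "vec_A v w = (\<Sum>i\<in>UNIV. ssc (v $ i) (VA i)) w"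
      by (simp add: vec_A_def smash_term_def ssc_def vec_T_def[of v] const_T_mult vec_T_simps(3))
  qed
  then show ?thesis
    by (simp add: vecN_def sum_distrib_right \<psi>_sum \<psi>_psc pma.scale_mult_left smash_sum_mult ssc_mult)
      (intro cong_I_sum cong_I_ssc \<psi>_y assms)
qed

lemma grp_A_mult: "u \<in> W \<Longrightarrow> w \<in> W \<Longrightarrow> grp_A u \<star> grp_A w = grp_A (u ** w)"
  by (simp add: grp_A_def smash_term_mult)

lemma grp_A_cov: "w \<in> W \<Longrightarrow> grp_A w \<star> cov_A \<xi> = cov_A (dual_act w \<xi>) \<star> grp_A w"
  and grp_A_vec: "w \<in> W \<Longrightarrow> grp_A w \<star> vec_A v = vec_A (w *v v) \<star> grp_A w"
  by (simp_all add: grp_A_def cov_A_def vec_A_def smash_term_mult W_one tensor_act_cov_T tensor_act_vec_T)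

lemma \<psi>_grp_mset:
  assumes w: "w \<in> W"
  shows "\<psi> (ap (grp_op w) (sgl ({#}, {#}, G) a)) = grp_A w \<star> \<psi> (sgl ({#}, {#}, G) a)"
proof -
  have some_list: "some_list {#} = ([] :: 'n list)" using mset_some_list[of "{#} :: 'n multiset"] by simp
  have "(\<Prod>u\<in>#G. gN (w ** u)) = sgl ({#}, {#}, image_mset ((**) w) G) 1"
    by (induction G) (simp_all add: sgl_one sgl_add_mset(3))
  then have "ap (grp_op w) (sgl ({#}, {#}, G) a) = sgl ({#}, {#}, image_mset ((**) w) G) a"
    by (simp add: ap_grp_op)
  moreover have "grp_mset (image_mset ((**) w) G) = grp_A w \<star> grp_mset G"
  proof (cases "\<exists>u\<in>W. G = {#u#}")
    case True
    then show ?thesis using w by (auto simp: grp_mset_single W_mult grp_A_mult)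
  next
    case False
    have "\<not> (\<exists>u\<in>W. image_mset ((**) w) G = {#u#})"
    proof
      assume "\<exists>u\<in>W. image_mset ((**) w) G = {#u#}"
      then obtain u where u: "u \<in> W" "image_mset ((**) w) G = {#u#}" by blast
      then have "size G = 1" by (metis size_image_mset size_single)
      then obtain v where v: "G = {#v#}" by (metis size_1_singleton_mset)
      then have "u = w ** v" using u(2) by simp
      then have "v = matrix_inv w ** u" using w by (simp add: matrix_mul_assoc W_inv_cancel)
      then have "v \<in> W" using u w by (simp add: W_mult W_inv)
      then show False using False v by blast
    qed
    then have "grp_mset (image_mset ((**) w) G) = 0" "grp_mset G = 0"
      using False unfolding grp_mset_def by (simp_all only: if_False)
    then show ?thesis by (simp only: smash_zero_mult)
  qed
  ultimately show ?thesis by (simp add: \<psi>_single ssc_mult some_list del: zero_fun_apply)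
qed

text \<open>By induction on the letters \<open>x\<close> and \<open>y\<close>: moving \<open>w\<close> past a letter changes the letter in the same way on
  both sides.\<close>

lemma \<psi>_grp_op:
  assumes w: "w \<in> W"
  shows "\<psi> (ap (grp_op w) n) \<doteq> grp_A w \<star> \<psi> n"
proof (induction n rule: nf_x_induct)
  case (xfree n)
  then show ?case
  proof (induction n rule: xfree_induct)
    case (g G a)
    show ?case by (simp only: \<psi>_grp_mset[OF w] cong_I_refl)
  next
    case (y i n)
    have "\<psi> (ap (grp_op w) (yN i * n)) = \<psi> (vecN (w *v axis i 1) * ap (grp_op w) n)"
      by (simp add: grp_op_mult_nf)
    also have "\<dots> \<doteq> vec_A (w *v axis i 1) \<star> \<psi> (ap (grp_op w) n)"
      by (rule \<psi>_vec[OF xfree_grp_op[OF y(1)]])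
    also have "\<dots> \<doteq> vec_A (w *v axis i 1) \<star> (grp_A w \<star> \<psi> n)"
      by (rule cong_I_lmult[OF y(2)]) simp
    also have "\<dots> = grp_A w \<star> (VA i \<star> \<psi> n)"
      by (simp only: smash_assoc[symmetric] grp_A_vec[OF w])
    also have "\<dots> \<doteq> grp_A w \<star> \<psi> (yN i * n)"
      by (rule cong_I_lmult[OF cong_I_sym[OF \<psi>_y[OF y(1)]]]) (simp add: w)
    finally show ?case .
  qed (simp add: ap_add \<psi>_add smash_add_mult cong_I_add del: plus_fun_apply)
next
  case (x i n)
  have "\<psi> (ap (grp_op w) (xN i * n)) = \<psi> (covN (dual_act w (axis i 1)) * ap (grp_op w) n)"
    by (simp add: grp_op_mult_nf)
  also have "\<dots> \<doteq> cov_A (dual_act w (axis i 1)) \<star> \<psi> (ap (grp_op w) n)"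
    by (rule \<psi>_cov)
  also have "\<dots> \<doteq> cov_A (dual_act w (axis i 1)) \<star> (grp_A w \<star> \<psi> n)"
    by (rule cong_I_lmult[OF x]) simp
  also have "\<dots> = grp_A w \<star> (CA i \<star> \<psi> n)"
    by (simp only: smash_assoc[symmetric] grp_A_cov[OF w])
  also have "\<dots> \<doteq> grp_A w \<star> \<psi> (xN i * n)"
    by (rule cong_I_lmult[OF cong_I_sym[OF \<psi>_x]]) (simp add: w)
  finally show ?case .
qed (simp add: ap_add \<psi>_add smash_add_mult cong_I_add del: plus_fun_apply)

lemma \<psi>_yx: "\<psi> (ap (yx_op \<xi> v) n) \<doteq> cherednik_rhs W t c \<alpha> \<alpha>v v \<xi> \<star> \<psi> n"
proof -
  have "\<psi> (ap (yx_op \<xi> v) n)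
      = ssc (t * pairing \<xi> v) (\<psi> n) - (\<Sum>s\<in>R. ssc (refl_coef s \<xi> v) (\<psi> (ap (grp_op s) n)))"
    by (simp only: ap_yx_op \<psi>_minus \<psi>_sum \<psi>_psc)
  also have "\<dots> \<doteq> ssc (t * pairing \<xi> v) (\<psi> n) - (\<Sum>s\<in>R. ssc (refl_coef s \<xi> v) (grp_A s \<star> \<psi> n))"
    by (intro cong_I_diff cong_I_sum cong_I_ssc \<psi>_grp_op cong_I_refl) (use R_subset in blast)
  also have "\<dots> = cherednik_rhs W t c \<alpha> \<alpha>v v \<xi> \<star> \<psi> n"
    by (simp only: cherednik_rhs_eq smash_diff_mult smash_sum_mult smash_assoc const_A_mult \<psi>_closed
        smash_mult_closed)
  finally show ?thesis .
qed

text \<open>By induction on the letters \<open>x\<close>: passing a \<open>y\<close> by an \<open>x\<close> produces the same correction in the operators and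
  in the algebra.\<close>

lemma \<psi>_dunkl: "\<psi> (ap (dunkl v) n) \<doteq> vec_A v \<star> \<psi> n"
proof (induction n rule: nf_x_induct)
  case (xfree n)
  then show ?case by (simp add: dunkl_xfree \<psi>_vec)
next
  case (x i n)
  let ?r = "cherednik_rhs W t c \<alpha> \<alpha>v v (axis i 1)"
  have "\<psi> (ap (dunkl v) (xN i * n)) = \<psi> (xN i * ap (dunkl v) n) + \<psi> (ap (yx_op (axis i 1) v) n)"
    by (simp only: dunkl_x \<psi>_add)
  also have "\<dots> \<doteq> CA i \<star> \<psi> (ap (dunkl v) n) + ?r \<star> \<psi> n"
    by (intro cong_I_add \<psi>_x \<psi>_yx)
  also have "\<dots> \<doteq> CA i \<star> (vec_A v \<star> \<psi> n) + ?r \<star> \<psi> n"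
    by (intro cong_I_add cong_I_lmult x cong_I_refl) simp
  also have "\<dots> = (CA i \<star> vec_A v + ?r) \<star> \<psi> n"
    by (simp only: smash_add_mult smash_assoc)
  also have "\<dots> \<doteq> (vec_A v \<star> CA i) \<star> \<psi> n"
  proof (rule cong_I_rmult[OF cong_I_sym \<psi>_closed])
    show "vec_A v \<star> CA i \<doteq> CA i \<star> vec_A v + ?r"
      unfolding cong_I_def using relation_in_I(3)[of v "axis i 1"] by (simp only: diff_diff_eq)
  qed
  also have "\<dots> = vec_A v \<star> (CA i \<star> \<psi> n)"
    by (rule smash_assoc)
  also have "\<dots> \<doteq> vec_A v \<star> \<psi> (xN i * n)"
    by (rule cong_I_lmult[OF cong_I_sym[OF \<psi>_x]]) simp
  finally show ?case .
qed (simp add: ap_add \<psi>_add smash_add_mult cong_I_add del: plus_fun_apply)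

lemma \<psi>_linear:
  assumes f: "f \<in> carrier S"
  shows "\<psi> (ap (\<rho> f) n) \<doteq> f \<star> \<psi> n"
proof -
  let ?P = "\<lambda>f. \<forall>n. \<psi> (ap (\<rho> f) n) \<doteq> f \<star> \<psi> n"
  have trm: "?P (smash_term p w)" if w: "w \<in> W" for p w
  proof (induction p rule: tensor_induct)
    case one
    have "\<rho> (smash_term 1 w) = grp_op w" by (simp add: \<rho>_term w tensor_op_simps)
    then show ?case using \<psi>_grp_op[OF w] by (simp add: grp_A_def)
  next
    case (letter l p)
    define L where "L = smash_term (letter_T l) (mat 1)"
    have L: "?P L" "L \<in> carrier S"
      using \<psi>_dunkl \<psi>_cov by (cases l; simp add: L_def vec_T_simps(3)[symmetric] cov_T_simps(3)[symmetric]
          vec_A_def[symmetric] cov_A_def[symmetric])+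
    have e: "smash_term (letter_T l * p) w = L \<star> smash_term p w"
      by (simp add: L_def smash_term_mult w W_one tensor_act_id)
    show ?case
    proof
      fix n
      have "\<psi> (ap (\<rho> (smash_term (letter_T l * p) w)) n) = \<psi> (ap (\<rho> L) (ap (\<rho> (smash_term p w)) n))"
        by (simp add: e \<rho>_mult)
      also have "\<dots> \<doteq> L \<star> \<psi> (ap (\<rho> (smash_term p w)) n)" using L by blast
      also have "\<dots> \<doteq> L \<star> (smash_term p w \<star> \<psi> n)" using letter L cong_I_lmult by blast
      also have "\<dots> = smash_term (letter_T l * p) w \<star> \<psi> n" by (simp only: e smash_assoc)
      finally show "\<psi> (ap (\<rho> (smash_term (letter_T l * p) w)) n) \<doteq> smash_term (letter_T l * p) w \<star> \<psi> n" .
    qed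
  next
    case (psc a p)
    have e: "smash_term (psc a p) w = ssc a (smash_term p w)"
      by (rule ext) (simp add: smash_term_def ssc_def)
    have "\<rho> (ssc a f) = osc a (\<rho> f)" for f
      by (simp add: \<rho>_def ssc_def tensor_op_simps op.scale_mult_left op.scale_sum_right)
    then show ?case using psc by (simp add: e ssc_mult \<psi>_psc cong_I_ssc)
  next
    case (add p q)
    have "smash_term (p + q) w = smash_term p w + smash_term q w"
      by (rule ext) (simp add: smash_term_def)
    then show ?case using add by (simp add: \<rho>_add \<psi>_add smash_add_mult cong_I_add del: plus_fun_apply)
  qed
  have "?P (\<Sum>w\<in>A. smash_term (f w) w)" if "finite A" "A \<subseteq> W" for A
    using that by (induction A rule: finite_induct)
      (simp_all add: \<rho>_add \<psi>_add smash_add_mult cong_I_add trm del: plus_fun_apply zero_fun_apply)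
  from this[OF finite_W order_refl] show ?thesis
    unfolding smash_expand[OF f, symmetric] by blast
qed

lemma \<psi>_unit: "\<psi> (gN (mat 1)) = \<one>\<^bsub>S\<^esub>"
proof -
  have "some_list {#} = ([] :: 'n list)" using mset_some_list[of "{#} :: 'n multiset"] by simp
  then show ?thesis
    by (simp add: gN_def \<psi>_single grp_mset_single W_one grp_A_def smash_one)
qed

text \<open>Evaluate the linearity of \<open>\<psi>\<close> at the unit.\<close>

theorem normal_form:
  assumes f: "f \<in> carrier S"
  shows "f \<doteq> \<psi> (ap (\<rho> f) (gN (mat 1)))"
  using cong_I_sym[OF \<psi>_linear[OF f, of "gN (mat 1)"]] f by (simp only: \<psi>_unit smash_one_mult)

text \<open>The kernel consists of elements with normal form \<open>0\<close>, and these are congruent to \<open>0\<close>.\<close>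

theorem faithful:
  assumes f: "f \<in> carrier S"
  shows "\<rho> f = 0 \<longleftrightarrow> f \<in> I"
proof
  assume "\<rho> f = 0"
  then have "f \<doteq> 0" using normal_form[OF f] by (simp del: zero_fun_apply)
  then show "f \<in> I" by (simp only: cong_I_def diff_0_right)
qed (rule \<rho>_vanishes_on_I)

end

section \<open>Gradings of normal forms\<close>

text \<open>The number of letters \<open>y\<close> and the group part: the data with respect to which symbols are taken.\<close>

definition grade :: "'n multiset \<times> 'n multiset \<times> 'g multiset \<Rightarrow> nat \<times> 'g multiset" where
  "grade k = (size (fst (snd k)), snd (snd k))"

lemma grade_simps [simp]: "grade (\<mu>, \<nu>, G) = (size \<nu>, G)"
  by (simp add: grade_def)

lemma grade_add: "grade (k + l) = grade k + grade l"
  by (simp add: grade_def plus_prod_def)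

definition graded :: "(nat \<times> (complex ^ 'n ^ 'n) multiset) set \<Rightarrow> 'n :: finite nf \<Rightarrow> bool" where
  "graded D n \<longleftrightarrow> (\<forall>k\<in>Poly_Mapping.keys n. grade k \<in> D)"

lemma graded_mono: "graded D n \<Longrightarrow> D \<subseteq> D' \<Longrightarrow> graded D' n"
  by (auto simp: graded_def)

lemma graded_zero [simp]: "graded D 0"
  by (simp add: graded_def)

lemma graded_add: "graded D m \<Longrightarrow> graded D n \<Longrightarrow> graded D (m + n)"
  using keys_add[of m n] unfolding graded_def by blast

lemma graded_psc: "graded D n \<Longrightarrow> graded D (psc a n)"
  by (auto simp: graded_def in_keys_iff)

lemma graded_minus: "graded D m \<Longrightarrow> graded D n \<Longrightarrow> graded D (m - n)"
proof -
  assume "graded D m" "graded D n"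
  then have "graded D (m + psc (-1) n)" by (intro graded_add graded_psc)
  moreover have "m + psc (-1) n = m - n"
    by (rule poly_mapping_eqI) (simp add: lookup_add lookup_minus)
  ultimately show ?thesis by simp
qed

lemma graded_sum: "(\<And>i. i \<in> A \<Longrightarrow> graded D (f i)) \<Longrightarrow> graded D (sum f A)"
  by (induction A rule: infinite_finite_induct) (simp_all add: graded_add)

lemma graded_single: "grade k \<in> D \<Longrightarrow> graded D (sgl k a)"
  by (simp add: graded_def)

lemma graded_mult:
  assumes "graded D m" "graded D' n" "\<And>x y. x \<in> D \<Longrightarrow> y \<in> D' \<Longrightarrow> x + y \<in> D''"
  shows "graded D'' (m * n)"
  unfolding graded_def
proof
  fix k assume "k \<in> Poly_Mapping.keys (m * n)"
  then obtain a b where "k = a + b" "a \<in> Poly_Mapping.keys m" "b \<in> Poly_Mapping.keys n"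
    using keys_mult[of m n] by blast
  then show "grade k \<in> D''" using assms by (auto simp: graded_def grade_add)
qed

lemma graded_homogeneous_mult:
  assumes "graded {c} m" "graded {d} n"
  shows "graded {c + d} (m * n)"
  by (rule graded_mult[OF assms]) auto

lemma graded_gens:
  "graded {(0, {#})} (covN \<xi>)" "graded {(1, {#})} (vecN v)" "graded {(0, {#u#})} (gN u)"
  "graded {(0, {#})} (xN i)" "graded {(1, {#})} (yN i)" "graded {(0, {#})} 1"
proof -
  show "graded {(0, {#})} (xN i)" "graded {(1, {#})} (yN i)" "graded {(0, {#u#})} (gN u)" for i
    unfolding xN_def yN_def gN_def by (rule graded_single; simp)+
  then show "graded {(0, {#})} (covN \<xi>)" "graded {(1, {#})} (vecN v)"
    unfolding covN_def vecN_def by (auto intro!: graded_sum graded_psc)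
  show "graded {(0, {#})} 1"
    unfolding sgl_one[symmetric] by (rule graded_single) simp
qed

lemma graded_grp_op_single:
  "graded {(size \<nu>, image_mset ((**) w) G)} (ap (grp_op w) (sgl (\<mu>, \<nu>, G) a))"
proof -
  have 1: "graded {(0, {#})} (\<Prod>i\<in>#\<mu>. covN (dual_act w (axis i 1)))"
  proof (induction \<mu>)
    case (add j \<mu>)
    show ?case using graded_homogeneous_mult[OF graded_gens(1) add] by simp
  qed (simp add: graded_gens)
  have 2: "graded {(size \<nu>, {#})} (\<Prod>i\<in>#\<nu>. vecN (w *v axis i 1))"
  proof (induction \<nu>)
    case (add j \<nu>)
    show ?case using graded_homogeneous_mult[OF graded_gens(2) add] by simp
  qed (simp add: graded_gens)
  have 3: "graded {(0, image_mset ((**) w) G)} (\<Prod>u\<in>#G. gN (w ** u))"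
  proof (induction G)
    case (add u G)
    show ?case using graded_homogeneous_mult[OF graded_gens(3) add] by simp
  qed (simp add: graded_gens)
  show ?thesis
    using graded_homogeneous_mult[OF graded_homogeneous_mult[OF 1 2] 3]
    by (simp add: ap_grp_op graded_psc)
qed

lemma ap_expand: "ap A n = (\<Sum>k\<in>Poly_Mapping.keys n. psc (coef n k) (ap A (sgl k 1)))"
  by (subst poly_mapping_sum_single[of n]) (simp add: ap_sum ap_psc[symmetric])

lemma graded_grp_op:
  assumes "graded D n" "\<And>d G. (d, G) \<in> D \<Longrightarrow> (d, image_mset ((**) w) G) \<in> D'"
  shows "graded D' (ap (grp_op w) n)"
proof -
  have "graded D' (ap (grp_op w) (sgl k 1))" if "k \<in> Poly_Mapping.keys n" for k
  proof -
    obtain \<mu> \<nu> G where k: "k = (\<mu>, \<nu>, G)" by (cases k)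
    have "(size \<nu>, G) \<in> D" using that assms(1) by (auto simp: graded_def k)
    then show ?thesis using graded_mono[OF graded_grp_op_single[of \<nu> w G \<mu> 1]] assms(2) by (auto simp: k)
  qed
  then show ?thesis by (subst ap_expand) (intro graded_sum graded_psc)
qed

definition component :: "(nat \<times> (complex ^ 'n ^ 'n) multiset) set \<Rightarrow> 'n :: finite nf \<Rightarrow> 'n nf" where
  "component D = pm.lext (\<lambda>k. if grade k \<in> D then sgl k 1 else 0)"

lemma component_add: "component D (m + n) = component D m + component D n" and component_psc: "component D (psc a n) = psc a (component D n)"
  and component_zero [simp]: "component D 0 = 0"
  by (simp_all add: component_def pm.lext_add pm.lext_psc)

lemma component_sum: "component D (sum f A) = (\<Sum>i\<in>A. component D (f i))"
  by (induction A rule: infinite_finite_induct) (simp_all add: component_add)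

lemma coef_component: "coef (component D n) k = (if grade k \<in> D then coef n k else 0)"
proof (induction n rule: pm_induct)
  case (single l a)
  show ?case by (auto simp: component_def lookup_single when_def)
qed (simp add: component_add lookup_add)

lemma component_eq: "graded D n \<Longrightarrow> component D n = n"
  by (rule poly_mapping_eqI) (auto simp: coef_component graded_def in_keys_iff)

lemma component_eq_0: "graded D n \<Longrightarrow> D \<inter> D' = {} \<Longrightarrow> component D' n = 0"
  by (rule poly_mapping_eqI) (auto simp: coef_component graded_def in_keys_iff)

lemma graded_component: "graded D (component D n)"
  by (auto simp: graded_def in_keys_iff coef_component split: if_splits)

subsection \<open>Cancellation\<close>

text \<open>As \<open>p\<close> and \<open>q\<close> have a fixed group part, the group variables may be set to \<open>1\<close> without losing
  information. What remains are polynomials in finitely many variables, and numbering these variables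
  turns them into finitely supported functions on monomials indexed by \<open>nat\<close>, an integral domain.\<close>

lemma graded_no_zero_divisors:
  fixes p q :: "'n :: finite nf"
  assumes p: "graded {(d, G)} p" and q: "graded {(e, H)} q" and pq: "p * q = 0"
  shows "p = 0 \<or> q = 0"
proof -
  obtain \<iota> :: "'n \<Rightarrow> nat" where \<iota>: "inj \<iota>"
    using finite_imp_inj_to_nat_seg[of "UNIV :: 'n set"] by auto
  \<comment> \<open>The exponents of the \<open>x\<close> go to even positions, those of the \<open>y\<close> to odd positions.\<close>
  define e :: "'n multiset \<Rightarrow> 'n multiset \<Rightarrow> nat \<Rightarrow>\<^sub>0 nat" where
    "e \<mu> \<nu> = (\<Sum>i\<in>#\<mu>. Poly_Mapping.single (2 * \<iota> i) 1) + (\<Sum>i\<in>#\<nu>. Poly_Mapping.single (2 * \<iota> i + 1) 1)" for \<mu> \<nu>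
  have 1: "Poly_Mapping.lookup (\<Sum>i\<in>#\<mu>. Poly_Mapping.single (2 * \<iota> i) (1::nat)) (2 * \<iota> j) = count \<mu> j"
    "Poly_Mapping.lookup (\<Sum>i\<in>#\<mu>. Poly_Mapping.single (2 * \<iota> i + 1) (1::nat)) (2 * \<iota> j + 1) = count \<mu> j" for \<mu> j
    by (induction \<mu>; use \<iota> in \<open>auto simp: lookup_add lookup_single when_def inj_eq\<close>)+
  have 2: "Poly_Mapping.lookup (\<Sum>i\<in>#\<mu>. Poly_Mapping.single (2 * \<iota> i) (1::nat)) (2 * \<iota> j + 1) = 0"
    "Poly_Mapping.lookup (\<Sum>i\<in>#\<mu>. Poly_Mapping.single (2 * \<iota> i + 1) (1::nat)) (2 * \<iota> j) = 0" for \<mu> j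
    by (induction \<mu>; auto simp: lookup_add lookup_single when_def; presburger)+
  have e_inj: "\<mu> = \<mu>' \<and> \<nu> = \<nu>'" if eq: "e \<mu> \<nu> = e \<mu>' \<nu>'" for \<mu> \<nu> \<mu>' \<nu>'
  proof -
    have "count \<mu> j = count \<mu>' j \<and> count \<nu> j = count \<nu>' j" for j
      using arg_cong[OF eq, of "\<lambda>f. Poly_Mapping.lookup f (2 * \<iota> j)"]
        arg_cong[OF eq, of "\<lambda>f. Poly_Mapping.lookup f (2 * \<iota> j + 1)"]
      unfolding e_def lookup_add 1 2 by simp
    then show ?thesis by (simp add: multiset_eq_iff)
  qed
  define E :: "'n nf \<Rightarrow> (nat \<Rightarrow>\<^sub>0 nat) \<Rightarrow>\<^sub>0 complex" where
    "E = pm.lext (\<lambda>k. sgl (e (fst k) (fst (snd k))) 1)"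
  have E_mult: "E (m * n) = E m * E n" for m n
    unfolding E_def by (rule pma.lext_mult) (simp add: e_def mult_single plus_prod_def add_ac)
  have E_zero: "n = 0" if n: "graded {(d, G)} n" and E: "E n = 0" for n d G
  proof (rule poly_mapping_eqI)
    fix k
    show "coef n k = coef 0 k"
    proof (rule ccontr)
      assume "coef n k \<noteq> coef 0 k"
      then have k: "k \<in> Poly_Mapping.keys n" by (simp add: in_keys_iff)
      have "coef (E n) (e (fst k) (fst (snd k)))
          = (\<Sum>l\<in>Poly_Mapping.keys n. if l = k then coef n k else 0)"
        unfolding E_def pm.lext_def lookup_sum
      proof (rule sum.cong[OF refl])
        fix l assume l: "l \<in> Poly_Mapping.keys n"
        have "snd (snd l) = snd (snd k)" using n k l by (auto simp: graded_def grade_def)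
        then have "e (fst l) (fst (snd l)) = e (fst k) (fst (snd k)) \<longleftrightarrow> l = k"
          using e_inj by (metis prod.expand)
        then show "coef (psc (coef n l) (sgl (e (fst l) (fst (snd l))) 1)) (e (fst k) (fst (snd k)))
            = (if l = k then coef n k else 0)"
          by (auto simp: lookup_single when_def)
      qed
      then show False using k E by (simp add: in_keys_iff)
    qed
  qed
  have "E p * E q = 0" using pq E_mult[of p q] by (simp add: E_def)
  then show ?thesis using E_zero[OF p] E_zero[OF q] by auto
qed

subsection \<open>Partial derivatives\<close>

text \<open>The subtraction in the key is truncated when \<open>j\<close> does not occur, but then the coefficient is \<open>0\<close>.\<close>

definition dx :: "'n \<Rightarrow> 'n :: finite nf \<Rightarrow> 'n nf" where
  "dx j = pm.lext (\<lambda>(\<mu>, \<nu>, G). sgl (\<mu> - {#j#}, \<nu>, G) (of_nat (count \<mu> j)))"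

definition dy :: "'n \<Rightarrow> 'n :: finite nf \<Rightarrow> 'n nf" where
  "dy i = pm.lext (\<lambda>(\<mu>, \<nu>, G). sgl (\<mu>, \<nu> - {#i#}, G) (of_nat (count \<nu> i)))"

lemma d_linear: "dx j (m + n) = dx j m + dx j n" "dx j (psc a n) = psc a (dx j n)"
  "dy j (m + n) = dy j m + dy j n" "dy j (psc a n) = psc a (dy j n)" "dx j 0 = 0" "dy j 0 = 0"
  by (simp_all add: dx_def dy_def pm.lext_add pm.lext_psc)

lemma coef_x: "coef (xN i * n) (\<mu>, \<nu>, G) = (if i \<in># \<mu> then coef n (\<mu> - {#i#}, \<nu>, G) else 0)"
proof (induction n rule: pm_induct)
  case (single k a)
  then show ?case by (cases k) (auto simp: sgl_add_mset[symmetric] lookup_single when_def)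
qed (simp add: distrib_left lookup_add)

lemma coef_y: "coef (yN i * n) (\<mu>, \<nu>, G) = (if i \<in># \<nu> then coef n (\<mu>, \<nu> - {#i#}, G) else 0)"
proof (induction n rule: pm_induct)
  case (single k a)
  then show ?case by (cases k) (auto simp: sgl_add_mset[symmetric] lookup_single when_def)
qed (simp add: distrib_left lookup_add)

lemma coef_dx: "coef (dx j n) (\<mu>, \<nu>, G) = of_nat (count \<mu> j + 1) * coef n (add_mset j \<mu>, \<nu>, G)"
proof (induction n rule: pm_induct)
  case (single k a)
  obtain \<mu>' \<nu>' G' where k: "k = (\<mu>', \<nu>', G')" by (cases k)
  show ?case
    by (cases "j \<in># \<mu>'")
      (auto simp: k dx_def lookup_single when_def not_in_iff dest: multi_member_split)
qed (simp add: d_linear lookup_add algebra_simps)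

lemma coef_dy: "coef (dy i n) (\<mu>, \<nu>, G) = of_nat (count \<nu> i + 1) * coef n (\<mu>, add_mset i \<nu>, G)"
proof (induction n rule: pm_induct)
  case (single k a)
  obtain \<mu>' \<nu>' G' where k: "k = (\<mu>', \<nu>', G')" by (cases k)
  show ?case
    by (cases "i \<in># \<nu>'")
      (auto simp: k dy_def lookup_single when_def not_in_iff dest: multi_member_split)
qed (simp add: d_linear lookup_add algebra_simps)

lemma d_mult_commute:
  "dy i (xN j * n) = xN j * dy i n" "dy i (gN u * n) = gN u * dy i n"
  "dx i (yN j * n) = yN j * dx i n" "dx i (gN u * n) = gN u * dx i n"
proof -
  have "dy i (xN j * n) = xN j * dy i n \<and> dy i (gN u * n) = gN u * dy i n \<and>
    dx i (yN j * n) = yN j * dx i n \<and> dx i (gN u * n) = gN u * dx i n"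
  proof (induction n rule: pm_induct)
    case (single k a)
    then show ?case by (cases k) (simp add: dx_def dy_def flip: sgl_add_mset)
  qed (simp add: d_linear distrib_left)
  then show "dy i (xN j * n) = xN j * dy i n" "dy i (gN u * n) = gN u * dy i n"
    "dx i (yN j * n) = yN j * dx i n" "dx i (gN u * n) = gN u * dx i n" by auto
qed

lemma dx_x: "dx j (xN i * n) = (if i = j then n else 0) + xN i * dx j n"
  for n :: "'n :: finite nf"
proof (rule poly_mapping_eqI)
  fix k :: "'n nf_key"
  obtain \<mu> \<nu> G where k: "k = (\<mu>, \<nu>, G)" by (cases k)
  show "coef (dx j (xN i * n)) k = coef ((if i = j then n else 0) + xN i * dx j n) k"
  proof (cases "i \<in># \<mu>")
    case True
    then obtain M where M: "\<mu> = add_mset i M" by (meson multi_member_split)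
    have "add_mset j (add_mset i M) - {#i#} = add_mset j M" by (simp add: multiset_eq_iff)
    then show ?thesis unfolding k coef_dx lookup_add coef_x by (auto simp: M coef_dx algebra_simps)
  next
    case False
    then have "count \<mu> i = 0" by (simp add: not_in_iff)
    with False show ?thesis unfolding k coef_dx lookup_add coef_x by auto
  qed
qed

lemma dy_y: "dy j (yN i * n) = (if i = j then n else 0) + yN i * dy j n"
  for n :: "'n :: finite nf"
proof (rule poly_mapping_eqI)
  fix k :: "'n nf_key"
  obtain \<mu> \<nu> G where k: "k = (\<mu>, \<nu>, G)" by (cases k)
  show "coef (dy j (yN i * n)) k = coef ((if i = j then n else 0) + yN i * dy j n) k"
  proof (cases "i \<in># \<nu>")
    case True
    then obtain M where M: "\<nu> = add_mset i M" by (meson multi_member_split)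
    have "add_mset j (add_mset i M) - {#i#} = add_mset j M" by (simp add: multiset_eq_iff)
    then show ?thesis unfolding k coef_dy lookup_add coef_y by (auto simp: M coef_dy algebra_simps)
  next
    case False
    then have "count \<nu> i = 0" by (simp add: not_in_iff)
    with False show ?thesis unfolding k coef_dy lookup_add coef_y by auto
  qed
qed

text \<open>The hypothesis says that \<open>p\<close> has zero Poisson bracket with \<open>x\<^sub>i y\<^sub>j\<close>. Taking \<open>i = j\<close> leaves only the
  coefficients at \<open>(\<kappa>, \<kappa>)\<close>; taking \<open>i \<noteq> j\<close> relates the coefficients at \<open>\<kappa> + i\<close> and \<open>\<kappa> + j\<close> by nonzero
  factors. So one can move letter by letter from any \<open>\<kappa>\<close> to the power of a single letter.\<close>

lemma gl_invariant_determined: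
  fixes p :: "'n :: finite nf"
  assumes inv: "\<And>i j. yN j * dy i p = xN i * dx j p"
    and p: "graded {(m, G)} p"
    and top: "coef p (replicate_mset m i0, replicate_mset m i0, G) = 0"
  shows "p = 0"
proof -
  have coef_inv: "(if j \<in># \<nu> then of_nat (count (\<nu> - {#j#}) i + 1) * coef p (\<mu>, add_mset i (\<nu> - {#j#}), G) else 0)
      = (if i \<in># \<mu> then of_nat (count (\<mu> - {#i#}) j + 1) * coef p (add_mset j (\<mu> - {#i#}), \<nu>, G) else 0)"
    for i j \<mu> \<nu>
    using arg_cong[OF inv[of j i], of "\<lambda>n. coef n (\<mu>, \<nu>, G)"] unfolding coef_x coef_y coef_dx coef_dy .
  have diag: "\<mu> = \<nu>" if nz: "coef p (\<mu>, \<nu>, G) \<noteq> 0" for \<mu> \<nu>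
  proof -
    have "count \<mu> i = count \<nu> i" for i
    proof -
      have e: "(if i \<in># M then of_nat (count (M - {#i#}) i + 1) * z else 0) = of_nat (count M i) * z"
        for M and z :: complex
        by (auto simp: not_in_iff dest: multi_member_split)
      have a: "i \<in># M \<Longrightarrow> add_mset i (M - {#i#}) = M" for M by simp
      have "of_nat (count \<nu> i) * coef p (\<mu>, \<nu>, G) = of_nat (count \<mu> i) * coef p (\<mu>, \<nu>, G)"
        using coef_inv[of i \<nu> i \<mu>] e a by (metis (full_types))
      then show ?thesis using nz by simp
    qed
    then show ?thesis by (simp add: multiset_eq_iff)
  qed
  have swap: "coef p (add_mset j \<kappa>, add_mset j \<kappa>, G) = 0"
    if "coef p (add_mset i \<kappa>, add_mset i \<kappa>, G) = 0" for i j \<kappa>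
  proof -
    have "of_nat (count \<kappa> i + 1) * coef p (add_mset i \<kappa>, add_mset i \<kappa>, G)
        = of_nat (count \<kappa> j + 1) * coef p (add_mset j \<kappa>, add_mset j \<kappa>, G)"
      using coef_inv[of j "add_mset j \<kappa>" i "add_mset i \<kappa>"] by simp
    moreover have "(of_nat (count \<kappa> j + 1) :: complex) \<noteq> 0" by (simp only: of_nat_eq_0_iff)
    ultimately show ?thesis using that by (metis mult_eq_0_iff)
  qed
  have zero: "coef p (\<kappa>, \<kappa>, G) = 0" if "size \<kappa> = m" for \<kappa>
    using that
  proof (induction "size (filter_mset (\<lambda>i. i \<noteq> i0) \<kappa>)" arbitrary: \<kappa>)
    case 0
    then have "filter_mset (\<lambda>i. i \<noteq> i0) \<kappa> = {#}" by simp
    then have "\<forall>i\<in>#\<kappa>. i = i0" by (auto simp: filter_mset_eq_conv)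
    then have "\<kappa> = replicate_mset m i0" using 0(2) by (metis set_mset_subset_singletonD subsetI singletonI)
    then show ?case using top by simp
  next
    case (Suc d)
    then have "filter_mset (\<lambda>i. i \<noteq> i0) \<kappa> \<noteq> {#}" by (metis size_empty nat.distinct(1))
    then obtain j where j: "j \<in># \<kappa>" "j \<noteq> i0" by (auto simp: filter_mset_eq_conv)
    then obtain \<kappa>' where \<kappa>: "\<kappa> = add_mset j \<kappa>'" by (meson multi_member_split)
    have "coef p (add_mset i0 \<kappa>', add_mset i0 \<kappa>', G) = 0"
      by (rule Suc(1)) (use Suc(2,3) j in \<open>auto simp: \<kappa>\<close>)
    then show ?case unfolding \<kappa> by (rule swap)
  qed
  show "p = 0"
  proof (rule poly_mapping_eqI)
    fix k :: "'n nf_key"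
    obtain \<mu> \<nu> H where k: "k = (\<mu>, \<nu>, H)" by (cases k)
    have "coef p k = 0"
    proof (rule ccontr)
      assume nz: "coef p k \<noteq> 0"
      then have "grade k = (m, G)" using p by (auto simp: graded_def in_keys_iff)
      then have "size \<nu> = m" "H = G" by (auto simp: k)
      then show False using nz diag[of \<mu> \<nu>] zero[of \<nu>] by (auto simp: k)
    qed
    then show "coef p k = coef 0 k" by simp
  qed
qed

section \<open>Symbols of commuting elements\<close>

definition xmon :: "'n :: finite list \<Rightarrow> 'n nf" where "xmon l = sgl (mset l, {#}, {#}) 1"
definition ymon :: "'n :: finite list \<Rightarrow> 'n nf" where "ymon l = sgl ({#}, mset l, {#}) 1"

lemma mon_simps [simp]: "xmon [] = 1" "xmon (i # l) = xN i * xmon l" "ymon [] = 1" "ymon (i # l) = yN i * ymon l"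
  by (simp_all add: xmon_def ymon_def sgl_one sgl_add_mset)

lemma sgl_eq_mon: "sgl (mset l, mset l', {#u#}) 1 = xmon l * (ymon l' * gN u)"
  by (simp add: xmon_def ymon_def gN_def mult_single add_Pair)

lemma xfree_ymon: "xfree (ymon l)"
  by (simp add: ymon_def xfree_single)

lemma xfree_yN: "xfree (yN i)"
  by (simp add: yN_def xfree_single)

lemma xfree_dy: "xfree n \<Longrightarrow> xfree (dy i n)"
proof (induction n rule: xfree_basis_induct)
  case (single k a)
  then show ?case by (cases k) (simp add: dy_def xfree_single)
qed (simp add: d_linear xfree_add)

definition dyv :: "complex ^ 'n \<Rightarrow> 'n nf \<Rightarrow> 'n nf" where
  "dyv \<eta> n = (\<Sum>i\<in>UNIV. psc (\<eta> $ i) (dy i n))"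

lemma dyv_y: "dyv \<eta> (yN j * n) = psc (\<eta> $ j) n + yN j * dyv \<eta> n"
proof -
  have "dyv \<eta> (yN j * n) = (\<Sum>i\<in>UNIV. (if i = j then psc (\<eta> $ j) n else 0) + yN j * psc (\<eta> $ i) (dy i n))"
    unfolding dyv_def
    by (rule sum.cong) (auto simp: dy_y psc_add_right pma.scale_mult_right)
  then show ?thesis by (simp add: sum.distrib dyv_def sum_distrib_left)
qed

lemma dyv_mult_commute: "dyv \<eta> (xN j * n) = xN j * dyv \<eta> n" "dyv \<eta> (gN u * n) = gN u * dyv \<eta> n"
  by (simp_all add: dyv_def d_mult_commute sum_distrib_left pma.scale_mult_right)

lemma dyv_xmon: "dyv \<eta> (xmon l * n) = xmon l * dyv \<eta> n"
  by (induction l) (simp_all add: dyv_mult_commute mult.assoc)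

lemma dx_ymon: "dx j (ymon l * n) = ymon l * dx j n"
  by (induction l) (simp_all add: d_mult_commute mult.assoc)

lemma dyv_one: "dyv \<eta> 1 = 0" and dx_one: "dx j 1 = 0"
  unfolding sgl_one[symmetric] by (simp_all add: dyv_def dy_def dx_def)

lemma dx_mult_xfree: "dx j (xmon l * (ymon l' * gN u)) = dx j (xmon l) * (ymon l' * gN u)"
proof (induction l)
  case Nil
  have "dx j (gN u * 1) = 0" unfolding d_mult_commute dx_one by simp
  then show ?case by (simp add: dx_ymon dx_one)
qed (simp add: dx_x mult.assoc distrib_right)

lemma graded_mons: "graded {(0, {#})} (xmon l)" "graded {(length l, {#})} (ymon l)"
  unfolding xmon_def ymon_def by (rule graded_single; simp)+

lemma graded_dx: "graded {(d, G)} n \<Longrightarrow> graded {(d, G)} (dx j n)"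
  unfolding graded_def
proof
  fix k assume n: "\<forall>k\<in>Poly_Mapping.keys n. grade k \<in> {(d, G)}" and k: "k \<in> Poly_Mapping.keys (dx j n)"
  obtain \<mu> \<nu> H where k': "k = (\<mu>, \<nu>, H)" by (cases k)
  have "(add_mset j \<mu>, \<nu>, H) \<in> Poly_Mapping.keys n"
    using k unfolding k' in_keys_iff coef_dx by simp
  then show "grade k \<in> {(d, G)}" using n by (force simp: k')
qed

lemma graded_dy: "graded {(Suc d, G)} n \<Longrightarrow> graded {(d, G)} (dy j n)"
  unfolding graded_def
proof
  fix k assume n: "\<forall>k\<in>Poly_Mapping.keys n. grade k \<in> {(Suc d, G)}" and k: "k \<in> Poly_Mapping.keys (dy j n)"
  obtain \<mu> \<nu> H where k': "k = (\<mu>, \<nu>, H)" by (cases k)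
  have "(\<mu>, add_mset j \<nu>, H) \<in> Poly_Mapping.keys n"
    using k unfolding k' in_keys_iff coef_dy by simp
  then show "grade k \<in> {(d, G)}" using n by (force simp: k')
qed

context reflection_algebra
begin

text \<open>The grades of the correction terms: no more letters \<open>y\<close> than before, and the group part moved by
  a reflection.\<close>

definition reflected :: "nat \<Rightarrow> (complex ^ 'n ^ 'n) multiset \<Rightarrow> (nat \<times> (complex ^ 'n ^ 'n) multiset) set" where
  "reflected d G = {(e, image_mset ((**) s) G) | e s. e \<le> d \<and> s \<in> R}"

lemma graded_reflection_sum:
  assumes "graded {(d, G)} n"
  shows "graded (reflected d G) (\<Sum>s\<in>R. psc (refl_coef s \<xi> v) (ap (grp_op s) n))"
proof (rule graded_sum)
  fix s assume "s \<in> R"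
  then show "graded (reflected d G) (psc (refl_coef s \<xi> v) (ap (grp_op s) n))"
    by (intro graded_psc graded_grp_op[OF assms]) (auto simp: reflected_def)
qed

definition dunkl_list :: "'n list \<Rightarrow> 'n nf_op" where
  "dunkl_list l = prod_list (map (\<lambda>i. dunkl (axis i 1)) l)"

lemma dunkl_list_simps [simp]: "dunkl_list [] = 1" "dunkl_list (j # l) = dunkl (axis j 1) * dunkl_list l"
  by (simp_all add: dunkl_list_def)

text \<open>The commutator of a monomial in \<open>y\<close> with \<open>\<eta>\<close> is \<open>t\<close> times its derivative along \<open>\<eta>\<close>, up to terms in which a
  letter \<open>y\<close> has been replaced by a reflection. The corrections contain no \<open>x\<close>, so that further Dunkl
  operators act on them by multiplication.\<close>

lemma dunkl_list_cov:
  assumes h: "xfree h" "graded {(1, G)} h"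
  shows "\<exists>E. xfree E \<and> graded (reflected (length l) G) E \<and>
    ap (dunkl_list l) (covN \<eta> * h) = covN \<eta> * (ymon l * h) + psc t (dyv \<eta> (ymon l) * h) + E"
proof (induction l)
  case Nil
  show ?case by (rule exI[of _ 0]) (simp add: dyv_one xfree_def)
next
  case (Cons j l)
  then obtain E where E: "xfree E" "graded (reflected (length l) G) E"
    and eq: "ap (dunkl_list l) (covN \<eta> * h) = covN \<eta> * (ymon l * h) + psc t (dyv \<eta> (ymon l) * h) + E" by blast
  define F where "F = (\<Sum>s\<in>R. psc (refl_coef s \<eta> (axis j 1)) (ap (grp_op s) (ymon l * h)))"
  have gr: "graded {(Suc (length l), G)} (ymon l * h)"
    using graded_homogeneous_mult[OF graded_mons(2) h(2), of l] by simp
  have xf: "xfree (ymon l * h)" "xfree (dyv \<eta> (ymon l) * h)"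
    using h(1) by (auto simp: dyv_def intro!: xfree_mult xfree_ymon xfree_sum xfree_psc xfree_dy)
  have "ap (dunkl_list (j # l)) (covN \<eta> * h)
      = covN \<eta> * (yN j * (ymon l * h)) + (psc (t * \<eta> $ j) (ymon l * h) - F)
        + psc t (yN j * (dyv \<eta> (ymon l) * h)) + yN j * E"
    using xf E(1) by (simp add: eq ap_add ap_psc dunkl_cov dunkl_xfree vecN_simps ap_yx_op F_def)
  also have "\<dots> = covN \<eta> * (ymon (j # l) * h) + psc t (dyv \<eta> (ymon (j # l)) * h) + (yN j * E - F)"
    by (simp add: dyv_y psc_add_right distrib_right pma.scale_mult_left mult.assoc)
  finally have "ap (dunkl_list (j # l)) (covN \<eta> * h)
      = covN \<eta> * (ymon (j # l) * h) + psc t (dyv \<eta> (ymon (j # l)) * h) + (yN j * E - F)" .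
  moreover have "graded (reflected (length (j # l)) G) (yN j * E - F)"
  proof (rule graded_minus)
    show "graded (reflected (length (j # l)) G) (yN j * E)"
      by (rule graded_mult[OF graded_gens(5) E(2)]) (auto simp: reflected_def)
    show "graded (reflected (length (j # l)) G) F"
      unfolding F_def using graded_reflection_sum[OF gr] by simp
  qed
  moreover have "xfree (yN j * E - F)"
  proof -
    have "xfree F" unfolding F_def by (intro xfree_sum xfree_psc xfree_grp_op xf)
    then have "xfree (yN j * E + psc (-1) F)" by (intro xfree_add xfree_psc xfree_mult xfree_yN E)
    moreover have "yN j * E + psc (-1) F = yN j * E - F"
      by (rule poly_mapping_eqI) (simp add: lookup_add lookup_minus)
    ultimately show ?thesis by simp
  qed
  ultimately show ?case by blast
qed

text \<open>The same for a single \<open>y\<close> and a monomial in \<open>x\<close>.\<close>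

lemma dunkl_xmon:
  assumes h: "xfree h" "graded {(d, G)} h"
  shows "\<exists>E. graded (reflected d G) E \<and>
    ap (dunkl (axis j 1)) (xmon l * h) = xmon l * (yN j * h) + psc t (dx j (xmon l) * h) + E"
proof (induction l)
  case Nil
  show ?case by (rule exI[of _ 0]) (simp add: dx_one dunkl_xfree h vecN_simps)
next
  case (Cons i l)
  then obtain E where E: "graded (reflected d G) E"
    and eq: "ap (dunkl (axis j 1)) (xmon l * h) = xmon l * (yN j * h) + psc t (dx j (xmon l) * h) + E" by blast
  define F where "F = (\<Sum>s\<in>R. psc (refl_coef s (axis i 1) (axis j 1)) (ap (grp_op s) (xmon l * h)))"
  have gr: "graded {(d, G)} (xmon l * h)"
    using graded_homogeneous_mult[OF graded_mons(1) h(2), of l] by simp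
  have "pairing (axis i 1) (axis j 1) = (if i = j then 1 else 0 :: complex)"
    by (subst pairing_axis(1)) (simp add: axis_def)
  then have "ap (dunkl (axis j 1)) (xmon (i # l) * h)
      = xmon (i # l) * (yN j * h) + psc t (dx j (xmon (i # l)) * h) + (xN i * E - F)"
    by (simp add: mult.assoc dunkl_x eq ap_yx_op F_def dx_x distrib_left distrib_right psc_add_right pma.scale_mult_right
        del: pairing_axis)
  moreover have "graded (reflected d G) (xN i * E - F)"
  proof (rule graded_minus)
    show "graded (reflected d G) (xN i * E)"
      by (rule graded_mult[OF graded_gens(4) E]) (auto simp: reflected_def)
    show "graded (reflected d G) F" unfolding F_def by (rule graded_reflection_sum[OF gr])
  qed
  ultimately show ?case by blast
qed

abbreviation unit_nf :: "'n nf" where "unit_nf \<equiv> gN (mat 1)"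

lemma \<rho>_lprod: "\<rho> (lprod C l f) = prod_list (map (\<lambda>i. \<rho> (C i)) l) * \<rho> f"
  by (induction l) (simp_all add: \<rho>_mult mult.assoc)

lemma \<rho>_monomial:
  assumes "u \<in> W"
  shows "ap (\<rho> (monomial (\<mu>, \<nu>, {#u#}))) n = xmon (some_list \<mu>) * ap (dunkl_list (some_list \<nu>)) (ap (grp_op u) n)"
proof -
  have "ap (prod_list (map (\<lambda>i. cov_op (axis i 1)) l)) n = xmon l * n" for l and n :: "'n nf"
    by (induction l) (simp_all add: covN_simps mult.assoc)
  then show ?thesis using assms by (simp add: \<rho>_lprod grp_mset_single dunkl_list_def)
qed

text \<open>The failure of \<open>u\<close> to fix \<open>x\<^sub>i y\<^sub>j\<close>: the leading symbol of \<open>[u, x\<^sub>i y\<^sub>j]\<close>.\<close>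

definition symb :: "complex ^ 'n ^ 'n \<Rightarrow> 'n \<Rightarrow> 'n \<Rightarrow> 'n nf" where
  "symb u i j = covN (dual_act u (axis i 1)) * vecN (u *v axis j 1) - xN i * yN j"

text \<open>The commutator of the monomial \<open>k\<close> with \<open>x\<^sub>i y\<^sub>j\<close>, applied to the unit.\<close>

definition defect :: "'n \<Rightarrow> 'n \<Rightarrow> 'n nf_key \<Rightarrow> 'n nf" where
  "defect i j k = ap (\<rho> (monomial k)) (xN i * (yN j * unit_nf)) - xN i * ap (dunkl (axis j 1)) (sgl k 1)"

text \<open>The three summands have \<open>size \<nu> + 1\<close>, \<open>size \<nu>\<close> and at most \<open>size \<nu>\<close> letters \<open>y\<close>; only the last one
  leaves the group element \<open>u\<close>.\<close>

lemma defect_expansion: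
  assumes u: "u \<in> W" and k: "k = (\<mu>, \<nu>, {#u#})"
  shows "\<exists>E. graded (reflected (size \<nu>) {#u#}) E \<and>
    defect i j k = sgl k 1 * symb u i j
      + psc t (dyv (dual_act u (axis i 1)) (sgl k 1) * vecN (u *v axis j 1) - xN i * dx j (sgl k 1)) + E"
proof -
  define \<eta> v where "\<eta> = dual_act u (axis i 1)" and "v = u *v axis j 1"
  let ?x = "xmon (some_list \<mu>)" and ?y = "ymon (some_list \<nu>)"
  have len: "length (some_list \<nu>) = size \<nu>" using mset_some_list[of \<nu>] by (metis size_mset)
  have kk: "sgl k 1 = ?x * (?y * gN u)"
    using sgl_eq_mon[of "some_list \<mu>" "some_list \<nu>" u] by (simp add: k mset_some_list)
  have "graded {(1, {#u#})} (vecN v * gN u)"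
    using graded_homogeneous_mult[OF graded_gens(2)[of v] graded_gens(3)[of u]] by simp
  then obtain E where E: "graded (reflected (size \<nu>) {#u#}) E"
    and eqE: "ap (dunkl_list (some_list \<nu>)) (covN \<eta> * (vecN v * gN u))
      = covN \<eta> * (?y * (vecN v * gN u)) + psc t (dyv \<eta> ?y * (vecN v * gN u)) + E"
    using dunkl_list_cov[of "vecN v * gN u" "{#u#}" "some_list \<nu>" \<eta>] len
    by (auto intro: xfree_mult xfree_vecN xfree_gN)
  have "graded {(size \<nu>, {#u#})} (?y * gN u)"
    using graded_homogeneous_mult[OF graded_mons(2)[of "some_list \<nu>"] graded_gens(3)[of u]] len by simp
  then obtain F where F: "graded (reflected (size \<nu>) {#u#}) F"
    and eqF: "ap (dunkl (axis j 1)) (?x * (?y * gN u)) = ?x * (yN j * (?y * gN u)) + psc t (dx j ?x * (?y * gN u)) + F"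
    using dunkl_xmon[of "?y * gN u" "size \<nu>" "{#u#}" j "some_list \<mu>"]
    by (auto intro: xfree_mult xfree_ymon xfree_gN)
  have dy: "dyv \<eta> (sgl k 1) = ?x * (dyv \<eta> ?y * gN u)"
    unfolding kk dyv_xmon by (subst mult.commute[of ?y]) (simp add: dyv_mult_commute mult_ac)
  have dx: "dx j (sgl k 1) = dx j ?x * (?y * gN u)"
    unfolding kk by (rule dx_mult_xfree)
  have "ap (grp_op u) (xN i * (yN j * unit_nf)) = covN \<eta> * (vecN v * gN u)"
    by (simp add: grp_op_mult_nf \<eta>_def v_def)
  then have "ap (\<rho> (monomial k)) (xN i * (yN j * unit_nf))
      = ?x * (covN \<eta> * (?y * (vecN v * gN u)) + psc t (dyv \<eta> ?y * (vecN v * gN u)) + E)"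
    unfolding k by (simp only: \<rho>_monomial[OF u] eqE)
  then have "defect i j k = sgl k 1 * symb u i j + psc t (dyv \<eta> (sgl k 1) * vecN v - xN i * dx j (sgl k 1)) + (?x * E - xN i * F)"
    unfolding defect_def dy dx
    unfolding kk eqF symb_def \<eta>_def[symmetric] v_def[symmetric]
    by (simp add: algebra_simps pma.scale_mult_right[symmetric] pm.scale_right_diff_distrib)
  moreover have "graded (reflected (size \<nu>) {#u#}) (?x * E - xN i * F)"
    by (intro graded_minus graded_mult[OF graded_mons(1) E] graded_mult[OF graded_gens(4) F])
      (auto simp: reflected_def)
  ultimately show ?thesis unfolding \<eta>_def v_def by blast
qed

lemma graded_symb: "graded {(1, {#})} (symb u i j)"
  using graded_homogeneous_mult[OF graded_gens(1,2)] graded_homogeneous_mult[OF graded_gens(4,5)]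
  unfolding symb_def by (intro graded_minus) simp_all

lemma graded_defect_parts:
  assumes k: "k = (\<mu>, \<nu>, {#u#})"
  shows "graded {(Suc (size \<nu>), {#u#})} (sgl k 1 * symb u i j)"
    and "graded {(size \<nu>, {#u#})} (dyv \<eta> (sgl k 1) * vecN v - xN i * dx j (sgl k 1))"
proof -
  have sk: "graded {(size \<nu>, {#u#})} (sgl k 1)" by (rule graded_single) (simp add: k)
  show "graded {(Suc (size \<nu>), {#u#})} (sgl k 1 * symb u i j)"
    using graded_homogeneous_mult[OF sk graded_symb] by simp
  show "graded {(size \<nu>, {#u#})} (dyv \<eta> (sgl k 1) * vecN v - xN i * dx j (sgl k 1))"
  proof (rule graded_minus)
    show "graded {(size \<nu>, {#u#})} (xN i * dx j (sgl k 1))"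
      using graded_homogeneous_mult[OF graded_gens(4) graded_dx[OF sk]] by simp
    show "graded {(size \<nu>, {#u#})} (dyv \<eta> (sgl k 1) * vecN v)"
    proof (cases "size \<nu>")
      case 0
      then have "dyv \<eta> (sgl k 1) = 0" by (simp add: k dyv_def dy_def)
      then show ?thesis by simp
    next
      case (Suc d)
      have "graded {(d, {#u#})} (dyv \<eta> (sgl k 1))"
        unfolding dyv_def using sk Suc by (intro graded_sum graded_psc graded_dy) simp
      then show ?thesis using graded_homogeneous_mult[OF _ graded_gens(2)] Suc by fastforce
    qed
  qed
qed

lemma matrix_eqI: "(\<And>v. (A :: complex ^ 'n ^ 'n) *v v = B *v v) \<Longrightarrow> A = B"
  by (simp add: matrix_eq)

lemma scalar_inv:
  assumes u: "u \<in> W" "u = mat a"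
  shows "a \<noteq> 0" "dual_act u \<xi> = inverse a *s \<xi>"
proof -
  have 1: "a *s (matrix_inv u *v v) = v" for v
    using W_inv_vec(1)[OF u(1), of v] by (simp add: u(2) mat_vec)
  show a: "a \<noteq> 0"
  proof
    assume "a = 0"
    then have "(axis undefined 1 :: complex ^ 'n) = 0" using 1[of "axis undefined 1"] by simp
    then show False by (simp add: axis_eq_0_iff)
  qed
  have "matrix_inv u *v v = inverse a *s v" for v
  proof -
    have "inverse a *s v = inverse a *s (a *s (matrix_inv u *v v))" by (simp only: 1)
    then show ?thesis using a by simp
  qed
  then show "dual_act u \<xi> = inverse a *s \<xi>" by (intro pairing_eqI) simp
qed

text \<open>A scalar matrix acts on \<open>\<hh>\<close> and \<open>\<hh>\<^sup>*\<close> by inverse factors.\<close>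

lemma symb_scalar:
  assumes "u \<in> W" "scalar u"
  shows "symb u i j = 0" "dyv (dual_act u (axis i 1)) n * vecN (u *v axis j 1) = yN j * dy i n"
proof -
  obtain a where u: "u = mat a" using assms(2) by (auto simp: scalar_def)
  note s = scalar_inv[OF assms(1) u]
  have v: "vecN (u *v axis j 1) = psc a (yN j)" for j by (simp add: u mat_vec vecN_simps)
  show "symb u i j = 0"
    using s(1) by (simp add: symb_def s(2) v covN_simps pma.scale_mult_left pma.scale_mult_right)
  have "psc ((inverse a *s axis i 1) $ l) (dy l n) = (if l = i then psc (inverse a) (dy i n) else 0)" for l
    by (simp add: axis_def)
  then have "dyv (inverse a *s axis i 1) n = psc (inverse a) (dy i n)" by (simp add: dyv_def)
  then show "dyv (dual_act u (axis i 1)) n * vecN (u *v axis j 1) = yN j * dy i n"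
    using s(1) by (simp add: s(2) v pma.scale_mult_left pma.scale_mult_right mult.commute)
qed

lemma coef_cov_vec: "coef (covN \<eta> * vecN v) ({#k#}, {#l#}, {#}) = \<eta> $ k * v $ l"
proof -
  have "coef (psc (\<eta> $ i) (xN i) * psc (v $ j) (yN j)) ({#k#}, {#l#}, {#}) = (if j = l then if i = k then \<eta> $ k * v $ l else 0 else 0)" for i j
    by (auto simp: pma.scale_mult_left pma.scale_mult_right xN_def yN_def mult_single add_Pair lookup_single when_def)
  then show ?thesis
    by (simp add: covN_def vecN_def sum_product lookup_sum)
qed

text \<open>If \<open>u\<close> fixes every \<open>x\<^sub>i y\<^sub>j\<close>, comparing coefficients shows that each \<open>y\<^sub>j\<close> is an eigenvector of \<open>u\<close>, with an
  eigenvalue inverse to a diagonal entry of the dual action that does not depend on \<open>j\<close>.\<close>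

lemma symb_nonscalar:
  assumes "\<not> scalar u"
  shows "\<exists>i j. symb u i j \<noteq> 0"
proof (rule ccontr)
  assume "\<not> ?thesis"
  then have z: "covN (dual_act u (axis i 1)) * vecN (u *v axis j 1) = covN (axis i 1) * vecN (axis j 1)" for i j
    by (simp add: symb_def covN_simps vecN_simps)
  have e: "dual_act u (axis i 1) $ k * (u *v axis j 1) $ l = (axis i 1 :: complex ^ 'n) $ k * (axis j 1 :: complex ^ 'n) $ l" for i j k l
    using arg_cong[OF z, of "\<lambda>n. coef n ({#k#}, {#l#}, {#})"] unfolding coef_cov_vec .
  define i0 :: 'n where "i0 = undefined"
  define a where "a = inverse (dual_act u (axis i0 1) $ i0)"
  have "(u *v axis j 1) $ l = a * (axis j 1 :: complex ^ 'n) $ l" for j l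
  proof -
    have "dual_act u (axis i0 1) $ i0 * (u *v axis j 1) $ j = 1" using e[of i0 i0 j j] by simp
    then have "dual_act u (axis i0 1) $ i0 \<noteq> 0" by auto
    then show ?thesis using e[of i0 i0 j l] by (simp add: a_def field_simps)
  qed
  then have "u *v axis j 1 = mat a *v axis j 1" for j by (simp add: mat_vec vec_eq_iff)
  moreover have "(A *v axis j 1) $ l = A $ l $ j" for A :: "complex ^ 'n ^ 'n" and l j
    by (simp add: matrix_vector_mult_def axis_def if_distrib[of "(*) _"] cong: if_cong)
  ultimately have "u $ l $ j = (mat a :: complex ^ 'n ^ 'n) $ l $ j" for l j by metis
  then have "u = mat a" by (simp add: vec_eq_iff)
  then show False using assms by (auto simp: scalar_def)
qed

lemma scalar_cancel:
  assumes "u \<in> W" "scalar u" "scalar (s ** u)"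
  shows "scalar s"
proof -
  obtain a b where a: "u = mat a" and b: "s ** u = mat b" using assms by (auto simp: scalar_def)
  have "s *v v = mat (b / a) *v v" for v
  proof -
    have "(s ** u) *v (inverse a *s v) = s *v (u *v (inverse a *s v))"
      by (simp only: matrix_vector_mul_assoc)
    then show ?thesis
      using scalar_inv(1)[OF assms(1) a] unfolding b by (simp add: a mat_vec divide_inverse)
  qed
  then have "s = mat (b / a)" by (rule matrix_eqI)
  then show ?thesis by (auto simp: scalar_def)
qed

lemma \<rho>_monomial_outside:
  assumes "\<not> (\<exists>u\<in>W. G = {#u#})"
  shows "\<rho> (monomial (\<mu>, \<nu>, G)) = 0"
proof -
  have "grp_mset G = 0" using assms unfolding grp_mset_def by (simp only: if_False)
  then show ?thesis by (simp only: monomial.simps \<rho>_lprod \<rho>_zero mult_zero_right)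
qed

lemma \<rho>_ssc: "\<rho> (ssc a f) = osc a (\<rho> f)"
  by (simp add: \<rho>_def ssc_def tensor_op_simps op.scale_mult_left op.scale_sum_right)

lemma \<rho>_cong: "f \<doteq> g \<Longrightarrow> \<rho> f = \<rho> g"
  using \<rho>_vanishes_on_I[of "f - g"] by (simp add: cong_I_def \<rho>_minus)

lemma \<rho>_normal_form:
  assumes f: "f \<in> carrier S"
  shows "\<rho> f = (\<Sum>k\<in>Poly_Mapping.keys (ap (\<rho> f) unit_nf). osc (coef (ap (\<rho> f) unit_nf) k) (\<rho> (monomial k)))"
proof -
  have "\<rho> f = \<rho> (\<psi> (ap (\<rho> f) unit_nf))" by (rule \<rho>_cong[OF normal_form[OF f]])
  also have "\<dots> = (\<Sum>k\<in>Poly_Mapping.keys (ap (\<rho> f) unit_nf). osc (coef (ap (\<rho> f) unit_nf) k) (\<rho> (monomial k)))"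
    by (simp only: \<psi>_def ssc.lext_def \<rho>_sum \<rho>_ssc)
  finally show ?thesis .
qed

lemma dunkl_list_xfree: "xfree h \<Longrightarrow> ap (dunkl_list l) h = ymon l * h"
proof (induction l)
  case (Cons j l)
  then show ?case by (simp add: dunkl_xfree xfree_mult xfree_ymon vecN_simps mult.assoc)
qed simp

lemma \<rho>_monomial_unit:
  assumes "u \<in> W"
  shows "ap (\<rho> (monomial (\<mu>, \<nu>, {#u#}))) unit_nf = sgl (\<mu>, \<nu>, {#u#}) 1"
  using sgl_eq_mon[of "some_list \<mu>" "some_list \<nu>" u]
  by (simp add: \<rho>_monomial[OF assms] dunkl_list_xfree xfree_gN mset_some_list del: monomial.simps)

text \<open>The grades that occur in normal forms of elements of the algebra.\<close>

definition W_grades :: "(nat \<times> (complex ^ 'n ^ 'n) multiset) set" where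
  "W_grades = {(d, {#u#}) | d u. u \<in> W}"

lemma graded_W_grades:
  assumes f: "f \<in> carrier S"
  shows "graded W_grades (ap (\<rho> f) unit_nf)"
proof -
  define n where "n = ap (\<rho> f) unit_nf"
  have "n = (\<Sum>k\<in>Poly_Mapping.keys n. psc (coef n k) (ap (\<rho> (monomial k)) unit_nf))"
    using arg_cong[OF \<rho>_normal_form[OF f], of "\<lambda>A. ap A unit_nf"] by (simp add: n_def)
  moreover have "graded W_grades (ap (\<rho> (monomial k)) unit_nf)" for k
  proof (cases k)
    case k: (fields \<mu> \<nu> G)
    show ?thesis
    proof (cases "\<exists>u\<in>W. G = {#u#}")
      case True
      then show ?thesis by (auto simp: k \<rho>_monomial_unit W_grades_def simp del: monomial.simps intro!: graded_single)
    next
      case False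
      then show ?thesis by (simp add: k \<rho>_monomial_outside del: monomial.simps)
    qed
  qed
  ultimately have "graded W_grades n" by (metis (no_types, lifting) graded_psc graded_sum)
  then show ?thesis by (simp only: n_def)
qed

lemma \<rho>_eq_0: "f \<in> carrier S \<Longrightarrow> ap (\<rho> f) unit_nf = 0 \<Longrightarrow> \<rho> f = 0"
  using \<rho>_normal_form[of f] by simp

text \<open>Compare the parts of the commutators with \<open>x\<^sub>i y\<^sub>j\<close> that have \<open>m + 1\<close>, then \<open>m\<close>, letters \<open>y\<close>. The
  former kills the symbol at nonscalar group elements. At a scalar \<open>u\<^sub>0\<close> the latter then receives no
  corrections, since these would come from \<open>s\<^sup>-\<^sup>1 u\<^sub>0\<close>, which is not scalar; so the symbol is
  \<open>gl(n)\<close>-invariant there and vanishes with the coefficient singled out in \<open>top\<close>.\<close>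

theorem symbol_of_commuting:
  assumes t: "t \<noteq> 0" and f: "f \<in> carrier S"
    and comm: "\<And>i j. \<rho> f * (cov_op (axis i 1) * dunkl (axis j 1)) = cov_op (axis i 1) * dunkl (axis j 1) * \<rho> f"
    and le: "graded {(d, G). d \<le> m} (ap (\<rho> f) unit_nf)"
    and top: "\<And>u. u \<in> W \<Longrightarrow> scalar u \<Longrightarrow>
      coef (ap (\<rho> f) unit_nf) (replicate_mset m i0, replicate_mset m i0, {#u#}) = 0"
  shows "graded {(d, G). d < m} (ap (\<rho> f) unit_nf)"
proof -
  define n where "n = ap (\<rho> f) unit_nf"
  let ?K = "Poly_Mapping.keys n"
  have key: "\<exists>\<mu> \<nu> u. k = (\<mu>, \<nu>, {#u#}) \<and> u \<in> W \<and> size \<nu> \<le> m" if "k \<in> ?K" for k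
    using graded_W_grades[OF f] le that unfolding n_def[symmetric] graded_def W_grades_def
    by (cases k) fastforce
  have total: "(\<Sum>k\<in>?K. psc (coef n k) (defect i j k)) = 0" for i j
  proof -
    have "ap (dunkl (axis j 1)) unit_nf = yN j * unit_nf" by (simp add: dunkl_xfree xfree_gN vecN_simps)
    then have "ap (\<rho> f) (xN i * (yN j * unit_nf)) = xN i * ap (dunkl (axis j 1)) n"
      using arg_cong[OF comm[of i j], of "\<lambda>A. ap A unit_nf"] by (simp add: n_def covN_simps)
    moreover have "ap (\<rho> f) (xN i * (yN j * unit_nf)) = (\<Sum>k\<in>?K. psc (coef n k) (ap (\<rho> (monomial k)) (xN i * (yN j * unit_nf))))"
      using arg_cong[OF \<rho>_normal_form[OF f], of "\<lambda>A. ap A (xN i * (yN j * unit_nf))"] by (simp add: n_def)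
    moreover have "xN i * ap (dunkl (axis j 1)) n = (\<Sum>k\<in>?K. psc (coef n k) (xN i * ap (dunkl (axis j 1)) (sgl k 1)))"
      by (subst ap_expand) (simp add: sum_distrib_left pma.scale_mult_right)
    ultimately show ?thesis
      by (simp add: defect_def pm.scale_right_diff_distrib sum_subtractf)
  qed
  have comp_n: "component D n = (\<Sum>k\<in>?K. psc (coef n k) (if grade k \<in> D then sgl k 1 else 0))" for D
    by (simp add: component_def pm.lext_def)
  have nonscalar: "component {(m, {#u0#})} n = 0" if u0: "u0 \<in> W" "\<not> scalar u0" for u0
  proof -
    obtain i j where q: "symb u0 i j \<noteq> 0" using symb_nonscalar[OF u0(2)] by blast
    have cd: "component {(Suc m, {#u0#})} (defect i j k) = (if grade k \<in> {(m, {#u0#})} then sgl k 1 else 0) * symb u0 i j"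
      if k: "k \<in> ?K" for k
    proof -
      obtain \<mu> \<nu> u where kk: "k = (\<mu>, \<nu>, {#u#})" and u: "u \<in> W" and size: "size \<nu> \<le> m"
        using key[OF k] by blast
      let ?A = "sgl k 1 * symb u i j"
      let ?B = "dyv (dual_act u (axis i 1)) (sgl k 1) * vecN (u *v axis j 1) - xN i * dx j (sgl k 1)"
      obtain E where E: "graded (reflected (size \<nu>) {#u#}) E" and eq: "defect i j k = ?A + psc t ?B + E"
        using defect_expansion[OF u kk] by blast
      note A = graded_defect_parts(1)[OF kk, of i j] and B = graded_defect_parts(2)[OF kk]
      have "component {(Suc m, {#u0#})} (psc t ?B) = 0"
        by (rule component_eq_0[OF graded_psc[OF B]]) (use size in auto)
      moreover have "component {(Suc m, {#u0#})} E = 0"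
        by (rule component_eq_0[OF E]) (use size in \<open>auto simp: reflected_def\<close>)
      moreover have "component {(Suc m, {#u0#})} ?A = (if grade k \<in> {(m, {#u0#})} then sgl k 1 else 0) * symb u0 i j"
      proof (cases "grade k = (m, {#u0#})")
        case True
        then show ?thesis using component_eq[OF A] by (simp add: kk)
      next
        case False
        have "component {(Suc m, {#u0#})} ?A = 0"
          by (rule component_eq_0[OF A]) (use False in \<open>auto simp: kk\<close>)
        then show ?thesis using False by simp
      qed
      ultimately show ?thesis by (simp add: eq component_add)
    qed
    \<comment> \<open>Sum over the monomials of the normal form; only the leading parts at \<open>u0\<close> survive.\<close>
    have "0 = component {(Suc m, {#u0#})} (\<Sum>k\<in>?K. psc (coef n k) (defect i j k))" by (simp add: total)
    also have "\<dots> = (\<Sum>k\<in>?K. psc (coef n k) ((if grade k \<in> {(m, {#u0#})} then sgl k 1 else 0) * symb u0 i j))"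
      by (simp add: component_sum component_psc cd)
    also have "\<dots> = component {(m, {#u0#})} n * symb u0 i j"
      unfolding comp_n by (simp only: sum_distrib_right pma.scale_mult_left)
    finally have "component {(m, {#u0#})} n * symb u0 i j = 0" by simp
    then show ?thesis using graded_no_zero_divisors[OF graded_component graded_symb] q by blast
  qed
  have scalar: "component {(m, {#u0#})} n = 0" if u0: "u0 \<in> W" "scalar u0" for u0
  proof (rule gl_invariant_determined)
    show "graded {(m, {#u0#})} (component {(m, {#u0#})} n)" by (rule graded_component)
    show "coef (component {(m, {#u0#})} n) (replicate_mset m i0, replicate_mset m i0, {#u0#}) = 0"
      using top[OF u0] by (simp add: coef_component n_def)
    fix i j
    have cd: "component {(m, {#u0#})} (defect i j k)
        = psc t (yN j * dy i (if grade k \<in> {(m, {#u0#})} then sgl k 1 else 0) - xN i * dx j (if grade k \<in> {(m, {#u0#})} then sgl k 1 else 0))"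
      if k: "k \<in> ?K" for k
    proof -
      obtain \<mu> \<nu> u where kk: "k = (\<mu>, \<nu>, {#u#})" and u: "u \<in> W" and size: "size \<nu> \<le> m"
        using key[OF k] by blast
      let ?A = "sgl k 1 * symb u i j"
      let ?B = "dyv (dual_act u (axis i 1)) (sgl k 1) * vecN (u *v axis j 1) - xN i * dx j (sgl k 1)"
      obtain E where E: "graded (reflected (size \<nu>) {#u#}) E" and eq: "defect i j k = ?A + psc t ?B + E"
        using defect_expansion[OF u kk] by blast
      note A = graded_defect_parts(1)[OF kk, of i j] and B = graded_defect_parts(2)[OF kk]
      have cA: "component {(m, {#u0#})} ?A = 0"
      proof (cases "u = u0")
        case True
        then show ?thesis using symb_scalar(1)[OF u0] by simp
      next
        case False
        show ?thesis by (rule component_eq_0[OF A]) (use False in auto)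
      qed
      have cE: "component {(m, {#u0#})} E = 0"
      proof (rule component_eq_0[OF E])
        show "reflected (size \<nu>) {#u#} \<inter> {(m, {#u0#})} = {}"
        proof (rule ccontr)
          assume "reflected (size \<nu>) {#u#} \<inter> {(m, {#u0#})} \<noteq> {}"
          \<comment> \<open>A correction landing at \<open>u0\<close> starts at a nonscalar \<open>u\<close>, where the symbol is already known to vanish.\<close>
          then obtain s where s: "s \<in> R" "u0 = s ** u" "size \<nu> = m" using size by (auto simp: reflected_def)
          have "\<not> scalar u"
            using scalar_cancel[OF u, of s] reflection_not_scalar[OF s(1)] u0(2) s(2) by blast
          then have "coef (component {(m, {#u#})} n) k = 0" using nonscalar[OF u] by simp
          then show False using k s(3) by (simp add: coef_component kk in_keys_iff)
        qed
      qed
      show ?thesis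
      proof (cases "grade k = (m, {#u0#})")
        case True
        then have "u = u0" "size \<nu> = m" by (auto simp: kk)
        moreover have "?B = yN j * dy i (sgl k 1) - xN i * dx j (sgl k 1)"
          using symb_scalar(2)[OF u0] \<open>u = u0\<close> by simp
        moreover have "component {(m, {#u0#})} ?B = ?B"
          by (rule component_eq) (use B \<open>u = u0\<close> \<open>size \<nu> = m\<close> in simp)
        ultimately show ?thesis using True cA cE by (simp add: eq component_add component_psc)
      next
        case False
        have "component {(m, {#u0#})} ?B = 0" by (rule component_eq_0[OF B]) (use False in \<open>auto simp: kk\<close>)
        then show ?thesis using False by (simp add: eq component_add cA cE component_psc d_linear)
      qed
    qed
    have dsum: "dy i (sum g A) = (\<Sum>k\<in>A. dy i (g k))" "dx j (sum g A) = (\<Sum>k\<in>A. dx j (g k))" for g :: "_ \<Rightarrow> 'n nf" and A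
      by (induction A rule: infinite_finite_induct) (simp_all add: d_linear)
    have "0 = component {(m, {#u0#})} (\<Sum>k\<in>?K. psc (coef n k) (defect i j k))" by (simp add: total)
    also have "\<dots> = (\<Sum>k\<in>?K. psc (coef n k) (psc t (yN j * dy i (if grade k \<in> {(m, {#u0#})} then sgl k 1 else 0)
        - xN i * dx j (if grade k \<in> {(m, {#u0#})} then sgl k 1 else 0))))"
      by (simp only: component_sum component_psc cd cong: sum.cong)
    also have "\<dots> = psc t (yN j * dy i (component {(m, {#u0#})} n) - xN i * dx j (component {(m, {#u0#})} n))"
    proof -
      have "psc a (psc t z) = psc t (psc a z)" for a and z :: "'n nf" by (simp add: mult.commute)
      then show ?thesis
        unfolding comp_n
        by (simp only: dsum d_linear sum_distrib_left pma.scale_mult_right pm.scale_right_diff_distrib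
            sum_subtractf[symmetric] pm.scale_sum_right)
    qed
    finally have "psc (inverse t) (psc t (yN j * dy i (component {(m, {#u0#})} n) - xN i * dx j (component {(m, {#u0#})} n))) = 0"
      by (simp only: pm.scale_zero_right)
    then have "yN j * dy i (component {(m, {#u0#})} n) - xN i * dx j (component {(m, {#u0#})} n) = 0"
      using t by (simp only: pm.scale_scale left_inverse pm.scale_one simp_thms)
    then show "yN j * dy i (component {(m, {#u0#})} n) = xN i * dx j (component {(m, {#u0#})} n)" by simp
  qed
  show ?thesis
    unfolding n_def[symmetric] graded_def
  proof
    fix k assume k: "k \<in> ?K"
    obtain \<mu> \<nu> u where kk: "k = (\<mu>, \<nu>, {#u#})" and u: "u \<in> W" and size: "size \<nu> \<le> m"
      using key[OF k] by blast
    have "size \<nu> \<noteq> m"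
    proof
      assume "size \<nu> = m"
      moreover have "component {(m, {#u#})} n = 0" using scalar nonscalar u by blast
      then have "coef (component {(m, {#u#})} n) k = 0" by simp
      ultimately show False using k by (simp add: coef_component kk in_keys_iff)
    qed
    then show "grade k \<in> {(d, G). d < m}" using size by (simp add: kk)
  qed
qed

end

section \<open>The Euler element\<close>

context reflection_algebra
begin

definition euler_op :: "'n nf_op" where
  "euler_op = (\<Sum>i\<in>UNIV. cov_op (axis i 1) * dunkl (axis i 1)) - (\<Sum>s\<in>R. osc (2 * c s / (1 - lam s)) (grp_op s))"

text \<open>The element \<open>\<Sum>\<^sub>i \<xi>\<^sub>i \<otimes> v\<^sub>i\<close> depends only on the tensor, which for dual bases is the identity.\<close>

lemma canonical_element:
  assumes "\<And>k l. (\<Sum>i\<in>A. \<xi> i $ k * v i $ l) = (if k = l then 1 else 0)"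
  shows "(\<Sum>i\<in>A. cov_op (\<xi> i) * dunkl (v i)) = (\<Sum>k\<in>UNIV. cov_op (axis k 1) * dunkl (axis k 1))"
proof -
  have "(\<Sum>i\<in>A. cov_op (\<xi> i) * dunkl (v i))
      = (\<Sum>i\<in>A. \<Sum>k\<in>UNIV. \<Sum>l\<in>UNIV. osc (\<xi> i $ k * v i $ l) (cov_op (axis k 1) * dunkl (axis l 1)))"
    by (subst cov_op_expand, subst dunkl_expand)
      (simp add: sum_product op.scale_mult_left op.scale_mult_right mult.commute[of "v _ $ _"])
  also have "\<dots> = (\<Sum>k\<in>UNIV. \<Sum>i\<in>A. \<Sum>l\<in>UNIV. osc (\<xi> i $ k * v i $ l) (cov_op (axis k 1) * dunkl (axis l 1)))"
    by (rule sum.swap)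
  also have "\<dots> = (\<Sum>k\<in>UNIV. \<Sum>l\<in>UNIV. \<Sum>i\<in>A. osc (\<xi> i $ k * v i $ l) (cov_op (axis k 1) * dunkl (axis l 1)))"
    by (rule sum.cong[OF refl], rule sum.swap)
  also have "\<dots> = (\<Sum>k\<in>UNIV. \<Sum>l\<in>UNIV. osc (if k = l then 1 else 0) (cov_op (axis k 1) * dunkl (axis l 1)))"
    by (simp add: op.scale_sum_left[symmetric] assms)
  also have "\<dots> = (\<Sum>k\<in>UNIV. cov_op (axis k 1) * dunkl (axis k 1))"
  proof (rule sum.cong[OF refl])
    fix k :: 'n
    have "osc (if k = l then 1 else 0) (cov_op (axis k 1) * dunkl (axis l 1))
        = (if l = k then cov_op (axis k 1) * dunkl (axis k 1) else 0)" for l by simp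
    then show "(\<Sum>l\<in>UNIV. osc (if k = l then 1 else 0) (cov_op (axis k 1) * dunkl (axis l 1))) = cov_op (axis k 1) * dunkl (axis k 1)"
      by simp
  qed
  finally show ?thesis .
qed

text \<open>The reflection terms of \<open>\<Sum>\<^sub>i x\<^sub>i [y\<^sub>i, \<xi>]\<close> are cancelled by \<open>[s, \<xi>] = (s \<xi> - \<xi>) s\<close>; this is what the
  coefficients \<open>2 c\<^sub>s / (1 - \<lambda>\<^sub>s)\<close> are made for.\<close>

lemma euler_op_cov_op: "euler_op * cov_op \<xi> = cov_op \<xi> * euler_op + osc t (cov_op \<xi>)"
proof -
  let ?g = "\<lambda>s. osc (2 * c s / root_pairing s * pairing \<xi> (\<alpha>v s)) (cov_op (\<alpha> s) * grp_op s)"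
  have 1: "(\<Sum>i\<in>UNIV. cov_op (axis i 1) * yx_op \<xi> (axis i 1)) = osc t (cov_op \<xi>) - (\<Sum>s\<in>R. ?g s)"
  proof -
    have "(\<Sum>i\<in>UNIV. osc (refl_coef s \<xi> (axis i 1)) (cov_op (axis i 1) * grp_op s)) = ?g s" for s
      by (subst (2) cov_op_expand)
        (simp add: refl_coef_def sum_distrib_right op.scale_sum_right op.scale_mult_left mult.assoc)
    then have "(\<Sum>i\<in>UNIV. \<Sum>s\<in>R. osc (refl_coef s \<xi> (axis i 1)) (cov_op (axis i 1) * grp_op s)) = (\<Sum>s\<in>R. ?g s)"
      by (subst sum.swap) simp
    moreover have "(\<Sum>i\<in>UNIV. osc (t * \<xi> $ i) (cov_op (axis i 1))) = osc t (cov_op \<xi>)"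
      by (subst (2) cov_op_expand) (simp add: op.scale_sum_right)
    ultimately show ?thesis
      by (simp add: yx_op_def right_diff_distrib sum_subtractf sum_distrib_left op.scale_mult_right)
  qed
  have 2: "osc (2 * c s / (1 - lam s)) (grp_op s * cov_op \<xi>)
      = osc (2 * c s / (1 - lam s)) (cov_op \<xi> * grp_op s) - ?g s" if "s \<in> R" for s
  proof -
    have "cov_op (dual_act s \<xi>) = cov_op \<xi> - osc ((1 - lam s) * pairing \<xi> (\<alpha>v s) / root_pairing s) (cov_op (\<alpha> s))"
      by (simp only: refl_dual[OF that] cov_op_diff)
    moreover have "2 * c s / (1 - lam s) * ((1 - lam s) * pairing \<xi> (\<alpha>v s) / root_pairing s) = 2 * c s / root_pairing s * pairing \<xi> (\<alpha>v s)"
      using lam_neq(1)[OF that] by simp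
    ultimately show ?thesis
      by (simp add: grp_op_cov_op left_diff_distrib op.scale_right_diff_distrib op.scale_mult_left)
  qed
  have "(\<Sum>s\<in>R. osc (2 * c s / (1 - lam s)) (grp_op s * cov_op \<xi>))
      = (\<Sum>s\<in>R. osc (2 * c s / (1 - lam s)) (cov_op \<xi> * grp_op s)) - (\<Sum>s\<in>R. ?g s)"
    by (simp only: 2 sum_subtractf[symmetric] cong: sum.cong)
  moreover have "(\<Sum>i\<in>UNIV. cov_op (axis i 1) * (dunkl (axis i 1) * cov_op \<xi>))
      = (\<Sum>i\<in>UNIV. cov_op \<xi> * (cov_op (axis i 1) * dunkl (axis i 1))) + (osc t (cov_op \<xi>) - (\<Sum>s\<in>R. ?g s))"
    unfolding 1[symmetric] sum.distrib[symmetric]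
    by (rule sum.cong) (simp_all add: dunkl_cov_op distrib_left cov_op_commute[of "axis _ 1" \<xi>] flip: mult.assoc)
  ultimately show ?thesis
    by (simp add: euler_op_def left_diff_distrib right_diff_distrib sum_distrib_left sum_distrib_right
        op.scale_mult_left op.scale_mult_right mult.assoc)
qed

lemma euler_op_dunkl: "euler_op * dunkl v = dunkl v * euler_op - osc t (dunkl v)"
proof -
  let ?g = "\<lambda>s. osc (2 * c s / root_pairing s * pairing (\<alpha> s) v) (grp_op s * dunkl (\<alpha>v s))"
  have 1: "(\<Sum>i\<in>UNIV. yx_op (axis i 1) v * dunkl (axis i 1)) = osc t (dunkl v) - (\<Sum>s\<in>R. ?g s)"
  proof -
    have "(\<Sum>i\<in>UNIV. osc (refl_coef s (axis i 1) v) (grp_op s * dunkl (axis i 1))) = ?g s" for s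
      by (subst (2) dunkl_expand)
        (simp add: refl_coef_def sum_distrib_left op.scale_sum_right op.scale_mult_right mult_ac)
    then have "(\<Sum>i\<in>UNIV. \<Sum>s\<in>R. osc (refl_coef s (axis i 1) v) (grp_op s * dunkl (axis i 1))) = (\<Sum>s\<in>R. ?g s)"
      by (subst sum.swap) simp
    moreover have "(\<Sum>i\<in>UNIV. osc (t * v $ i) (dunkl (axis i 1))) = osc t (dunkl v)"
      by (subst (2) dunkl_expand) (simp add: op.scale_sum_right)
    ultimately show ?thesis
      by (simp add: yx_op_def left_diff_distrib sum_subtractf sum_distrib_right op.scale_mult_left)
  qed
  have 2: "osc (2 * c s / (1 - lam s)) (grp_op s * dunkl v)
      = osc (2 * c s / (1 - lam s)) (dunkl v * grp_op s) + ?g s" if "s \<in> R" for s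
  proof -
    have sW: "s \<in> W" using that R_subset by blast
    have "dunkl (matrix_inv s *v v) = dunkl v - osc ((1 - lam s) * pairing (\<alpha> s) v / root_pairing s) (dunkl (\<alpha>v s))"
      by (simp only: refl_inv_vec[OF that] dunkl_diff)
    moreover have "dunkl v * grp_op s = grp_op s * dunkl (matrix_inv s *v v)"
      using grp_op_dunkl[OF sW, of "matrix_inv s *v v"] sW by simp
    moreover have "2 * c s / (1 - lam s) * ((1 - lam s) * pairing (\<alpha> s) v / root_pairing s) = 2 * c s / root_pairing s * pairing (\<alpha> s) v"
      using lam_neq(1)[OF that] by simp
    ultimately show ?thesis
      using lam_neq(1)[OF that]
      by (simp add: right_diff_distrib op.scale_right_diff_distrib op.scale_mult_right mult.assoc)
  qed
  have "(\<Sum>s\<in>R. osc (2 * c s / (1 - lam s)) (grp_op s * dunkl v))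
      = (\<Sum>s\<in>R. osc (2 * c s / (1 - lam s)) (dunkl v * grp_op s)) + (\<Sum>s\<in>R. ?g s)"
    by (simp only: 2 sum.distrib[symmetric] cong: sum.cong)
  moreover have "(\<Sum>i\<in>UNIV. cov_op (axis i 1) * (dunkl (axis i 1) * dunkl v))
      = (\<Sum>i\<in>UNIV. dunkl v * (cov_op (axis i 1) * dunkl (axis i 1))) - (osc t (dunkl v) - (\<Sum>s\<in>R. ?g s))"
    unfolding 1[symmetric] sum_subtractf[symmetric]
  proof (rule sum.cong[OF refl])
    fix i
    have "dunkl v * (cov_op (axis i 1) * dunkl (axis i 1))
        = cov_op (axis i 1) * (dunkl v * dunkl (axis i 1)) + yx_op (axis i 1) v * dunkl (axis i 1)"
      by (simp add: dunkl_cov_op distrib_right flip: mult.assoc)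
    then show "cov_op (axis i 1) * (dunkl (axis i 1) * dunkl v)
        = dunkl v * (cov_op (axis i 1) * dunkl (axis i 1)) - yx_op (axis i 1) v * dunkl (axis i 1)"
      by (simp add: dunkl_commute[of v])
  qed
  ultimately show ?thesis
    by (simp add: euler_op_def left_diff_distrib right_diff_distrib sum_distrib_left sum_distrib_right
        op.scale_mult_left op.scale_mult_right mult.assoc)
qed

lemma euler_op_XY: "euler_op * (cov_op \<xi> * dunkl v) = cov_op \<xi> * dunkl v * euler_op"
proof -
  have "euler_op * (cov_op \<xi> * dunkl v) = cov_op \<xi> * (euler_op * dunkl v) + osc t (cov_op \<xi> * dunkl v)"
    by (simp add: euler_op_cov_op distrib_right op.scale_mult_left flip: mult.assoc)
  then show ?thesis by (simp add: euler_op_dunkl right_diff_distrib op.scale_mult_right mult.assoc)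
qed

text \<open>The canonical element is invariant, and the coefficients of the reflections are class functions.\<close>

lemma euler_op_grp_op:
  assumes w: "w \<in> W"
  shows "euler_op * grp_op w = grp_op w * euler_op"
proof -
  have "(\<Sum>i\<in>UNIV. dual_act w (axis i 1) $ k * (w *v axis i 1) $ l) = (if k = l then 1 else 0)" for k l
  proof -
    have "dual_act w (axis i 1) $ k = matrix_inv w $ i $ k" for i
      by (simp add: dual_act_def vector_matrix_mult_def axis_def if_distrib[of "(*) _"] if_distrib[of "\<lambda>x. x * _"] cong: if_cong)
    moreover have "(w *v axis i 1) $ l = w $ l $ i" for i
      by (simp add: matrix_vector_mult_def axis_def if_distrib[of "(*) _"] cong: if_cong)
    moreover have "(w ** matrix_inv w) $ l $ k = (if k = l then 1 else 0)"
      using w by (simp add: W_inv_mult mat_def)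
    ultimately show ?thesis by (simp add: matrix_matrix_mult_def mult.commute)
  qed
  then have "(\<Sum>i\<in>UNIV. cov_op (dual_act w (axis i 1)) * dunkl (w *v axis i 1)) = (\<Sum>k\<in>UNIV. cov_op (axis k 1) * dunkl (axis k 1))"
    by (rule canonical_element)
  moreover have "grp_op w * (cov_op (axis i 1) * dunkl (axis i 1)) = cov_op (dual_act w (axis i 1)) * dunkl (w *v axis i 1) * grp_op w" for i
  proof -
    have "grp_op w * (cov_op (axis i 1) * dunkl (axis i 1)) = cov_op (dual_act w (axis i 1)) * (grp_op w * dunkl (axis i 1))"
      by (simp only: grp_op_cov_op mult.assoc[symmetric])
    then show ?thesis by (simp only: grp_op_dunkl[OF w] mult.assoc)
  qed
  then have "grp_op w * (\<Sum>i\<in>UNIV. cov_op (axis i 1) * dunkl (axis i 1))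
      = (\<Sum>i\<in>UNIV. cov_op (dual_act w (axis i 1)) * dunkl (w *v axis i 1)) * grp_op w"
    by (simp add: sum_distrib_left sum_distrib_right)
  moreover have "grp_op w * (\<Sum>s\<in>R. osc (2 * c s / (1 - lam s)) (grp_op s)) = (\<Sum>s\<in>R. osc (2 * c s / (1 - lam s)) (grp_op s)) * grp_op w"
  proof -
    have "osc (2 * c s / (1 - lam s)) (grp_op w * grp_op s)
        = osc (2 * c (w ** s ** matrix_inv w) / (1 - lam (w ** s ** matrix_inv w))) (grp_op (w ** s ** matrix_inv w) * grp_op w)" if s: "s \<in> R" for s
    proof -
      have sW: "s \<in> W" using s R_subset by blast
      have "grp_op w * grp_op s = grp_op (w ** s ** matrix_inv w) * grp_op w"
        using conj_matrix(1)[OF w sW] W_invertible[OF w] W_invertible[OF sW]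
          W_invertible[OF W_mult[OF W_mult[OF w sW] W_inv[OF w]]]
        by (simp add: grp_op_mult)
      moreover have "c (w ** s ** matrix_inv w) = c s" using conj w s by (simp add: conj_invariant_def)
      ultimately show ?thesis by (simp add: lam_conj[OF w s])
    qed
    then have "(\<Sum>s\<in>R. osc (2 * c s / (1 - lam s)) (grp_op w * grp_op s))
        = (\<Sum>s\<in>R. osc (2 * c (w ** s ** matrix_inv w) / (1 - lam (w ** s ** matrix_inv w))) (grp_op (w ** s ** matrix_inv w) * grp_op w))"
      by (intro sum.cong refl)
    also have "\<dots> = (\<Sum>s\<in>R. osc (2 * c s / (1 - lam s)) (grp_op s * grp_op w))"
      by (rule sum_reflections_conj[OF w, of "\<lambda>s. osc (2 * c s / (1 - lam s)) (grp_op s * grp_op w)"])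
    finally show ?thesis by (simp add: sum_distrib_left sum_distrib_right op.scale_mult_left op.scale_mult_right)
  qed
  ultimately show ?thesis by (simp add: euler_op_def left_diff_distrib right_diff_distrib)
qed

lemma dunkl_top:
  assumes n: "graded {(d, G). d \<le> m} n"
  shows "graded {(d, G). d \<le> m} (ap (dunkl (axis j 1)) n - yN j * n)"
proof -
  have "graded {(d, G). d \<le> m} (ap (dunkl (axis j 1)) (sgl k 1) - yN j * sgl k 1)"
    if k: "k \<in> Poly_Mapping.keys n" for k
  proof -
    obtain \<mu> \<nu> G where kk: "k = (\<mu>, \<nu>, G)" by (cases k)
    have size: "size \<nu> \<le> m" using n k by (auto simp: graded_def kk)
    define h where "h = (sgl ({#}, \<nu>, G) 1 :: 'n nf)"
    have h: "xfree h" "graded {(size \<nu>, G)} h"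
      unfolding h_def by (auto intro: xfree_single graded_single)
    have kh: "sgl k 1 = xmon (some_list \<mu>) * h"
      by (simp add: kk h_def xmon_def mult_single add_Pair mset_some_list)
    obtain E where E: "graded (reflected (size \<nu>) G) E"
      and eq: "ap (dunkl (axis j 1)) (xmon (some_list \<mu>) * h) = xmon (some_list \<mu>) * (yN j * h) + psc t (dx j (xmon (some_list \<mu>)) * h) + E"
      using dunkl_xmon[OF h] by blast
    have "ap (dunkl (axis j 1)) (sgl k 1) - yN j * sgl k 1 = psc t (dx j (xmon (some_list \<mu>)) * h) + E"
      unfolding kh eq by (simp add: mult.left_commute[of "yN j"])
    moreover have "graded {(d, G). d \<le> m} (psc t (dx j (xmon (some_list \<mu>)) * h))"
      by (intro graded_psc graded_mult[OF graded_dx[OF graded_mons(1)] h(2)]) (use size in auto)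
    moreover have "graded {(d, G). d \<le> m} E"
      by (rule graded_mono[OF E]) (use size in \<open>auto simp: reflected_def\<close>)
    ultimately show ?thesis by (simp add: graded_add)
  qed
  then have "graded {(d, G). d \<le> m}
      (\<Sum>k\<in>Poly_Mapping.keys n. psc (coef n k) (ap (dunkl (axis j 1)) (sgl k 1) - yN j * sgl k 1))"
    by (intro graded_sum graded_psc)
  moreover have "yN j * n = (\<Sum>k\<in>Poly_Mapping.keys n. psc (coef n k) (yN j * sgl k 1))"
    by (subst poly_mapping_sum_single[of n]) (simp add: sum_distrib_left pma.scale_mult_right[symmetric])
  then have "ap (dunkl (axis j 1)) n - yN j * n
      = (\<Sum>k\<in>Poly_Mapping.keys n. psc (coef n k) (ap (dunkl (axis j 1)) (sgl k 1) - yN j * sgl k 1))"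
    by (subst ap_expand) (simp only: pm.scale_right_diff_distrib sum_subtractf)
  ultimately show ?thesis by simp
qed

lemma coef_graded_0: "graded D n \<Longrightarrow> grade k \<notin> D \<Longrightarrow> coef n k = 0"
  by (auto simp: graded_def in_keys_iff)

text \<open>Up to terms with at most \<open>m\<close> letters \<open>y\<close>, the Euler operator multiplies by \<open>\<Sum>\<^sub>j x\<^sub>j y\<^sub>j\<close>. A pure power of the
  letter \<open>i0\<close> can only arise from the summand \<open>j = i0\<close>.\<close>

lemma euler_op_top:
  assumes n: "graded {(d, G). d \<le> m} n"
  shows "graded {(d, G). d \<le> Suc m} (ap euler_op n)"
    and "coef (ap euler_op n) (replicate_mset (Suc m) i0, replicate_mset (Suc m) i0, G)
      = coef n (replicate_mset m i0, replicate_mset m i0, G)"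
proof -
  define r where "r j = ap (dunkl (axis j 1)) n - yN j * n" for j
  define F where "F = (\<Sum>s\<in>R. psc (2 * c s / (1 - lam s)) (ap (grp_op s) n))"
  define L where "L = (\<Sum>j\<in>UNIV. xN j * r j) - F"
  have r: "graded {(d, G). d \<le> m} (xN j * r j)" for j
    using graded_mult[OF graded_gens(4) dunkl_top[OF n], where D'' = "{(d, G). d \<le> m}"] unfolding r_def by auto
  have "graded {(d, G). d \<le> m} F"
    unfolding F_def by (intro graded_sum graded_psc graded_grp_op[OF n]) auto
  then have L: "graded {(d, G). d \<le> m} L"
    unfolding L_def by (intro graded_minus graded_sum r)
  have "ap euler_op n = (\<Sum>j\<in>UNIV. xN j * ap (dunkl (axis j 1)) n) - F"
    by (simp add: euler_op_def F_def covN_simps)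
  also have "\<dots> = (\<Sum>j\<in>UNIV. xN j * (yN j * n)) + L"
    by (simp add: L_def r_def right_diff_distrib sum_subtractf)
  finally have eq: "ap euler_op n = (\<Sum>j\<in>UNIV. xN j * (yN j * n)) + L" .
  have "graded {(d, G). d \<le> Suc m} (xN j * (yN j * n))" for j
  proof (rule graded_mult[OF graded_gens(4)])
    show "graded {(d, G). d \<le> Suc m} (yN j * n)"
      by (rule graded_mult[OF graded_gens(5) n]) auto
  qed auto
  then show "graded {(d, G). d \<le> Suc m} (ap euler_op n)"
    unfolding eq by (intro graded_add graded_sum graded_mono[OF L]) auto
  let ?k = "(replicate_mset (Suc m) i0, replicate_mset (Suc m) i0, G)"
  have "coef L ?k = 0" by (rule coef_graded_0[OF L]) simp
  moreover have "coef (xN j * (yN j * n)) ?k = (if j = i0 then coef n (replicate_mset m i0, replicate_mset m i0, G) else 0)" for j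
    unfolding coef_x coef_y by (auto split: if_splits)
  ultimately show "coef (ap euler_op n) ?k = coef n (replicate_mset m i0, replicate_mset m i0, G)"
    by (simp add: eq lookup_add lookup_sum)
qed

lemma euler_op_power_top:
  "graded {(d, G). d \<le> m} (ap (euler_op ^ m) (gN w))"
  "coef (ap (euler_op ^ m) (gN w)) (replicate_mset m i0, replicate_mset m i0, {#u#}) = (if u = w then 1 else 0)"
proof -
  have "graded {(d, G). d \<le> m} (ap (euler_op ^ m) (gN w)) \<and>
    coef (ap (euler_op ^ m) (gN w)) (replicate_mset m i0, replicate_mset m i0, {#u#}) = (if u = w then 1 else 0)"
  proof (induction m)
    case 0
    have "graded {(d, G). d \<le> 0} (gN w)" by (rule graded_mono[OF graded_gens(3)]) auto
    then show ?case by (simp add: gN_def lookup_single when_def)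
  next
    case (Suc m)
    then show ?case using euler_op_top(1)[of m "ap (euler_op ^ m) (gN w)"] euler_op_top(2)[of m "ap (euler_op ^ m) (gN w)" i0 "{#u#}"] by simp
  qed
  then show "graded {(d, G). d \<le> m} (ap (euler_op ^ m) (gN w))"
    "coef (ap (euler_op ^ m) (gN w)) (replicate_mset m i0, replicate_mset m i0, {#u#}) = (if u = w then 1 else 0)"
    by auto
qed

definition scalars_W :: "(complex ^ 'n ^ 'n) set" where "scalars_W = {w \<in> W. scalar w}"

lemma finite_scalars_W: "finite scalars_W"
  by (simp add: scalars_W_def finite_W)

definition euler_poly :: "complex poly \<Rightarrow> 'n nf_op" where
  "euler_poly p = (\<Sum>k\<le>Polynomial.degree p. osc (Polynomial.coeff p k) (euler_op ^ k))"

lemma euler_poly_bound: "Polynomial.degree p \<le> N \<Longrightarrow> euler_poly p = (\<Sum>k\<le>N. osc (Polynomial.coeff p k) (euler_op ^ k))"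
  unfolding euler_poly_def by (rule sum.mono_neutral_left) (auto simp: coeff_eq_0)

lemma euler_poly_add: "euler_poly (p + q) = euler_poly p + euler_poly q"
  using euler_poly_bound[of p "max (Polynomial.degree p) (Polynomial.degree q)"]
    euler_poly_bound[of q "max (Polynomial.degree p) (Polynomial.degree q)"]
    euler_poly_bound[of "p + q" "max (Polynomial.degree p) (Polynomial.degree q)"] degree_add_le_max[of p q]
  by (simp add: op.scale_left_distrib sum.distrib)

lemma euler_poly_monom: "euler_poly (Polynomial.monom a m) = osc a (euler_op ^ m)"
proof -
  have "euler_poly (Polynomial.monom a m) = (\<Sum>k\<le>m. if k = m then osc a (euler_op ^ m) else 0)"
    unfolding euler_poly_bound[OF degree_monom_le[of a m]] by (rule sum.cong) auto
  then show ?thesis by simp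
qed

text \<open>The multiplication map, in terms of operators.\<close>

definition tensor_eval :: "(complex ^ 'n ^ 'n \<Rightarrow> complex poly) \<Rightarrow> 'n nf_op" where
  "tensor_eval f = (\<Sum>w\<in>scalars_W. euler_poly (f w) * grp_op w)"

lemma tensor_eval_add: "tensor_eval (\<lambda>w. f w + g w) = tensor_eval f + tensor_eval g"
  by (simp add: tensor_eval_def euler_poly_add distrib_right sum.distrib)

text \<open>By descending induction on the degree: if all degrees are at most \<open>M\<close>, the coefficient at \<open>x\<^sub>i\<^sup>M y\<^sub>i\<^sup>M u\<close>
  of the normal form is the coefficient of degree \<open>M\<close> of \<open>f u\<close>.\<close>

lemma tensor_eval_inj:
  assumes "tensor_eval f = 0" "w \<in> scalars_W"
  shows "f w = 0"
proof -
  have claim: "\<forall>w\<in>scalars_W. f w = 0" if "\<forall>w\<in>scalars_W. \<forall>k\<ge>M. Polynomial.coeff (f w) k = 0" for M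
    using that
  proof (induction M)
    case 0
    then show ?case by (simp add: poly_eq_iff)
  next
    case (Suc M)
    have "Polynomial.coeff (f u) M = 0" if u: "u \<in> scalars_W" for u
    proof -
      let ?k = "(replicate_mset M undefined, replicate_mset M undefined, {#u#})"
      have "0 = coef (ap (tensor_eval f) unit_nf) ?k" using assms(1) by simp
      also have "\<dots> = (\<Sum>w\<in>scalars_W. \<Sum>k\<le>M. Polynomial.coeff (f w) k * coef (ap (euler_op ^ k) (gN w)) ?k)"
      proof -
        have "euler_poly (f w) = (\<Sum>k\<le>M. osc (Polynomial.coeff (f w) k) (euler_op ^ k))" if "w \<in> scalars_W" for w
          by (rule euler_poly_bound) (use Suc.prems that in \<open>auto intro!: degree_le\<close>)
        then show ?thesis by (simp add: tensor_eval_def lookup_sum)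
      qed
      also have "\<dots> = (\<Sum>w\<in>scalars_W. \<Sum>k\<le>M. if w = u \<and> k = M then Polynomial.coeff (f u) M else 0)"
      proof (intro sum.cong refl)
        fix w k assume "k \<in> {..M}"
        then consider "k = M" | "k < M" by force
        then show "Polynomial.coeff (f w) k * coef (ap (euler_op ^ k) (gN w)) ?k
            = (if w = u \<and> k = M then Polynomial.coeff (f u) M else 0)"
        proof cases
          case 1
          then show ?thesis by (auto simp: euler_op_power_top(2))
        next
          case 2
          have "coef (ap (euler_op ^ k) (gN w)) ?k = 0"
            by (rule coef_graded_0[OF euler_op_power_top(1)]) (use 2 in simp)
          then show ?thesis using 2 by simp
        qed
      qed
      also have "\<dots> = (\<Sum>w\<in>scalars_W. if w = u then Polynomial.coeff (f u) M else 0)"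
        by (rule sum.cong) auto
      also have "\<dots> = Polynomial.coeff (f u) M" using u finite_scalars_W by simp
      finally show ?thesis by simp
    qed
    then have "\<forall>w\<in>scalars_W. \<forall>k\<ge>M. Polynomial.coeff (f w) k = 0"
      using Suc.prems by (metis Suc_leI le_neq_implies_less)
    then show ?case by (rule Suc.IH)
  qed
  have "\<forall>w\<in>scalars_W. \<forall>k\<ge>(Suc (Max ((\<lambda>w. Polynomial.degree (f w)) ` scalars_W))). Polynomial.coeff (f w) k = 0"
  proof (intro ballI allI impI)
    fix w k assume w: "w \<in> scalars_W" and k: "Suc (Max ((\<lambda>w. Polynomial.degree (f w)) ` scalars_W)) \<le> k"
    have "Polynomial.degree (f w) \<le> Max ((\<lambda>w. Polynomial.degree (f w)) ` scalars_W)"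
      by (rule Max_ge) (use w finite_scalars_W in auto)
    then show "Polynomial.coeff (f w) k = 0" using k by (intro coeff_eq_0) simp
  qed
  from claim[OF this] show ?thesis using assms(2) by blast
qed

subsection \<open>The operators in the image\<close>

definition op_image :: "'n nf_op set" where "op_image = \<rho> ` carrier S"

lemma op_image_add: "A \<in> op_image \<Longrightarrow> B \<in> op_image \<Longrightarrow> A + B \<in> op_image"
  and op_image_minus: "A \<in> op_image \<Longrightarrow> B \<in> op_image \<Longrightarrow> A - B \<in> op_image"
  and op_image_mult: "A \<in> op_image \<Longrightarrow> B \<in> op_image \<Longrightarrow> A * B \<in> op_image"
  and op_image_osc: "A \<in> op_image \<Longrightarrow> osc a A \<in> op_image"
  and op_image_gens: "0 \<in> op_image" "1 \<in> op_image" "cov_op \<xi> \<in> op_image" "dunkl v \<in> op_image" "w \<in> W \<Longrightarrow> grp_op w \<in> op_image"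
proof -
  show "A \<in> op_image \<Longrightarrow> B \<in> op_image \<Longrightarrow> A + B \<in> op_image" "A \<in> op_image \<Longrightarrow> B \<in> op_image \<Longrightarrow> A - B \<in> op_image"
    "A \<in> op_image \<Longrightarrow> B \<in> op_image \<Longrightarrow> A * B \<in> op_image" "A \<in> op_image \<Longrightarrow> osc a A \<in> op_image"
    unfolding op_image_def
    by (auto simp only: \<rho>_add[symmetric] \<rho>_minus[symmetric] \<rho>_mult[symmetric] \<rho>_ssc[symmetric]
        intro!: imageI smash_carrier_closed smash_mult_closed ssc_carrier)
  show "0 \<in> op_image" unfolding op_image_def by (rule image_eqI[of _ _ 0]) (simp_all add: smash_carrier_closed del: zero_fun_apply)
  show "1 \<in> op_image" unfolding op_image_def by (rule image_eqI[of _ _ "\<one>\<^bsub>S\<^esub>"]) simp_all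
  show "cov_op \<xi> \<in> op_image" unfolding op_image_def by (rule image_eqI[of _ _ "cov_A \<xi>"]) simp_all
  show "dunkl v \<in> op_image" unfolding op_image_def by (rule image_eqI[of _ _ "vec_A v"]) simp_all
  show "w \<in> W \<Longrightarrow> grp_op w \<in> op_image" unfolding op_image_def by (rule image_eqI[of _ _ "grp_A w"]) simp_all
qed

lemma op_image_sum: "(\<And>i. i \<in> A \<Longrightarrow> f i \<in> op_image) \<Longrightarrow> sum f A \<in> op_image"
  by (induction A rule: infinite_finite_induct) (auto intro: op_image_add op_image_gens)

lemma op_image_euler: "euler_op \<in> op_image"
  unfolding euler_op_def using R_subset by (intro op_image_minus op_image_sum op_image_mult op_image_osc op_image_gens) blast

lemma op_image_euler_power: "euler_op ^ k \<in> op_image"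
  by (induction k) (auto intro: op_image_mult op_image_euler op_image_gens)

lemma op_image_tensor_eval: "tensor_eval f \<in> op_image"
  unfolding tensor_eval_def euler_poly_def by (intro op_image_sum op_image_mult op_image_osc op_image_euler_power op_image_gens) (simp add: scalars_W_def)

lemma scalar_commutes_XY:
  assumes "w \<in> scalars_W"
  shows "grp_op w * (cov_op \<xi> * dunkl v) = cov_op \<xi> * dunkl v * grp_op w"
proof -
  have w: "w \<in> W" and "scalar w" using assms by (auto simp: scalars_W_def)
  then obtain a where a: "w = mat a" by (auto simp: scalar_def)
  have "grp_op w * (cov_op \<xi> * dunkl v) = cov_op (dual_act w \<xi>) * dunkl (w *v v) * grp_op w"
  proof -
    have "grp_op w * (cov_op \<xi> * dunkl v) = cov_op (dual_act w \<xi>) * (grp_op w * dunkl v)"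
      by (simp only: grp_op_cov_op mult.assoc[symmetric])
    then show ?thesis by (simp only: grp_op_dunkl[OF w] mult.assoc)
  qed
  also have "cov_op (dual_act w \<xi>) * dunkl (w *v v) = cov_op \<xi> * dunkl v"
  proof -
    have "w *v v = a *s v" by (simp add: a mat_vec)
    then show ?thesis
      using scalar_inv(1)[OF w a] unfolding scalar_inv(2)[OF w a]
      by (simp add: cov_op_simps dunkl_simps op.scale_mult_left op.scale_mult_right)
  qed
  finally show ?thesis .
qed

lemma euler_op_power_XY: "euler_op ^ k * (cov_op \<xi> * dunkl v) = cov_op \<xi> * dunkl v * euler_op ^ k"
  by (rule power_commuting_commutes) (rule euler_op_XY)

lemma tensor_eval_XY: "tensor_eval f * (cov_op \<xi> * dunkl v) = cov_op \<xi> * dunkl v * tensor_eval f"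
proof -
  have "euler_op ^ k * (grp_op w * (cov_op \<xi> * dunkl v)) = cov_op \<xi> * dunkl v * (euler_op ^ k * grp_op w)" if "w \<in> scalars_W" for k w
  proof -
    have "euler_op ^ k * (grp_op w * (cov_op \<xi> * dunkl v)) = (euler_op ^ k * (cov_op \<xi> * dunkl v)) * grp_op w"
      by (simp only: scalar_commutes_XY[OF that] mult.assoc)
    then show ?thesis by (simp only: euler_op_power_XY mult.assoc)
  qed
  then show ?thesis
    by (simp add: tensor_eval_def euler_poly_def sum_distrib_left sum_distrib_right op.scale_mult_left op.scale_mult_right mult.assoc
        cong: sum.cong)
qed

text \<open>By induction on the bound \<open>m\<close> for the number of letters \<open>y\<close>. At each scalar \<open>u\<close> the coefficient tested in
  \<open>symbol_of_commuting\<close> can be removed by subtracting a multiple of \<open>eu\<^sup>m u\<close>.\<close>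

theorem commuting_is_tensor_eval:
  assumes t: "t \<noteq> 0" and z: "z \<in> op_image"
    and comm: "\<And>i j. z * (cov_op (axis i 1) * dunkl (axis j 1)) = cov_op (axis i 1) * dunkl (axis j 1) * z"
  shows "\<exists>f. (\<forall>w. w \<notin> scalars_W \<longrightarrow> f w = 0) \<and> z = tensor_eval f"
proof -
  have main: "\<exists>f. (\<forall>w. w \<notin> scalars_W \<longrightarrow> f w = 0) \<and> z = tensor_eval f"
    if "z \<in> op_image" "\<And>i j. z * (cov_op (axis i 1) * dunkl (axis j 1)) = cov_op (axis i 1) * dunkl (axis j 1) * z"
      "graded {(d, G). d < m} (ap z unit_nf)" for z m
    using that
  proof (induction m arbitrary: z)
    case 0
    obtain f where f: "f \<in> carrier S" "z = \<rho> f" using 0(1) by (auto simp: op_image_def)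
    have "ap z unit_nf = 0"
    proof (rule poly_mapping_eqI)
      fix k show "coef (ap z unit_nf) k = coef 0 k"
        using coef_graded_0[OF 0(3), of k] by (cases "grade k") simp
    qed
    then have "z = 0" using \<rho>_eq_0 f by blast
    then show ?case by (intro exI[of _ "\<lambda>w. 0"]) (simp add: tensor_eval_def euler_poly_def)
  next
    case (Suc m)
    define i0 :: 'n where "i0 = undefined"
    let ?k = "\<lambda>u. (replicate_mset m i0, replicate_mset m i0, {#u#})"
    define f0 where "f0 w = (if w \<in> scalars_W then Polynomial.monom (coef (ap z unit_nf) (?k w)) m else 0)" for w
    define z' where "z' = z - tensor_eval f0"
    have z'Im: "z' \<in> op_image" unfolding z'_def by (intro op_image_minus Suc.prems op_image_tensor_eval)
    have comm': "z' * (cov_op (axis i 1) * dunkl (axis j 1)) = cov_op (axis i 1) * dunkl (axis j 1) * z'" for i j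
      unfolding z'_def by (simp only: left_diff_distrib right_diff_distrib Suc.prems(2) tensor_eval_XY)
    have MM0: "ap (tensor_eval f0) unit_nf = (\<Sum>w\<in>scalars_W. psc (coef (ap z unit_nf) (?k w)) (ap (euler_op ^ m) (gN w)))"
      by (simp add: tensor_eval_def f0_def euler_poly_monom)
    obtain f where f: "f \<in> carrier S" "z' = \<rho> f" using z'Im by (auto simp: op_image_def)
    have "graded {(d, G). d < m} (ap (\<rho> f) unit_nf)"
    proof (rule symbol_of_commuting[OF t f(1), of m i0])
      show "\<rho> f * (cov_op (axis i 1) * dunkl (axis j 1)) = cov_op (axis i 1) * dunkl (axis j 1) * \<rho> f" for i j
        using comm' f(2) by simp
      have "graded {(d, G). d \<le> m} (ap z unit_nf)" by (rule graded_mono[OF Suc.prems(3)]) auto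
      then show "graded {(d, G). d \<le> m} (ap (\<rho> f) unit_nf)"
        unfolding f(2)[symmetric] z'_def ap_op MM0
        by (intro graded_minus graded_sum graded_psc euler_op_power_top(1))
      fix u assume "u \<in> W" "scalar u"
      then have u: "u \<in> scalars_W" by (simp add: scalars_W_def)
      have "coef (ap (tensor_eval f0) unit_nf) (?k u) = (\<Sum>w\<in>scalars_W. if w = u then coef (ap z unit_nf) (?k u) else 0)"
        unfolding MM0 lookup_sum by (rule sum.cong) (auto simp: euler_op_power_top(2))
      also have "\<dots> = coef (ap z unit_nf) (?k u)" using u finite_scalars_W by simp
      finally show "coef (ap (\<rho> f) unit_nf) (?k u) = 0"
        unfolding f(2)[symmetric] z'_def by (simp add: lookup_minus)
    qed
    then have "graded {(d, G). d < m} (ap z' unit_nf)" using f(2) by simp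
    from Suc.IH[OF z'Im comm' this] obtain g where g: "\<forall>w. w \<notin> scalars_W \<longrightarrow> g w = 0" "z' = tensor_eval g" by blast
    have "z = tensor_eval (\<lambda>w. f0 w + g w)" unfolding tensor_eval_add g(2)[symmetric] z'_def by simp
    then show ?case using g(1) by (intro exI[of _ "\<lambda>w. f0 w + g w"]) (simp add: f0_def)
  qed
  have "graded {(d, G). d < Suc (Max ((\<lambda>k. fst (grade k)) ` Poly_Mapping.keys (ap z unit_nf)))} (ap z unit_nf)"
    unfolding graded_def
  proof
    fix k assume k: "k \<in> Poly_Mapping.keys (ap z unit_nf)"
    have "fst (grade k) \<le> Max ((\<lambda>k. fst (grade k)) ` Poly_Mapping.keys (ap z unit_nf))"
      by (rule Max_ge) (use k in auto)
    then show "grade k \<in> {(d, G). d < Suc (Max ((\<lambda>k. fst (grade k)) ` Poly_Mapping.keys (ap z unit_nf)))}"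
      by (cases "grade k") simp
  qed
  from main[OF z comm this] show ?thesis by blast
qed

end

section \<open>Central elements are scalars\<close>

text \<open>The value \<open>p(A) v\<close>, by Horner's scheme.\<close>

definition poly_vec :: "complex ^ 'n ^ 'n \<Rightarrow> complex ^ 'n \<Rightarrow> complex poly \<Rightarrow> complex ^ 'n" where
  "poly_vec A v p = fold_coeffs (\<lambda>a u. a *s v + A *v u) p 0"

lemma poly_vec_pCons [simp]: "poly_vec A v 0 = 0" "poly_vec A v (pCons a p) = a *s v + A *v poly_vec A v p"
  by (cases "p = 0 \<and> a = 0"; auto simp: poly_vec_def)+

lemma poly_vec_linear: "poly_vec A v (p + q) = poly_vec A v p + poly_vec A v q"
  "poly_vec A v (Polynomial.smult a p) = a *s poly_vec A v p"
proof -
  show "poly_vec A v (p + q) = poly_vec A v p + poly_vec A v q"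
    by (induction p q rule: poly_induct2) (simp_all add: vec.scale_left_distrib matrix_vector_simps)
  show "poly_vec A v (Polynomial.smult a p) = a *s poly_vec A v p"
    by (induction p) (simp_all add: vec.scale_right_distrib matrix_vector_simps)
qed

lemma poly_vec_monom: "poly_vec A v (Polynomial.monom 1 k) = (((*v) A) ^^ k) v"
  by (induction k) (simp_all add: monom_0 monom_Suc)

text \<open>Split off a linear factor \<open>X - r\<close> of \<open>p\<close>: either the remaining factor still annihilates \<open>v\<close>, or it maps
  \<open>v\<close> to an eigenvector.\<close>

lemma eigenvector_of_annihilator:
  assumes "p \<noteq> 0" "poly_vec A v p = 0" "v \<noteq> 0"
  shows "\<exists>r u. u \<noteq> 0 \<and> A *v u = r *s u"
  using assms(1,2)
proof (induction "Polynomial.degree p" arbitrary: p rule: less_induct)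
  case less
  show ?case
  proof (cases "Polynomial.degree p = 0")
    case True
    then obtain a where "p = [:a:]" by (metis degree_eq_zeroE)
    then show ?thesis using less.prems assms(3) by simp
  next
    case False
    then obtain r where "poly p r = 0"
      using fundamental_theorem_of_algebra[of p] by (auto simp: constant_degree)
    then obtain q where q: "p = [:- r, 1:] * q" by (metis poly_eq_0_iff_dvd dvdE)
    have q0: "q \<noteq> 0" using less.prems(1) q by auto
    have "[:- r, 1:] * q = Polynomial.smult (- r) q + pCons 0 q"
      by (simp add: mult_pCons_left)
    then have "poly_vec A v p = (- r) *s poly_vec A v q + A *v poly_vec A v q"
      by (simp only: q poly_vec_linear poly_vec_pCons vec.scale_zero_left add_0_left)
    then have eig: "A *v poly_vec A v q = r *s poly_vec A v q" using less.prems(2) by simp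
    have "Polynomial.degree p = Suc (Polynomial.degree q)"
      unfolding q using q0 by (subst degree_mult_eq) auto
    then show ?thesis using eig less.hyps[of q] q0 by (cases "poly_vec A v q = 0") auto
  qed
qed

context reflection_algebra
begin

lemma eigenvector:
  assumes z: "z \<in> W"
  shows "\<exists>r u. u \<noteq> 0 \<and> z *v u = r *s u"
proof -
  define v :: "complex ^ 'n" where "v = axis undefined 1"
  define g where "g k = (((**) z) ^^ k) (mat 1)" for k
  have "g k \<in> W" for k
    by (induction k) (simp_all add: g_def W_one W_mult z)
  then have "range g \<subseteq> W" by blast
  \<comment> \<open>Two powers of \<open>z\<close> coincide, which gives an annihilating polynomial.\<close>
  then have "\<not> inj g" using finite_W finite_subset finite_imageD infinite_UNIV_nat by blast
  then obtain i j where ij: "i \<noteq> j" "g i = g j" by (auto simp: inj_def)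
  have "g k *v v = (((*v) z) ^^ k) v" for k
    by (induction k) (simp_all add: g_def matrix_vector_mul_assoc[symmetric])
  then have "poly_vec z v (Polynomial.monom 1 i + Polynomial.smult (-1) (Polynomial.monom 1 j)) = 0"
    using ij(2) by (simp only: poly_vec_linear poly_vec_monom) (metis add.right_inverse vec.scale_minus_left vec.scale_one)
  moreover have "Polynomial.coeff (Polynomial.monom 1 i + Polynomial.smult (-1) (Polynomial.monom 1 j)) i = (1 :: complex)"
    using ij(1) by simp
  then have "Polynomial.monom 1 i + Polynomial.smult (-1) (Polynomial.monom 1 j) \<noteq> (0 :: complex poly)"
    by (metis coeff_0 zero_neq_one)
  moreover have "v \<noteq> 0" by (simp add: v_def axis_eq_0_iff)
  ultimately show ?thesis using eigenvector_of_annihilator by blast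
qed

text \<open>Schur's lemma: an eigenspace of a central element is invariant under \<open>W\<close>.\<close>

lemma group_centre_eq_scalars:
  assumes irr: "irreducible_rep W"
  shows "group_centre W = scalars_W"
proof (intro equalityI subsetI)
  fix z assume "z \<in> scalars_W"
  then obtain a where z: "z \<in> W" "z = mat a" by (auto simp: scalars_W_def scalar_def)
  have "z ** w = w ** z" for w
    by (rule matrix_eqI) (simp add: z(2) mat_vec matrix_vector_simps flip: matrix_vector_mul_assoc)
  then show "z \<in> group_centre W" using z(1) by (simp add: group_centre_def)
next
  fix z assume "z \<in> group_centre W"
  then have z: "z \<in> W" and comm: "\<And>w. w \<in> W \<Longrightarrow> z ** w = w ** z" by (auto simp: group_centre_def)
  obtain r u where u: "u \<noteq> 0" "z *v u = r *s u" using eigenvector[OF z] by blast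
  let ?U = "{u. z *v u = r *s u}"
  have "vec.subspace ?U"
    by (rule vec.subspaceI) (auto simp: matrix_vector_simps vec.scale_right_distrib mult.commute)
  moreover have "w *v u' \<in> ?U" if "w \<in> W" "u' \<in> ?U" for w u'
    using that comm[OF that(1)] by (simp add: matrix_vector_mul_assoc)
      (metis matrix_vector_mul_assoc matrix_vector_simps(3))
  ultimately have "?U = {0} \<or> ?U = UNIV" using irr by (auto simp: irreducible_rep_def)
  then have "?U = UNIV" using u by auto
  then have "z = mat r" by (intro matrix_eqI) (auto simp: mat_vec)
  then show "z \<in> scalars_W" using z by (auto simp: scalars_W_def scalar_def)
qed

end

section \<open>Transport to the Cherednik algebra\<close>

inductive_set op_subring :: "'k op set \<Rightarrow> 'k op set" for K where
  one: "1 \<in> op_subring K"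
| incl: "A \<in> K \<Longrightarrow> A \<in> op_subring K"
| uminus: "A \<in> op_subring K \<Longrightarrow> - A \<in> op_subring K"
| add: "A \<in> op_subring K \<Longrightarrow> B \<in> op_subring K \<Longrightarrow> A + B \<in> op_subring K"
| mult: "A \<in> op_subring K \<Longrightarrow> B \<in> op_subring K \<Longrightarrow> A * B \<in> op_subring K"

lemma op_subring_sum: "(\<And>i. i \<in> I \<Longrightarrow> f i \<in> op_subring K) \<Longrightarrow> sum f I \<in> op_subring K"
proof (induction I rule: infinite_finite_induct)
  have "1 + (- 1) \<in> op_subring K" by (intro op_subring.intros)
  then have "0 \<in> op_subring K" by simp
  then show "sum f {} \<in> op_subring K" "\<And>A. infinite A \<Longrightarrow> sum f A \<in> op_subring K" by simp_all
qed (auto intro: op_subring.add)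

lemma op_subring_power: "A \<in> op_subring K \<Longrightarrow> A ^ k \<in> op_subring K"
  by (induction k) (auto intro: op_subring.intros)

lemma op_subring_commute:
  assumes "A \<in> op_subring K" "\<And>B. B \<in> K \<Longrightarrow> B * C = C * B"
  shows "A * C = C * A"
  using assms(1)
proof induction
  case (mult A B)
  have "A * B * C = A * (C * B)" by (simp only: mult.assoc mult.IH)
  also have "\<dots> = C * (A * B)" by (simp only: mult.assoc[symmetric] mult.IH)
  finally show ?case .
qed (simp_all add: assms(2) distrib_left distrib_right)

context reflection_algebra
begin

abbreviation H where "H \<equiv> cherednik W t c \<alpha> \<alpha>v"
abbreviation pr where "pr \<equiv> cherednik_proj W t c \<alpha> \<alpha>v"

sublocale H: ring H
  unfolding cherednik_def by (rule ideal.quotient_is_ring[OF I_ideal])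

lemma pr_hom: "pr \<in> ring_hom S H"
proof -
  have "pr = (+>\<^bsub>S\<^esub>) I" by (rule ext) (simp add: cherednik_proj_def)
  then show ?thesis unfolding cherednik_def by (simp add: ideal.rcos_ring_hom[OF I_ideal])
qed

lemma carrier_H: "carrier H = pr ` carrier S"
  by (auto simp: cherednik_def cherednik_proj_def FactRing_def A_RCOSETS_def')

lemma pr_eq_iff:
  assumes "f \<in> carrier S" "g \<in> carrier S"
  shows "pr f = pr g \<longleftrightarrow> \<rho> f = \<rho> g"
proof -
  have "pr f = pr g \<longleftrightarrow> f \<ominus>\<^bsub>S\<^esub> g \<in> I"
    unfolding cherednik_proj_def using S.quotient_eq_iff_same_a_r_cos[OF I_ideal assms] by simp
  also have "\<dots> \<longleftrightarrow> \<rho> (f - g) = 0"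
    using faithful[of "f - g"] assms by (simp add: smash_minus smash_carrier_closed)
  finally show ?thesis by (simp add: \<rho>_minus)
qed

text \<open>The faithful action of the Cherednik algebra itself. It identifies the algebra with a ring of operators,
  to which the statement is transported.\<close>

definition \<theta> :: "'n smash_elt set \<Rightarrow> 'n nf_op" where
  "\<theta> C = \<rho> (SOME f. f \<in> carrier S \<and> pr f = C)"

lemma \<theta>_pr: "f \<in> carrier S \<Longrightarrow> \<theta> (pr f) = \<rho> f"
  unfolding \<theta>_def using someI[of "\<lambda>g. g \<in> carrier S \<and> pr g = pr f" f] pr_eq_iff by blast

lemma \<theta>_inj: "inj_on \<theta> (carrier H)"
proof (rule inj_onI)
  fix C D assume "C \<in> carrier H" "D \<in> carrier H" and eq: "\<theta> C = \<theta> D"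
  then obtain f g where "f \<in> carrier S" "C = pr f" "g \<in> carrier S" "D = pr g" by (auto simp: carrier_H)
  then show "C = D" using eq pr_eq_iff[of f g] by (simp add: \<theta>_pr)
qed

lemma \<theta>_op_image: "C \<in> carrier H \<Longrightarrow> \<theta> C \<in> op_image"
  by (auto simp: carrier_H \<theta>_pr op_image_def)

lemma pr_closed [simp]: "f \<in> carrier S \<Longrightarrow> pr f \<in> carrier H"
  by (simp add: carrier_H)

lemma \<theta>_mult: "C \<in> carrier H \<Longrightarrow> D \<in> carrier H \<Longrightarrow> \<theta> (C \<otimes>\<^bsub>H\<^esub> D) = \<theta> C * \<theta> D"
  by (auto simp: carrier_H ring_hom_mult[OF pr_hom, symmetric] \<theta>_pr smash_mult_closed \<rho>_mult)

lemma \<theta>_add: "C \<in> carrier H \<Longrightarrow> D \<in> carrier H \<Longrightarrow> \<theta> (C \<oplus>\<^bsub>H\<^esub> D) = \<theta> C + \<theta> D"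
  by (auto simp: carrier_H ring_hom_add[OF pr_hom, symmetric] \<theta>_pr smash_simps(3) smash_carrier_closed \<rho>_add)

lemma \<theta>_one: "\<theta> \<one>\<^bsub>H\<^esub> = 1"
  using ring_hom_one[OF pr_hom] \<theta>_pr[of "\<one>\<^bsub>S\<^esub>"] by simp

lemma \<theta>_zero: "\<theta> \<zero>\<^bsub>H\<^esub> = 0"
  using \<theta>_add[of "\<zero>\<^bsub>H\<^esub>" "\<zero>\<^bsub>H\<^esub>"] by simp

lemma \<theta>_uminus: "C \<in> carrier H \<Longrightarrow> \<theta> (\<ominus>\<^bsub>H\<^esub> C) = - \<theta> C"
  using \<theta>_add[of C "\<ominus>\<^bsub>H\<^esub> C"] by (simp add: H.r_neg \<theta>_zero minus_unique)

lemma \<theta>_minus: "C \<in> carrier H \<Longrightarrow> D \<in> carrier H \<Longrightarrow> \<theta> (C \<ominus>\<^bsub>H\<^esub> D) = \<theta> C - \<theta> D"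
  by (simp add: a_minus_def \<theta>_add \<theta>_uminus)

lemma \<theta>_finsum:
  "finite A \<Longrightarrow> (\<And>i. i \<in> A \<Longrightarrow> f i \<in> carrier H) \<Longrightarrow> \<theta> (finsum H f A) = (\<Sum>i\<in>A. \<theta> (f i))"
  by (induction A rule: finite_induct) (auto simp: \<theta>_zero \<theta>_add H.finsum_closed Pi_def)

lemma \<theta>_power: "C \<in> carrier H \<Longrightarrow> \<theta> (C [^]\<^bsub>H\<^esub> (k::nat)) = \<theta> C ^ k"
  by (induction k) (simp_all add: \<theta>_one \<theta>_mult power_commutes)

lemma \<theta>_generate_ring:
  assumes K: "K \<subseteq> carrier H"
  shows "\<theta> ` generate_ring H K = op_subring (\<theta> ` K)"
proof (intro equalityI subsetI)
  fix A assume "A \<in> \<theta> ` generate_ring H K"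
  then obtain C where "C \<in> generate_ring H K" "A = \<theta> C" by blast
  then show "A \<in> op_subring (\<theta> ` K)"
  proof (induction arbitrary: A)
    case one
    then show ?case by (simp add: \<theta>_one op_subring.one)
  next
    case (incl C)
    then show ?case by (auto intro: op_subring.incl)
  next
    case (a_inv C)
    then show ?case using H.generate_ring_in_carrier[OF K]
      by (simp add: \<theta>_uminus op_subring.uminus)
  next
    case (eng_add C D)
    then show ?case using H.generate_ring_in_carrier[OF K]
      by (simp add: \<theta>_add op_subring.add)
  next
    case (eng_mult C D)
    then show ?case using H.generate_ring_in_carrier[OF K]
      by (simp add: \<theta>_mult op_subring.mult)
  qed
next
  fix A assume "A \<in> op_subring (\<theta> ` K)"
  then show "A \<in> \<theta> ` generate_ring H K"
  proof induction
    case one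
    show ?case by (rule image_eqI[of _ _ "\<one>\<^bsub>H\<^esub>"]) (simp_all add: \<theta>_one generate_ring.one)
  next
    case (incl A)
    then show ?case by (auto intro: generate_ring.incl)
  next
    case (uminus A)
    then obtain C where "C \<in> generate_ring H K" "A = \<theta> C" by blast
    then show ?case using H.generate_ring_in_carrier[OF K]
      by (intro image_eqI[of _ _ "\<ominus>\<^bsub>H\<^esub> C"]) (simp_all add: \<theta>_uminus generate_ring.a_inv)
  next
    case (add A B)
    then obtain C D where "C \<in> generate_ring H K" "A = \<theta> C" "D \<in> generate_ring H K" "B = \<theta> D" by blast
    then show ?case using H.generate_ring_in_carrier[OF K]
      by (intro image_eqI[of _ _ "C \<oplus>\<^bsub>H\<^esub> D"]) (simp_all add: \<theta>_add generate_ring.eng_add)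
  next
    case (mult A B)
    then obtain C D where "C \<in> generate_ring H K" "A = \<theta> C" "D \<in> generate_ring H K" "B = \<theta> D" by blast
    then show ?case using H.generate_ring_in_carrier[OF K]
      by (intro image_eqI[of _ _ "C \<otimes>\<^bsub>H\<^esub> D"]) (simp_all add: \<theta>_mult generate_ring.eng_mult)
  qed
qed

text \<open>A left inverse of a square matrix is a right inverse.\<close>

lemma dual_bases_canonical:
  fixes x y :: "'n \<Rightarrow> complex ^ 'n"
  assumes "dual_bases y x"
  shows "(\<Sum>i\<in>UNIV. x i $ k * y i $ l) = (if k = l then 1 else 0)"
proof -
  define A B :: "complex ^ 'n ^ 'n" where "A = (\<chi> i j. x i $ j)" and "B = (\<chi> j i. y i $ j)"
  have "(A ** B) $ i $ j = mat 1 $ i $ j" for i j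
    using assms by (simp add: A_def B_def matrix_matrix_mult_def dual_bases_def pairing_def mat_def)
  then have "A ** B = mat 1" by (simp add: vec_eq_iff)
  then have "(B ** A) $ l $ k = mat 1 $ l $ k" using matrix_left_right_inverse[of A B] by simp
  then show ?thesis by (auto simp: A_def B_def matrix_matrix_mult_def mat_def mult.commute)
qed

text \<open>The products \<open>X\<^sub>\<xi> Y\<^sub>v\<close> are bilinear in \<open>\<xi>\<close> and \<open>v\<close>, so any pair of dual bases may be replaced by the
  standard one.\<close>

lemma commutes_with_all_XY:
  fixes x y :: "'n \<Rightarrow> complex ^ 'n"
  assumes db: "dual_bases y x"
    and z: "\<And>i j. z * (cov_op (x i) * dunkl (y j)) = cov_op (x i) * dunkl (y j) * z"
  shows "z * (cov_op (axis k 1) * dunkl (axis l 1)) = cov_op (axis k 1) * dunkl (axis l 1) * z"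
proof -
  have e: "(\<Sum>i\<in>UNIV. y i $ k *s x i) = axis k 1" "(\<Sum>i\<in>UNIV. x i $ k *s y i) = axis k 1" for k
    using dual_bases_canonical[OF db]
    by (auto simp: vec_eq_iff axis_def mult.commute[of "y _ $ _"])
  have "cov_op (axis k 1) = (\<Sum>i\<in>UNIV. osc (y i $ k) (cov_op (x i)))"
    by (simp only: e(1)[symmetric] cov_op_sum cov_op_simps)
  moreover have "dunkl (axis l 1) = (\<Sum>i\<in>UNIV. osc (x i $ l) (dunkl (y i)))"
    by (simp only: e(2)[symmetric] dunkl_sum dunkl_simps)
  ultimately have "cov_op (axis k 1) * dunkl (axis l 1)
      = (\<Sum>i\<in>UNIV. \<Sum>j\<in>UNIV. osc (y i $ k * x j $ l) (cov_op (x i) * dunkl (y j)))"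
    by (simp add: sum_product op.scale_mult_left op.scale_mult_right mult.commute[of "x _ $ _"])
  then show ?thesis
    by (simp add: sum_distrib_left sum_distrib_right op.scale_mult_left op.scale_mult_right z)
qed

abbreviation eu where "eu \<equiv> euler W t c \<alpha> \<alpha>v lam"

lemma euler_facts:
  fixes x y :: "'n \<Rightarrow> complex ^ 'n"
  assumes db: "dual_bases y x"
  shows eu_closed: "eu y x \<in> carrier H" and \<theta>_eu: "\<theta> (eu y x) = euler_op"
proof -
  define f where "f = (\<lambda>i. pr (cov_A (x i)) \<otimes>\<^bsub>H\<^esub> pr (vec_A (y i)))"
  define g where "g = (\<lambda>s. pr (const_A (2 * c s / (1 - lam s))) \<otimes>\<^bsub>H\<^esub> pr (grp_A s))"
  have eu: "eu y x = finsum H f UNIV \<ominus>\<^bsub>H\<^esub> finsum H g R"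
    by (simp add: euler_def f_def g_def)
  have f: "f i \<in> carrier H" "\<theta> (f i) = cov_op (x i) * dunkl (y i)" for i
    by (simp_all add: f_def \<theta>_mult \<theta>_pr)
  have g: "g s \<in> carrier H" "\<theta> (g s) = osc (2 * c s / (1 - lam s)) (grp_op s)" if "s \<in> R" for s
    using that R_subset by (auto simp: g_def \<theta>_mult \<theta>_pr op.scale_mult_left)
  have fc: "finsum H f UNIV \<in> carrier H" "finsum H g R \<in> carrier H"
    using f(1) g(1) by (auto intro!: H.finsum_closed)
  then show "eu y x \<in> carrier H" unfolding eu by (rule H.minus_closed)
  have "\<theta> (eu y x) = (\<Sum>i\<in>UNIV. \<theta> (f i)) - (\<Sum>s\<in>R. \<theta> (g s))"
    using f(1) g(1) by (simp add: eu \<theta>_minus fc \<theta>_finsum)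
  also have "\<dots> = euler_op"
    using canonical_element[OF dual_bases_canonical[OF db]]
    by (simp add: f(2) g(2) euler_op_def cong: sum.cong)
  finally show "\<theta> (eu y x) = euler_op" .
qed

lemma multiplication_map_facts:
  fixes x y :: "'n \<Rightarrow> complex ^ 'n"
  assumes db: "dual_bases y x"
  shows mm_closed: "multiplication_map W t c \<alpha> \<alpha>v (eu y x) scalars_W f \<in> carrier H"
    and \<theta>_mm: "\<theta> (multiplication_map W t c \<alpha> \<alpha>v (eu y x) scalars_W f) = tensor_eval f"
proof -
  define g where "g = (\<lambda>z k. pr (const_A (Polynomial.coeff (f z) k)) \<otimes>\<^bsub>H\<^esub> eu y x [^]\<^bsub>H\<^esub> (k :: nat))"
  define h where "h = (\<lambda>z. finsum H (g z) {..Polynomial.degree (f z)} \<otimes>\<^bsub>H\<^esub> pr (grp_A z))"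
  have mm: "multiplication_map W t c \<alpha> \<alpha>v (eu y x) scalars_W f = finsum H h scalars_W"
    by (simp add: multiplication_map_def g_def h_def)
  have g: "g z k \<in> carrier H" "\<theta> (g z k) = osc (Polynomial.coeff (f z) k) (euler_op ^ k)" for z k
    using eu_closed[OF db] by (simp_all add: g_def \<theta>_mult \<theta>_pr \<theta>_power \<theta>_eu[OF db] op.scale_mult_left)
  have gs: "finsum H (g z) {..Polynomial.degree (f z)} \<in> carrier H" for z
    using g(1) by (auto intro!: H.finsum_closed)
  have h: "h z \<in> carrier H" "\<theta> (h z) = euler_poly (f z) * grp_op z" if "z \<in> scalars_W" for z
  proof -
    have "z \<in> W" using that by (simp add: scalars_W_def)
    then show "h z \<in> carrier H" "\<theta> (h z) = euler_poly (f z) * grp_op z"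
      using gs g(1) by (simp_all add: h_def \<theta>_mult \<theta>_pr \<theta>_finsum g(2) euler_poly_def)
  qed
  show "multiplication_map W t c \<alpha> \<alpha>v (eu y x) scalars_W f \<in> carrier H"
    unfolding mm using h(1) by (auto intro!: H.finsum_closed)
  show "\<theta> (multiplication_map W t c \<alpha> \<alpha>v (eu y x) scalars_W f) = tensor_eval f"
    unfolding mm using h by (simp add: \<theta>_finsum finite_scalars_W tensor_eval_def cong: sum.cong)
qed

end

theorem proposition6p21:
  fixes W :: "(complex ^ 'n ^ 'n) set"
    and t :: complex
    and c lam :: "complex ^ 'n ^ 'n \<Rightarrow> complex"
    and \<alpha> \<alpha>v :: "complex ^ 'n ^ 'n \<Rightarrow> complex ^ 'n"
    and y x :: "'n \<Rightarrow> complex ^ 'n"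
  assumes "complex_reflection_group W"
    and "irreducible_rep W"
    and "CARD('n) > 1"
    and "t \<noteq> 0"
    and "conj_invariant W c"
    and "reflection_data W \<alpha> \<alpha>v lam"
    and "dual_bases y x"
  shows "centre_of (cherednik W t c \<alpha> \<alpha>v) (cherednik_gl W t c \<alpha> \<alpha>v y x) =
           generated_subalgebra W t c \<alpha> \<alpha>v
             (insert (euler W t c \<alpha> \<alpha>v lam y x)
                ((\<lambda>z. cherednik_proj W t c \<alpha> \<alpha>v (grp_A z)) ` group_centre W)) \<and>
         bij_betw
           (multiplication_map W t c \<alpha> \<alpha>v (euler W t c \<alpha> \<alpha>v lam y x) (group_centre W))
           (poly_tensor_group_algebra (group_centre W))
           (centre_of (cherednik W t c \<alpha> \<alpha>v) (cherednik_gl W t c \<alpha> \<alpha>v y x))"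
proof -
  interpret reflection_algebra W t c lam \<alpha> \<alpha>v
    by unfold_locales (fact assms)+
  note Z = group_centre_eq_scalars[OF assms(2)]
  note eu_closed = eu_closed[OF assms(7)] and \<theta>_eu = \<theta>_eu[OF assms(7)]
  let ?mm = "multiplication_map W t c \<alpha> \<alpha>v (eu y x) scalars_W"
  note mm = mm_closed[OF assms(7)] \<theta>_mm[OF assms(7)]
  define KB where "KB = range (\<lambda>a. pr (const_A a)) \<union>
    ({pr (cov_A (x i)) \<otimes>\<^bsub>H\<^esub> pr (vec_A (y j)) | i j. True} \<union> (\<lambda>w. pr (grp_A w)) ` W)"
  define KD where "KD = range (\<lambda>a. pr (const_A a)) \<union> insert (eu y x) ((\<lambda>z. pr (grp_A z)) ` scalars_W)"
  let ?B = "generate_ring H KB" and ?D = "generate_ring H KD"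
  have B: "cherednik_gl W t c \<alpha> \<alpha>v y x = ?B"
    unfolding cherednik_gl_def generated_subalgebra_def KB_def ..
  have D: "generated_subalgebra W t c \<alpha> \<alpha>v (insert (eu y x) ((\<lambda>z. pr (grp_A z)) ` scalars_W)) = ?D"
    unfolding generated_subalgebra_def KD_def ..
  have KB: "KB \<subseteq> carrier H" by (auto simp: KB_def)
  have KD: "KD \<subseteq> carrier H" using eu_closed by (auto simp: KD_def scalars_W_def)
  have \<theta>KB: "\<theta> ` KB = range (\<lambda>a. osc a 1) \<union> ({cov_op (x i) * dunkl (y j) | i j. True} \<union> grp_op ` W)"
  proof -
    have pairs: "{F i j | i j. True} = range (\<lambda>z. F (fst z) (snd z))" for F :: "'n \<Rightarrow> 'n \<Rightarrow> 'b"
      by (auto simp: image_def)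
    have "(\<lambda>w. \<theta> (pr (grp_A w))) ` W = grp_op ` W"
      by (rule image_cong) (simp_all add: \<theta>_pr)
    then show ?thesis
      unfolding KB_def pairs image_Un image_image by (simp add: \<theta>_pr \<theta>_mult)
  qed
  have \<theta>KD: "\<theta> ` KD = range (\<lambda>a. osc a 1) \<union> insert euler_op (grp_op ` scalars_W)"
  proof -
    have "(\<lambda>w. \<theta> (pr (grp_A w))) ` scalars_W = grp_op ` scalars_W"
      by (rule image_cong) (simp_all add: \<theta>_pr scalars_W_def)
    then show ?thesis
      unfolding KD_def image_Un image_image image_insert by (simp add: \<theta>_pr \<theta>_eu)
  qed
  note BH = H.generate_ring_in_carrier[OF KB] and DH = H.generate_ring_in_carrier[OF KD]
  have osc_in: "osc a A \<in> op_subring K" if "A \<in> op_subring K" "range (\<lambda>a. osc a 1) \<subseteq> K" for a K and A :: "'n nf_op"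
  proof -
    have "osc a 1 \<in> op_subring K" by (rule op_subring.incl) (use that(2) in auto)
    then have "osc a 1 * A \<in> op_subring K" using that(1) by (rule op_subring.mult)
    then show ?thesis by (simp add: op.scale_mult_left)
  qed
  have Eu_B: "euler_op \<in> op_subring (\<theta> ` KB)"
  proof -
    have "euler_op = (\<Sum>i\<in>UNIV. cov_op (x i) * dunkl (y i)) + - (\<Sum>s\<in>R. osc (2 * c s / (1 - lam s)) (grp_op s))"
      unfolding euler_op_def canonical_element[OF dual_bases_canonical[OF assms(7)], symmetric] by simp
    also have "\<dots> \<in> op_subring (\<theta> ` KB)"
      by (intro op_subring.add op_subring.uminus op_subring_sum osc_in op_subring.incl)
        (use R_subset in \<open>auto simp: \<theta>KB\<close>)
    finally show ?thesis .
  qed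
  have D_sub: "A \<in> op_subring (\<theta> ` KB)" if "A \<in> op_subring (\<theta> ` KD)" for A
    using that
  proof induction
    case (incl A)
    then show ?case using Eu_B by (auto simp: \<theta>KD \<theta>KB scalars_W_def intro: op_subring.incl)
  qed (auto intro: op_subring.intros)
  have D_comm: "A * A' = A' * A" if "A \<in> op_subring (\<theta> ` KD)" "A' \<in> op_subring (\<theta> ` KB)" for A A'
  proof (rule op_subring_commute[OF that(1)])
    fix C assume C: "C \<in> \<theta> ` KD"
    show "C * A' = A' * C"
    proof (rule op_subring_commute[OF that(2), symmetric])
      fix C' assume C': "C' \<in> \<theta> ` KB"
      consider a where "C = osc a 1" | "C = euler_op" | w where "w \<in> scalars_W" "C = grp_op w"
        using C by (auto simp: \<theta>KD)
      then show "C' * C = C * C'"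
      proof cases
        case 1
        then show ?thesis by (simp add: op.scale_mult_left op.scale_mult_right)
      next
        case 2
        then show ?thesis using C' by (auto simp: \<theta>KB euler_op_XY euler_op_grp_op op.scale_mult_left op.scale_mult_right)
      next
        case 3
        have "grp_op w * grp_op u = grp_op u * grp_op w" if u: "u \<in> W" for u
        proof -
          have "w \<in> W" "w ** u = u ** w" using 3(1) u unfolding Z[symmetric] group_centre_def by auto
          then show ?thesis using u by (simp add: grp_op_mult W_invertible)
        qed
        then show ?thesis
          using C' 3 by (auto simp: \<theta>KB scalar_commutes_XY op.scale_mult_left op.scale_mult_right)
      qed
    qed
  qed
  have D_centre: "C \<in> centre_of H ?B" if C: "C \<in> ?D" for C
  proof -
    have CD: "\<theta> C \<in> op_subring (\<theta> ` KD)" using C \<theta>_generate_ring[OF KD] by blast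
    then have "\<theta> C \<in> \<theta> ` ?B" using D_sub \<theta>_generate_ring[OF KB] by blast
    then have "C \<in> ?B" using \<theta>_inj BH DH[OF C] by (auto dest: inj_onD)
    moreover have "C \<otimes>\<^bsub>H\<^esub> C' = C' \<otimes>\<^bsub>H\<^esub> C" if C': "C' \<in> ?B" for C'
    proof -
      have "\<theta> C' \<in> op_subring (\<theta> ` KB)" using C' \<theta>_generate_ring[OF KB] by blast
      then have "\<theta> (C \<otimes>\<^bsub>H\<^esub> C') = \<theta> (C' \<otimes>\<^bsub>H\<^esub> C)"
        using D_comm[OF CD] DH[OF C] BH[OF C'] by (simp add: \<theta>_mult)
      then show ?thesis using \<theta>_inj DH[OF C] BH[OF C'] by (auto dest: inj_onD)
    qed
    ultimately show ?thesis by (simp add: centre_of_def)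
  qed
  have mm_D: "?mm f \<in> ?D" for f
  proof -
    have "tensor_eval f \<in> op_subring (\<theta> ` KD)"
      unfolding tensor_eval_def euler_poly_def
      by (intro op_subring_sum op_subring.mult osc_in op_subring_power op_subring.incl) (auto simp: \<theta>KD)
    then obtain C where C: "C \<in> ?D" "\<theta> C = tensor_eval f" using \<theta>_generate_ring[OF KD] by (metis imageE)
    then have "C = ?mm f" using \<theta>_inj DH[OF C(1)] mm[of f] by (metis inj_onD)
    then show ?thesis using C(1) by simp
  qed
  \<comment> \<open>Of the generators only the products \<open>x\<^sub>i y\<^sub>j\<close> are tested here: commuting with them already
    forces the normal form.\<close>
  have centre_mm: "\<exists>f\<in>poly_tensor_group_algebra scalars_W. C = ?mm f" if C: "C \<in> centre_of H ?B" for C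
  proof -
    have CB: "C \<in> ?B" and comm: "\<And>C'. C' \<in> ?B \<Longrightarrow> C \<otimes>\<^bsub>H\<^esub> C' = C' \<otimes>\<^bsub>H\<^esub> C"
      using C by (auto simp: centre_of_def)
    have CH: "C \<in> carrier H" using BH CB by blast
    have "\<theta> C * (cov_op (x i) * dunkl (y j)) = cov_op (x i) * dunkl (y j) * \<theta> C" for i j
    proof -
      let ?C' = "pr (cov_A (x i)) \<otimes>\<^bsub>H\<^esub> pr (vec_A (y j))"
      have "?C' \<in> ?B" by (rule generate_ring.incl) (auto simp: KB_def)
      then have "\<theta> (C \<otimes>\<^bsub>H\<^esub> ?C') = \<theta> (?C' \<otimes>\<^bsub>H\<^esub> C)" using comm by simp
      then show ?thesis using CH by (simp add: \<theta>_mult \<theta>_pr)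
    qed
    from commuting_is_tensor_eval[OF assms(4) \<theta>_op_image[OF CH] commutes_with_all_XY[OF assms(7) this]]
    obtain f where f: "\<forall>w. w \<notin> scalars_W \<longrightarrow> f w = 0" "\<theta> C = tensor_eval f" by blast
    then have "C = ?mm f" using \<theta>_inj CH mm[of f] by (metis inj_onD)
    then show ?thesis using f(1) by (auto simp: poly_tensor_group_algebra_def)
  qed
  have "centre_of H ?B = ?D"
    using D_centre centre_mm mm_D by blast
  moreover have "bij_betw ?mm (poly_tensor_group_algebra scalars_W) (centre_of H ?B)"
    unfolding bij_betw_def
  proof
    show "inj_on ?mm (poly_tensor_group_algebra scalars_W)"
    proof (rule inj_onI)
      fix f g assume f: "f \<in> poly_tensor_group_algebra scalars_W" and g: "g \<in> poly_tensor_group_algebra scalars_W"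
        and eq: "?mm f = ?mm g"
      have "tensor_eval f = tensor_eval g" using mm(2) eq by metis
      then have "tensor_eval (\<lambda>w. f w + - g w) = 0"
        using tensor_eval_add[of "\<lambda>w. f w + - g w" g] by simp
      then have "f w + - g w = 0" if "w \<in> scalars_W" for w using that by (rule tensor_eval_inj)
      then have "f w = g w" if "w \<in> scalars_W" for w using that by simp
      moreover have "f w = g w" if "w \<notin> scalars_W" for w
        using f g that by (simp add: poly_tensor_group_algebra_def)
      ultimately show "f = g" by (intro ext) blast
    qed
    show "?mm ` poly_tensor_group_algebra scalars_W = centre_of H ?B"
      using D_centre centre_mm mm_D by blast
  qed
  ultimately show ?thesis unfolding Z B D by blast
qed

end
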